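(* Let $\mathcal A=\mathcal B\ltimes_\eta\mathsf F$ be an image-nilpotent $\eta$-extension, let $n\ge1$, and let $\mathcal P,\mathcal R$ be classes of objects in $\mathcal A$. Assume that (1) $\mathcal R$ is closed under extensions and direct summands; (2) $\mathcal P^\vee_{n-1}$ is closed under extensions; (3) $\operatorname{Ext}^i_{\mathcal A}(\mathcal P,\mathcal R)=0$ for $1\le i\le n$; (4) $\operatorname{Ext}^2_{\mathcal A}(\mathcal P^\vee_{n-1},\mathcal R)=0$. Then the following conditions are equivalent: (a) $(\mathcal P,\mathcal R)$ is a right $n$-cotorsion pair in $\mathcal A$; (b) for every $B\in\mathcal B$ there is a short exact sequence $0\to\mathsf Z(B)\to R_B\to P_B\to0$ in $\mathcal A$ with $R_B\in\mathcal R$ and $P_B\in\mathcal P^\vee_{n-1}$. If $\mathcal R$ is coresolving, then condition (4) follows from condition (3).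
   Context: Conventions: abelian categories under consideration (in particular $\mathcal B$ and $\mathcal A$) have enough projective and enough injective objects; subcategories (classes of objects, viewed as full subcategories) are full, additive and closed under isomorphisms. $\operatorname{Ext}^i(\mathcal X,\mathcal Y)=0$ means $\operatorname{Ext}^i(X,Y)=0$ for all $X\in\mathcal X$, $Y\in\mathcal Y$. Let $\mathcal B$ be an abelian category, $\mathsf F:\mathcal B\to\mathcal B$ a covariant right exact additive functor, and $\eta:\mathsf F^2\to\mathsf F$ a natural transformation that is associative, i.e. $\eta\circ\mathsf F\eta=\eta\circ\eta\mathsf F$. The $\eta$-extension $\mathcal A=\mathcal B\ltimes_\eta\mathsf F$ is the category whose objects are pairs $(B,f)$ with $f:\mathsf F(B)\to B$ satisfying $f\,\mathsf F(f)=f\,\eta_B$, and whose morphisms $(B,f)\to(B',f')$ are morphisms $\alpha:B\to B'$ with $\alpha f=f'\mathsf F(\alpha)$. It is abelian, with exactness detected in $\mathcal B$. $\mathsf Z:\mathcal B\to\mathcal A$ is $\mathsf Z(X)=(X,0)$. For $A=(B,f)$ with image factorization $f=i_Aq_A$ ($q_A:\mathsf F(B)\twoheadrightarrow\operatorname{Im}f$, $i_A:\operatorname{Im}f\rightarrowtail B$), put $\mathsf I(A)=(\operatorname{Im}f,\,q_A\mathsf F(i_A))\in\mathcal A$; $\mathsf I^0(A)=A$, $\mathsf I^{r+1}(A)=\mathsf I(\mathsf I^r(A))$. $\mathcal A$ is image-nilpotent if for every $A\in\mathcal A$ there is $d\ge0$ with $\mathsf I^d(A)=0$. For a class $\mathcal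 M$ in an abelian category, $\mathcal M^\vee_m$ is the class of objects $N$ admitting an exact sequence $0\to N\to M^0\to\cdots\to M^m\to0$ with all $M^j\in\mathcal M$. A pair $(\mathcal X,\mathcal Y)$ of classes in an abelian category $\mathcal E$ is a right $n$-cotorsion pair if: $\mathcal Y$ is closed under direct summands; $\operatorname{Ext}^i_{\mathcal E}(\mathcal X,\mathcal Y)=0$ for $1\le i\le n$; and every $E\in\mathcal E$ admits a short exact sequence $0\to E\to Y_E\to X_E\to0$ with $Y_E\in\mathcal Y$ and $X_E\in\mathcal X^\vee_{n-1}$. A full additive subcategory is coresolving if it contains all injective objects, is closed under extensions, and is closed under cokernels of monomorphisms. *)

theory Defs
  imports "HOL-Algebra.Elementary_Groups"
begin

section \<open>Abelian categories\<close>

text \<open>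
  \<open>Comp C g f\<close> is the composite ``g after f''; its value is only meaningful if
  \<open>Cod C f = Dom C g\<close>. Likewise \<open>Add C f g\<close> is only meaningful for parallel arrows.
\<close>

record ('o, 'm) acat =
  Obj :: "'o set"
  Arr :: "'m set"
  Dom :: "'m \<Rightarrow> 'o"
  Cod :: "'m \<Rightarrow> 'o"
  Ident :: "'o \<Rightarrow> 'm"
  Comp :: "'m \<Rightarrow> 'm \<Rightarrow> 'm"  (infixl "\<cdot>\<index>" 75)
  Add :: "'m \<Rightarrow> 'm \<Rightarrow> 'm"  (infixl "\<boxplus>\<index>" 65)
  Zero :: "'o \<Rightarrow> 'o \<Rightarrow> 'm"

definition Hom :: "('o, 'm) acat \<Rightarrow> 'o \<Rightarrow> 'o \<Rightarrow> 'm set" where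
  "Hom C X Y = {f \<in> Arr C. Dom C f = X \<and> Cod C f = Y}"

definition hom_group :: "('o, 'm) acat \<Rightarrow> 'o \<Rightarrow> 'o \<Rightarrow> 'm monoid" where
  "hom_group C X Y = \<lparr>carrier = Hom C X Y, mult = Add C, one = Zero C X Y\<rparr>"

locale category =
  fixes C :: "('o, 'm) acat" (structure)
  assumes dom_obj: "f \<in> Arr C \<Longrightarrow> Dom C f \<in> Obj C"
    and cod_obj: "f \<in> Arr C \<Longrightarrow> Cod C f \<in> Obj C"
    and ident_hom: "X \<in> Obj C \<Longrightarrow> Ident C X \<in> Hom C X X"
    and comp_hom: "\<lbrakk>f \<in> Hom C X Y; g \<in> Hom C Y Z\<rbrakk> \<Longrightarrow> g \<cdot> f \<in> Hom C X Z"
    and comp_ident_right: "f \<in> Hom C X Y \<Longrightarrow> f \<cdot> Ident C X = f"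
    and comp_ident_left: "f \<in> Hom C X Y \<Longrightarrow> Ident C Y \<cdot> f = f"
    and comp_assoc: "\<lbrakk>f \<in> Hom C W X; g \<in> Hom C X Y; h \<in> Hom C Y Z\<rbrakk>
      \<Longrightarrow> (h \<cdot> g) \<cdot> f = h \<cdot> (g \<cdot> f)"

locale preadditive_category = category +
  assumes hom_comm_group: "\<lbrakk>X \<in> Obj C; Y \<in> Obj C\<rbrakk> \<Longrightarrow> comm_group (hom_group C X Y)"
    and comp_add_left: "\<lbrakk>f \<in> Hom C X Y; g \<in> Hom C Y Z; h \<in> Hom C Y Z\<rbrakk>
      \<Longrightarrow> (g \<boxplus> h) \<cdot> f = (g \<cdot> f) \<boxplus> (h \<cdot> f)"
    and comp_add_right: "\<lbrakk>f \<in> Hom C X Y; g \<in> Hom C X Y; h \<in> Hom C Y Z\<rbrakk>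
      \<Longrightarrow> h \<cdot> (f \<boxplus> g) = (h \<cdot> f) \<boxplus> (h \<cdot> g)"

definition is_mono :: "('o, 'm) acat \<Rightarrow> 'm \<Rightarrow> bool" where
  "is_mono C f \<longleftrightarrow> f \<in> Arr C \<and>
     (\<forall>W. \<forall>g \<in> Hom C W (Dom C f). \<forall>h \<in> Hom C W (Dom C f).
        f \<cdot>\<^bsub>C\<^esub> g = f \<cdot>\<^bsub>C\<^esub> h \<longrightarrow> g = h)"

definition is_epi :: "('o, 'm) acat \<Rightarrow> 'm \<Rightarrow> bool" where
  "is_epi C f \<longleftrightarrow> f \<in> Arr C \<and>
     (\<forall>W. \<forall>g \<in> Hom C (Cod C f) W. \<forall>h \<in> Hom C (Cod C f) W.
        g \<cdot>\<^bsub>C\<^esub> f = h \<cdot>\<^bsub>C\<^esub> f \<longrightarrow> g = h)"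

definition isomorphic :: "('o, 'm) acat \<Rightarrow> 'o \<Rightarrow> 'o \<Rightarrow> bool" where
  "isomorphic C X Y \<longleftrightarrow> X \<in> Obj C \<and> Y \<in> Obj C \<and>
     (\<exists>f \<in> Hom C X Y. \<exists>g \<in> Hom C Y X.
        g \<cdot>\<^bsub>C\<^esub> f = Ident C X \<and> f \<cdot>\<^bsub>C\<^esub> g = Ident C Y)"

definition is_zero :: "('o, 'm) acat \<Rightarrow> 'o \<Rightarrow> bool" where
  "is_zero C Z \<longleftrightarrow> Z \<in> Obj C \<and>
     (\<forall>X \<in> Obj C. (\<exists>!f. f \<in> Hom C Z X) \<and> (\<exists>!f. f \<in> Hom C X Z))"

definition is_biproduct ::
  "('o, 'm) acat \<Rightarrow> 'o \<Rightarrow> 'o \<Rightarrow> 'o \<Rightarrow> bool" where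
  "is_biproduct C X Y S \<longleftrightarrow> X \<in> Obj C \<and> Y \<in> Obj C \<and> S \<in> Obj C \<and>
     (\<exists>i1 \<in> Hom C X S. \<exists>i2 \<in> Hom C Y S. \<exists>p1 \<in> Hom C S X. \<exists>p2 \<in> Hom C S Y.
        p1 \<cdot>\<^bsub>C\<^esub> i1 = Ident C X \<and> p2 \<cdot>\<^bsub>C\<^esub> i2 = Ident C Y \<and>
        p2 \<cdot>\<^bsub>C\<^esub> i1 = Zero C X Y \<and> p1 \<cdot>\<^bsub>C\<^esub> i2 = Zero C Y X \<and>
        (i1 \<cdot>\<^bsub>C\<^esub> p1) \<boxplus>\<^bsub>C\<^esub> (i2 \<cdot>\<^bsub>C\<^esub> p2) = Ident C S)"

definition is_kernel :: "('o, 'm) acat \<Rightarrow> 'm \<Rightarrow> 'm \<Rightarrow> bool" where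
  "is_kernel C k f \<longleftrightarrow> f \<in> Arr C \<and> k \<in> Arr C \<and> Cod C k = Dom C f \<and>
     f \<cdot>\<^bsub>C\<^esub> k = Zero C (Dom C k) (Cod C f) \<and>
     (\<forall>W. \<forall>h \<in> Hom C W (Dom C f). f \<cdot>\<^bsub>C\<^esub> h = Zero C W (Cod C f) \<longrightarrow>
        (\<exists>!u. u \<in> Hom C W (Dom C k) \<and> k \<cdot>\<^bsub>C\<^esub> u = h))"

definition is_cokernel :: "('o, 'm) acat \<Rightarrow> 'm \<Rightarrow> 'm \<Rightarrow> bool" where
  "is_cokernel C c f \<longleftrightarrow> f \<in> Arr C \<and> c \<in> Arr C \<and> Dom C c = Cod C f \<and>
     c \<cdot>\<^bsub>C\<^esub> f = Zero C (Dom C f) (Cod C c) \<and>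
     (\<forall>W. \<forall>h \<in> Hom C (Cod C f) W. h \<cdot>\<^bsub>C\<^esub> f = Zero C (Dom C f) W \<longrightarrow>
        (\<exists>!u. u \<in> Hom C (Cod C c) W \<and> u \<cdot>\<^bsub>C\<^esub> c = h))"

locale abelian_category = preadditive_category +
  assumes ex_zero: "\<exists>Z. is_zero C Z"
    and ex_biproduct: "\<lbrakk>X \<in> Obj C; Y \<in> Obj C\<rbrakk> \<Longrightarrow> \<exists>S. is_biproduct C X Y S"
    and ex_kernel: "f \<in> Arr C \<Longrightarrow> \<exists>k. is_kernel C k f"
    and ex_cokernel: "f \<in> Arr C \<Longrightarrow> \<exists>c. is_cokernel C c f"
    and mono_normal: "is_mono C f \<Longrightarrow> \<exists>g. is_kernel C f g"
    and epi_normal: "is_epi C f \<Longrightarrow> \<exists>g. is_cokernel C f g"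

text \<open>\<open>is_image_fact C f i q\<close>: \<open>f = i q\<close> with \<open>q\<close> epi and \<open>i\<close> mono, so \<open>Im f = Dom C i\<close>.\<close>

definition is_image_fact :: "('o, 'm) acat \<Rightarrow> 'm \<Rightarrow> 'm \<Rightarrow> 'm \<Rightarrow> bool" where
  "is_image_fact C f i q \<longleftrightarrow>
     is_mono C i \<and> is_epi C q \<and> Cod C q = Dom C i \<and> f = i \<cdot>\<^bsub>C\<^esub> q"

definition exact :: "('o, 'm) acat \<Rightarrow> 'm \<Rightarrow> 'm \<Rightarrow> bool" where
  "exact C f g \<longleftrightarrow> f \<in> Arr C \<and> g \<in> Arr C \<and> Cod C f = Dom C g \<and>
     (\<exists>i q. is_image_fact C f i q \<and> is_kernel C i g)"

text \<open>\<open>ses C X Y Z f g\<close>: the sequence \<open>0 \<rightarrow> X \<rightarrow> Y \<rightarrow> Z \<rightarrow> 0\<close> with maps \<open>f\<close>, \<open>g\<close> is exact.\<close>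

definition ses :: "('o, 'm) acat \<Rightarrow> 'o \<Rightarrow> 'o \<Rightarrow> 'o \<Rightarrow> 'm \<Rightarrow> 'm \<Rightarrow> bool" where
  "ses C X Y Z f g \<longleftrightarrow> f \<in> Hom C X Y \<and> g \<in> Hom C Y Z \<and>
     is_mono C f \<and> exact C f g \<and> is_epi C g"

definition projective :: "('o, 'm) acat \<Rightarrow> 'o \<Rightarrow> bool" where
  "projective C P \<longleftrightarrow> P \<in> Obj C \<and>
     (\<forall>e. is_epi C e \<longrightarrow>
        (\<forall>f \<in> Hom C P (Cod C e). \<exists>g \<in> Hom C P (Dom C e). e \<cdot>\<^bsub>C\<^esub> g = f))"

definition injective :: "('o, 'm) acat \<Rightarrow> 'o \<Rightarrow> bool" where
  "injective C J \<longleftrightarrow> J \<in> Obj C \<and>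
     (\<forall>m. is_mono C m \<longrightarrow>
        (\<forall>f \<in> Hom C (Dom C m) J. \<exists>g \<in> Hom C (Cod C m) J. g \<cdot>\<^bsub>C\<^esub> m = f))"

definition enough_projectives :: "('o, 'm) acat \<Rightarrow> bool" where
  "enough_projectives C \<longleftrightarrow>
     (\<forall>X \<in> Obj C. \<exists>P e. projective C P \<and> e \<in> Hom C P X \<and> is_epi C e)"

definition enough_injectives :: "('o, 'm) acat \<Rightarrow> bool" where
  "enough_injectives C \<longleftrightarrow>
     (\<forall>X \<in> Obj C. \<exists>J m. injective C J \<and> m \<in> Hom C X J \<and> is_mono C m)"

section \<open>Ext groups\<close>

text \<open>\<open>d i\<close> is the differential \<open>P (i + 1) \<rightarrow> P i\<close> and \<open>e\<close> the augmentation \<open>P 0 \<rightarrow> X\<close>.\<close>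

definition is_proj_resolution ::
  "('o, 'm) acat \<Rightarrow> 'o \<Rightarrow> (nat \<Rightarrow> 'o) \<Rightarrow> (nat \<Rightarrow> 'm) \<Rightarrow> 'm \<Rightarrow> bool" where
  "is_proj_resolution C X P d e \<longleftrightarrow>
     (\<forall>i. projective C (P i)) \<and> (\<forall>i. d i \<in> Hom C (P (Suc i)) (P i)) \<and>
     e \<in> Hom C (P 0) X \<and> is_epi C e \<and> exact C (d 0) e \<and>
     (\<forall>i. exact C (d (Suc i)) (d i))"

definition chosen_resolution ::
  "('o, 'm) acat \<Rightarrow> 'o \<Rightarrow> (nat \<Rightarrow> 'o) \<times> (nat \<Rightarrow> 'm) \<times> 'm" where
  "chosen_resolution C X = (SOME (P, d, e). is_proj_resolution C X P d e)"

definition cocycles ::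
  "('o, 'm) acat \<Rightarrow> (nat \<Rightarrow> 'o) \<Rightarrow> (nat \<Rightarrow> 'm) \<Rightarrow> 'o \<Rightarrow> nat \<Rightarrow> 'm set" where
  "cocycles C P d Y i =
     {f \<in> Hom C (P i) Y. f \<cdot>\<^bsub>C\<^esub> d i = Zero C (P (Suc i)) Y}"

fun coboundaries ::
  "('o, 'm) acat \<Rightarrow> (nat \<Rightarrow> 'o) \<Rightarrow> (nat \<Rightarrow> 'm) \<Rightarrow> 'o \<Rightarrow> nat \<Rightarrow> 'm set" where
  "coboundaries C P d Y 0 = {Zero C (P 0) Y}"
| "coboundaries C P d Y (Suc i) = (\<lambda>g. g \<cdot>\<^bsub>C\<^esub> d i) ` Hom C (P i) Y"

text \<open>
  \<open>Ext C i X Y\<close> is the \<open>i\<close>-th right derived functor of \<open>Hom(-, Y)\<close> at \<open>X\<close>: the \<open>i\<close>-th cohomology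
  group of \<open>Hom(P, Y)\<close> for a projective resolution \<open>P\<close> of \<open>X\<close>, which exists if the abelian
  category \<open>C\<close> has enough projectives; up to isomorphism the choice of \<open>P\<close> is immaterial.
\<close>

definition Ext :: "('o, 'm) acat \<Rightarrow> nat \<Rightarrow> 'o \<Rightarrow> 'o \<Rightarrow> 'm set monoid" where
  "Ext C i X Y = (case chosen_resolution C X of (P, d, e) \<Rightarrow>
     (hom_group C (P i) Y)\<lparr>carrier := cocycles C P d Y i\<rparr> Mod coboundaries C P d Y i)"

definition Ext_vanishes :: "('o, 'm) acat \<Rightarrow> nat \<Rightarrow> 'o set \<Rightarrow> 'o set \<Rightarrow> bool" where
  "Ext_vanishes C i \<X> \<Y> \<longleftrightarrow> (\<forall>X \<in> \<X>. \<forall>Y \<in> \<Y>. trivial_group (Ext C i X Y))"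

section \<open>Classes of objects\<close>

definition additive_subcategory :: "('o, 'm) acat \<Rightarrow> 'o set \<Rightarrow> bool" where
  "additive_subcategory C \<M> \<longleftrightarrow> \<M> \<subseteq> Obj C \<and>
     (\<forall>X \<in> \<M>. \<forall>Y. isomorphic C X Y \<longrightarrow> Y \<in> \<M>) \<and>
     (\<exists>Z \<in> \<M>. is_zero C Z) \<and>
     (\<forall>X \<in> \<M>. \<forall>Y \<in> \<M>. \<forall>S. is_biproduct C X Y S \<longrightarrow> S \<in> \<M>)"

definition closed_under_extensions :: "('o, 'm) acat \<Rightarrow> 'o set \<Rightarrow> bool" where
  "closed_under_extensions C \<M> \<longleftrightarrow>
     (\<forall>X Y Z f g. ses C X Y Z f g \<and> X \<in> \<M> \<and> Z \<in> \<M> \<longrightarrow> Y \<in> \<M>)"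

definition closed_under_summands :: "('o, 'm) acat \<Rightarrow> 'o set \<Rightarrow> bool" where
  "closed_under_summands C \<M> \<longleftrightarrow>
     (\<forall>X Y S. is_biproduct C X Y S \<and> S \<in> \<M> \<longrightarrow> X \<in> \<M>)"

definition closed_under_mono_cokernels :: "('o, 'm) acat \<Rightarrow> 'o set \<Rightarrow> bool" where
  "closed_under_mono_cokernels C \<M> \<longleftrightarrow>
     (\<forall>X Y Z f g. ses C X Y Z f g \<and> X \<in> \<M> \<and> Y \<in> \<M> \<longrightarrow> Z \<in> \<M>)"

definition coresolving :: "('o, 'm) acat \<Rightarrow> 'o set \<Rightarrow> bool" where
  "coresolving C \<M> \<longleftrightarrow> additive_subcategory C \<M> \<and>
     (\<forall>J. injective C J \<longrightarrow> J \<in> \<M>) \<and>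
     closed_under_extensions C \<M> \<and> closed_under_mono_cokernels C \<M>"

text \<open>
  \<open>coresolved C \<M> m\<close> is the class \<open>\<M>\<close> with superscript \<open>\<or>\<close> and subscript \<open>m\<close>: the objects \<open>N\<close>
  with an exact sequence \<open>0 \<rightarrow> N \<rightarrow> M\<^sup>0 \<rightarrow> \<dots> \<rightarrow> M\<^sup>m \<rightarrow> 0\<close>. The sequence is encoded as
  \<open>S 0 = N\<close>, \<open>S (j + 1) = M\<^sup>j\<close>, with maps \<open>d j : S j \<rightarrow> S (j + 1)\<close> for \<open>j \<le> m\<close>.
\<close>

definition coresolved :: "('o, 'm) acat \<Rightarrow> 'o set \<Rightarrow> nat \<Rightarrow> 'o set" where
  "coresolved C \<M> m = {N. \<exists>S d. S 0 = N \<and>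
     (\<forall>j \<le> m. S (Suc j) \<in> \<M> \<and> d j \<in> Hom C (S j) (S (Suc j))) \<and>
     is_mono C (d 0) \<and> (\<forall>j < m. exact C (d j) (d (Suc j))) \<and> is_epi C (d m)}"

definition right_cotorsion_pair ::
  "('o, 'm) acat \<Rightarrow> nat \<Rightarrow> 'o set \<Rightarrow> 'o set \<Rightarrow> bool" where
  "right_cotorsion_pair C n \<X> \<Y> \<longleftrightarrow>
     closed_under_summands C \<Y> \<and> (\<forall>i \<in> {1..n}. Ext_vanishes C i \<X> \<Y>) \<and>
     (\<forall>E \<in> Obj C. \<exists>Y \<in> \<Y>. \<exists>X \<in> coresolved C \<X> (n - 1). \<exists>f g. ses C E Y X f g)"

section \<open>Functors and natural transformations\<close>

record ('o, 'm, 'p, 'n) fctr =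
  OMap :: "'o \<Rightarrow> 'p"
  AMap :: "'m \<Rightarrow> 'n"

definition functor_comp ::
  "('p, 'n, 'q, 'k) fctr \<Rightarrow> ('o, 'm, 'p, 'n) fctr \<Rightarrow> ('o, 'm, 'q, 'k) fctr" where
  "functor_comp G F = \<lparr>OMap = OMap G \<circ> OMap F, AMap = AMap G \<circ> AMap F\<rparr>"

definition is_functor ::
  "('o, 'm) acat \<Rightarrow> ('p, 'n) acat \<Rightarrow> ('o, 'm, 'p, 'n) fctr \<Rightarrow> bool" where
  "is_functor C D F \<longleftrightarrow>
     (\<forall>X \<in> Obj C. OMap F X \<in> Obj D) \<and>
     (\<forall>X Y. \<forall>f \<in> Hom C X Y. AMap F f \<in> Hom D (OMap F X) (OMap F Y)) \<and>
     (\<forall>X \<in> Obj C. AMap F (Ident C X) = Ident D (OMap F X)) \<and>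
     (\<forall>X Y Z. \<forall>f \<in> Hom C X Y. \<forall>g \<in> Hom C Y Z.
        AMap F (g \<cdot>\<^bsub>C\<^esub> f) = AMap F g \<cdot>\<^bsub>D\<^esub> AMap F f)"

definition is_additive_functor ::
  "('o, 'm) acat \<Rightarrow> ('p, 'n) acat \<Rightarrow> ('o, 'm, 'p, 'n) fctr \<Rightarrow> bool" where
  "is_additive_functor C D F \<longleftrightarrow> is_functor C D F \<and>
     (\<forall>X Y. \<forall>f \<in> Hom C X Y. \<forall>g \<in> Hom C X Y.
        AMap F (f \<boxplus>\<^bsub>C\<^esub> g) = AMap F f \<boxplus>\<^bsub>D\<^esub> AMap F g)"

definition right_exact ::
  "('o, 'm) acat \<Rightarrow> ('p, 'n) acat \<Rightarrow> ('o, 'm, 'p, 'n) fctr \<Rightarrow> bool" where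
  "right_exact C D F \<longleftrightarrow>
     (\<forall>X Y Z f g. ses C X Y Z f g \<longrightarrow>
        exact D (AMap F f) (AMap F g) \<and> is_epi D (AMap F g))"

definition nat_trans ::
  "('o, 'm) acat \<Rightarrow> ('p, 'n) acat \<Rightarrow> ('o, 'm, 'p, 'n) fctr \<Rightarrow> ('o, 'm, 'p, 'n) fctr
     \<Rightarrow> ('o \<Rightarrow> 'n) \<Rightarrow> bool" where
  "nat_trans C D F G \<eta> \<longleftrightarrow>
     (\<forall>X \<in> Obj C. \<eta> X \<in> Hom D (OMap F X) (OMap G X)) \<and>
     (\<forall>X Y. \<forall>f \<in> Hom C X Y. \<eta> Y \<cdot>\<^bsub>D\<^esub> AMap F f = AMap G f \<cdot>\<^bsub>D\<^esub> \<eta> X)"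

section \<open>The \<open>\<eta>\<close>-extension\<close>

definition eta_associative ::
  "('o, 'm) acat \<Rightarrow> ('o, 'm, 'o, 'm) fctr \<Rightarrow> ('o \<Rightarrow> 'm) \<Rightarrow> bool" where
  "eta_associative B F \<eta> \<longleftrightarrow>
     (\<forall>X \<in> Obj B. \<eta> X \<cdot>\<^bsub>B\<^esub> AMap F (\<eta> X) = \<eta> X \<cdot>\<^bsub>B\<^esub> \<eta> (OMap F X))"

definition eta_objects ::
  "('o, 'm) acat \<Rightarrow> ('o, 'm, 'o, 'm) fctr \<Rightarrow> ('o \<Rightarrow> 'm) \<Rightarrow> ('o \<times> 'm) set" where
  "eta_objects B F \<eta> =
     {(X, f). X \<in> Obj B \<and> f \<in> Hom B (OMap F X) X \<and>
        f \<cdot>\<^bsub>B\<^esub> AMap F f = f \<cdot>\<^bsub>B\<^esub> \<eta> X}"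

definition eta_arrows ::
  "('o, 'm) acat \<Rightarrow> ('o, 'm, 'o, 'm) fctr \<Rightarrow> ('o \<Rightarrow> 'm)
     \<Rightarrow> (('o \<times> 'm) \<times> 'm \<times> ('o \<times> 'm)) set" where
  "eta_arrows B F \<eta> =
     {((X, f), \<alpha>, (X', f')) | X f \<alpha> X' f'.
        (X, f) \<in> eta_objects B F \<eta> \<and> (X', f') \<in> eta_objects B F \<eta> \<and>
        \<alpha> \<in> Hom B X X' \<and> \<alpha> \<cdot>\<^bsub>B\<^esub> f = f' \<cdot>\<^bsub>B\<^esub> AMap F \<alpha>}"

text \<open>
  An arrow of the extension is a triple (source, underlying arrow of \<open>B\<close>, target), since the same
  arrow of \<open>B\<close> may underlie arrows between different objects.
\<close>

definition eta_extension ::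
  "('o, 'm) acat \<Rightarrow> ('o, 'm, 'o, 'm) fctr \<Rightarrow> ('o \<Rightarrow> 'm)
     \<Rightarrow> ('o \<times> 'm, ('o \<times> 'm) \<times> 'm \<times> ('o \<times> 'm)) acat" where
  "eta_extension B F \<eta> =
     \<lparr>Obj = eta_objects B F \<eta>,
      Arr = eta_arrows B F \<eta>,
      Dom = (\<lambda>(U, \<alpha>, V). U),
      Cod = (\<lambda>(U, \<alpha>, V). V),
      Ident = (\<lambda>U. (U, Ident B (fst U), U)),
      Comp = (\<lambda>(V', \<beta>, W) (U, \<alpha>, V). (U, \<beta> \<cdot>\<^bsub>B\<^esub> \<alpha>, W)),
      Add = (\<lambda>(U, \<alpha>, V) (U', \<beta>, V'). (U, \<alpha> \<boxplus>\<^bsub>B\<^esub> \<beta>, V)),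
      Zero = (\<lambda>U V. (U, Zero B (fst U) (fst V), V))\<rparr>"

definition Z_functor ::
  "('o, 'm) acat \<Rightarrow> ('o, 'm, 'o, 'm) fctr
     \<Rightarrow> ('o, 'm, 'o \<times> 'm, ('o \<times> 'm) \<times> 'm \<times> ('o \<times> 'm)) fctr" where
  "Z_functor B F =
     \<lparr>OMap = (\<lambda>X. (X, Zero B (OMap F X) X)),
      AMap = (\<lambda>\<alpha>. ((Dom B \<alpha>, Zero B (OMap F (Dom B \<alpha>)) (Dom B \<alpha>)), \<alpha>,
                    (Cod B \<alpha>, Zero B (OMap F (Cod B \<alpha>)) (Cod B \<alpha>))))\<rparr>"

text \<open>
  The object \<open>I(X, f) = (Im f, q F(i))\<close> for a chosen image factorization \<open>f = i q\<close>; another choice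
  gives an isomorphic object.
\<close>

definition image_object ::
  "('o, 'm) acat \<Rightarrow> ('o, 'm, 'o, 'm) fctr \<Rightarrow> 'o \<times> 'm \<Rightarrow> 'o \<times> 'm" where
  "image_object B F A =
     (case (SOME (i, q). is_image_fact B (snd A) i q) of
        (i, q) \<Rightarrow> (Dom B i, q \<cdot>\<^bsub>B\<^esub> AMap F i))"

definition image_nilpotent ::
  "('o, 'm) acat \<Rightarrow> ('o, 'm, 'o, 'm) fctr \<Rightarrow> ('o \<Rightarrow> 'm) \<Rightarrow> bool" where
  "image_nilpotent B F \<eta> \<longleftrightarrow>
     (\<forall>A \<in> Obj (eta_extension B F \<eta>). \<exists>d.
        is_zero (eta_extension B F \<eta>) ((image_object B F ^^ d) A))"

end

theory Submission
  imports Defs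
begin

text \<open>
  An object \<open>(X, f)\<close> of the extension is an extension of \<open>Z(Coker f)\<close> by \<open>I(X, f)\<close>, so image
  nilpotency reduces the construction of approximations to objects in the image of \<open>Z\<close>, provided
  approximations can be combined along a short exact sequence \<open>0 \<rightarrow> A1 \<rightarrow> A \<rightarrow> A2 \<rightarrow> 0\<close>. Given
  \<open>0 \<rightarrow> Ai \<rightarrow> Ri \<rightarrow> Pi \<rightarrow> 0\<close>, pushing out along \<open>A1 \<rightarrow> R1\<close> yields an extension of \<open>A2\<close> by \<open>R1\<close>; the
  obstruction to prolonging it to an extension of \<open>R2\<close> by \<open>R1\<close> lies in \<open>Ext\<^sup>2(P2, R1) = 0\<close>.
  For coresolving \<open>\<R>\<close>, cosyzygies of objects of \<open>\<R>\<close> along injectives stay in \<open>\<R>\<close>; hence the class of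
  objects left \<open>Ext\<^sup>1\<close>-orthogonal to \<open>\<R>\<close> is closed under kernels of epimorphisms and is also
  \<open>Ext\<^sup>2\<close>-orthogonal to \<open>\<R>\<close>.
\<close>

section \<open>Kernels, cokernels and short exact sequences\<close>

text \<open>\<open>Ext\<close> is computed from one chosen projective resolution, and the argument
  uses neither Yoneda classes nor long exact sequences. Each vanishing hypothesis is read as
  "cocycles are coboundaries" on that resolution and turned at once into a lifting or extension
  property of arrows, on which diagram chases can act. The obstruction in Ext^2(P2, R1) becomes
  concrete in this way: if Q 0 -> P2 starts the resolution and K is its kernel, the extension R2 of
  P2 by A2 comes from a map K -> A2, and Ext^2(P2, R1) = 0 lifts this map to the pushed out
  extension of A2 by R1; one more pushout gives the middle object R. Two filtrations have to come
  out together: R must be an extension of R2 by R1, and the cokernel of A -> R an extension of P2 by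
  P1, because closure under extensions is applied to both. These chases run in the extension
  category, which must first be shown abelian. Its kernels and cokernels are those of the base
  category; the delicate side is the cokernels, whose structure map exists because F is right
  exact.\<close>

context category begin

lemma Hom_iff: "f \<in> Hom C X Y \<longleftrightarrow> f \<in> Arr C \<and> Dom C f = X \<and> Cod C f = Y"
  by (simp add: Hom_def)

lemma Hom_obj: "f \<in> Hom C X Y \<Longrightarrow> X \<in> Obj C \<and> Y \<in> Obj C"
  using dom_obj cod_obj by (auto simp: Hom_iff)

lemma arr_Hom: "f \<in> Arr C \<Longrightarrow> f \<in> Hom C (Dom C f) (Cod C f)"
  by (simp add: Hom_iff)

lemma comp_arr [simp]:
  assumes "f \<in> Arr C" "g \<in> Arr C" "Cod C f = Dom C g"
  shows "g \<cdot> f \<in> Arr C" "Dom C (g \<cdot> f) = Dom C f" "Cod C (g \<cdot> f) = Cod C g"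
  using comp_hom[of f "Dom C f" "Cod C f" g "Cod C g"] assms by (auto simp: Hom_iff)

lemma ident_arr [simp]:
  assumes "X \<in> Obj C"
  shows "Ident C X \<in> Arr C" "Dom C (Ident C X) = X" "Cod C (Ident C X) = X"
  using ident_hom[OF assms] by (auto simp: Hom_iff)

lemma comp_ident [simp]:
  "\<lbrakk>f \<in> Arr C; X = Dom C f\<rbrakk> \<Longrightarrow> f \<cdot> Ident C X = f"
  "\<lbrakk>f \<in> Arr C; X = Cod C f\<rbrakk> \<Longrightarrow> Ident C X \<cdot> f = f"
  using comp_ident_right comp_ident_left arr_Hom by blast+

lemma assoc:
  assumes "f \<in> Arr C" "g \<in> Arr C" "h \<in> Arr C" "Cod C f = Dom C g" "Cod C g = Dom C h"
  shows "(h \<cdot> g) \<cdot> f = h \<cdot> (g \<cdot> f)"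
  using comp_assoc assms by (auto simp: Hom_iff)

text \<open>Simplification nests composites to the right, where the left side of a known equation
  \<open>g \<cdot> f = h\<close> is no longer a subterm. This form of the equation still matches
  there.\<close>

lemma assoc_eq:
  assumes "g \<cdot> f = h" "x \<in> Arr C" "f \<in> Arr C" "g \<in> Arr C" "Cod C x = Dom C f" "Cod C f = Dom C g"
  shows "g \<cdot> (f \<cdot> x) = h \<cdot> x"
  using assoc[of x f g] assms by simp

lemma mono_arr: "is_mono C f \<Longrightarrow> f \<in> Arr C"
  by (simp add: is_mono_def)

lemma epi_arr: "is_epi C f \<Longrightarrow> f \<in> Arr C"
  by (simp add: is_epi_def)

lemma mono_cancel:
  "\<lbrakk>is_mono C m; a \<in> Hom C W (Dom C m); b \<in> Hom C W (Dom C m); m \<cdot> a = m \<cdot> b\<rbrakk> \<Longrightarrow> a = b"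
  unfolding is_mono_def by blast

lemma epi_cancel:
  "\<lbrakk>is_epi C e; a \<in> Hom C (Cod C e) W; b \<in> Hom C (Cod C e) W; a \<cdot> e = b \<cdot> e\<rbrakk> \<Longrightarrow> a = b"
  unfolding is_epi_def by blast

lemma mono_comp:
  assumes "is_mono C f" "is_mono C g" "Cod C f = Dom C g"
  shows "is_mono C (g \<cdot> f)"
  unfolding is_mono_def
proof (intro conjI allI ballI impI)
  have a: "f \<in> Arr C" "g \<in> Arr C" using assms mono_arr by auto
  show "g \<cdot> f \<in> Arr C" using a assms by simp
  fix W x y assume x: "x \<in> Hom C W (Dom C (g \<cdot> f))" and y: "y \<in> Hom C W (Dom C (g \<cdot> f))"
    and e: "g \<cdot> f \<cdot> x = g \<cdot> f \<cdot> y"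
  have "g \<cdot> (f \<cdot> x) = g \<cdot> (f \<cdot> y)"
    using e x y a assms(3) by (simp add: assoc Hom_iff)
  then have "f \<cdot> x = f \<cdot> y"
    using mono_cancel[OF assms(2), of "f \<cdot> x" W "f \<cdot> y"] x y a assms(3) by (simp add: Hom_iff)
  then show "x = y"
    using mono_cancel[OF assms(1), of x W y] x y a assms(3) by (simp add: Hom_iff)
qed

lemma mono_ident: "X \<in> Obj C \<Longrightarrow> is_mono C (Ident C X)"
  by (simp add: is_mono_def Hom_iff)

lemma epi_ident: "X \<in> Obj C \<Longrightarrow> is_epi C (Ident C X)"
  by (simp add: is_epi_def Hom_iff)

lemma epi_right_factor:
  assumes "is_epi C (g \<cdot> f)" "f \<in> Arr C" "g \<in> Arr C" "Cod C f = Dom C g"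
  shows "is_epi C g"
  unfolding is_epi_def
proof (intro conjI allI ballI impI)
  fix W x y assume x: "x \<in> Hom C (Cod C g) W" and y: "y \<in> Hom C (Cod C g) W"
    and e: "x \<cdot> g = y \<cdot> g"
  have "x \<cdot> (g \<cdot> f) = y \<cdot> (g \<cdot> f)"
    using e x y assms assoc[of f g x] assoc[of f g y] by (simp add: Hom_iff)
  then show "x = y"
    using epi_cancel[OF assms(1), of x W y] x y assms by (simp add: Hom_iff)
qed (use assms in simp)

end

section \<open>Hom groups and the universal properties of kernels and cokernels\<close>

context preadditive_category begin

lemma add_hom: "\<lbrakk>f \<in> Hom C X Y; g \<in> Hom C X Y\<rbrakk> \<Longrightarrow> f \<boxplus> g \<in> Hom C X Y"
  and zero_hom: "\<lbrakk>X \<in> Obj C; Y \<in> Obj C\<rbrakk> \<Longrightarrow> Zero C X Y \<in> Hom C X Y"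
  and add_assoc: "\<lbrakk>f \<in> Hom C X Y; g \<in> Hom C X Y; h \<in> Hom C X Y\<rbrakk>
    \<Longrightarrow> (f \<boxplus> g) \<boxplus> h = f \<boxplus> (g \<boxplus> h)"
  and add_comm: "\<lbrakk>f \<in> Hom C X Y; g \<in> Hom C X Y\<rbrakk> \<Longrightarrow> f \<boxplus> g = g \<boxplus> f"
  and add_zero: "f \<in> Hom C X Y \<Longrightarrow> f \<boxplus> Zero C X Y = f"
  and zero_add: "f \<in> Hom C X Y \<Longrightarrow> Zero C X Y \<boxplus> f = f"
  and add_cancel: "\<lbrakk>f \<in> Hom C X Y; g \<in> Hom C X Y; h \<in> Hom C X Y; f \<boxplus> g = f \<boxplus> h\<rbrakk> \<Longrightarrow> g = h"
  and ex_neg: "f \<in> Hom C X Y \<Longrightarrow> \<exists>g \<in> Hom C X Y. f \<boxplus> g = Zero C X Y"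
proof -
  have G: "X \<in> Obj C \<Longrightarrow> Y \<in> Obj C \<Longrightarrow> comm_group (hom_group C X Y)"
    using hom_comm_group by blast
  have H: "f \<in> Hom C X Y \<Longrightarrow> comm_group (hom_group C X Y)" for f
    using hom_comm_group Hom_obj by blast
  have M: "f \<in> Hom C X Y \<Longrightarrow> group (hom_group C X Y)" for f
    using H comm_group.axioms by blast
  show "\<lbrakk>f \<in> Hom C X Y; g \<in> Hom C X Y\<rbrakk> \<Longrightarrow> f \<boxplus> g \<in> Hom C X Y"
    using monoid.m_closed[OF group.is_monoid[OF M], of f f g] by (simp add: hom_group_def)
  show "\<lbrakk>X \<in> Obj C; Y \<in> Obj C\<rbrakk> \<Longrightarrow> Zero C X Y \<in> Hom C X Y"
    using monoid.one_closed[OF group.is_monoid[OF comm_group.axioms(2)[OF G]]]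
    by (simp add: hom_group_def)
  show "\<lbrakk>f \<in> Hom C X Y; g \<in> Hom C X Y; h \<in> Hom C X Y\<rbrakk> \<Longrightarrow> (f \<boxplus> g) \<boxplus> h = f \<boxplus> (g \<boxplus> h)"
    using monoid.m_assoc[OF group.is_monoid[OF M], of f f g h] by (simp add: hom_group_def)
  show comm: "\<lbrakk>f \<in> Hom C X Y; g \<in> Hom C X Y\<rbrakk> \<Longrightarrow> f \<boxplus> g = g \<boxplus> f" for f g
    using comm_monoid.m_comm[OF comm_group.axioms(1)[OF H], of f f g]
    by (simp add: hom_group_def)
  show "f \<in> Hom C X Y \<Longrightarrow> f \<boxplus> Zero C X Y = f"
    using monoid.r_one[OF group.is_monoid[OF M], of f f] by (simp add: hom_group_def)
  show "f \<in> Hom C X Y \<Longrightarrow> Zero C X Y \<boxplus> f = f"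
    using monoid.l_one[OF group.is_monoid[OF M], of f f] by (simp add: hom_group_def)
  show "\<lbrakk>f \<in> Hom C X Y; g \<in> Hom C X Y; h \<in> Hom C X Y; f \<boxplus> g = f \<boxplus> h\<rbrakk> \<Longrightarrow> g = h"
    using group.right_cancel[OF M, of f f g h, unfolded hom_group_def, simplified] comm by metis
  show "f \<in> Hom C X Y \<Longrightarrow> \<exists>g \<in> Hom C X Y. f \<boxplus> g = Zero C X Y"
    using group.r_inv_ex[OF M, of f f] by (simp add: hom_group_def)
qed

lemma zero_arr [simp]:
  assumes "X \<in> Obj C" "Y \<in> Obj C"
  shows "Zero C X Y \<in> Arr C" "Dom C (Zero C X Y) = X" "Cod C (Zero C X Y) = Y"
  using zero_hom[OF assms] by (auto simp: Hom_iff)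

lemma add_arr [simp]:
  assumes "f \<in> Arr C" "g \<in> Arr C" "Dom C f = Dom C g" "Cod C f = Cod C g"
  shows "f \<boxplus> g \<in> Arr C" "Dom C (f \<boxplus> g) = Dom C g" "Cod C (f \<boxplus> g) = Cod C g"
  using add_hom[of f "Dom C g" "Cod C g" g] assms by (auto simp: Hom_iff)

lemma comp_distrib:
  "\<lbrakk>f \<in> Arr C; g \<in> Arr C; h \<in> Arr C; Cod C f = Dom C g; Dom C h = Dom C g; Cod C h = Cod C g\<rbrakk>
    \<Longrightarrow> (g \<boxplus> h) \<cdot> f = (g \<cdot> f) \<boxplus> (h \<cdot> f)"
  "\<lbrakk>f \<in> Arr C; g \<in> Arr C; h \<in> Arr C; Cod C f = Dom C h; Dom C g = Dom C f; Cod C g = Cod C f\<rbrakk>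
    \<Longrightarrow> h \<cdot> (f \<boxplus> g) = (h \<cdot> f) \<boxplus> (h \<cdot> g)"
  by (rule comp_add_left[of f "Dom C f" "Cod C f" g "Cod C g" h]; simp add: Hom_iff)
    (rule comp_add_right[of f "Dom C f" "Cod C f" g h "Cod C h"]; simp add: Hom_iff)

lemma dbl_zero: "\<lbrakk>f \<in> Hom C X Y; f \<boxplus> f = f\<rbrakk> \<Longrightarrow> f = Zero C X Y"
  using add_cancel[of f X Y f "Zero C X Y"] add_zero Hom_obj zero_hom by metis

lemma comp_zero_hom: "\<lbrakk>f \<in> Hom C X Y; W \<in> Obj C\<rbrakk> \<Longrightarrow> f \<cdot> Zero C W X = Zero C W Y"
  and zero_comp_hom: "\<lbrakk>f \<in> Hom C X Y; W \<in> Obj C\<rbrakk> \<Longrightarrow> Zero C Y W \<cdot> f = Zero C X W"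
proof -
  assume f: "f \<in> Hom C X Y" and W: "W \<in> Obj C"
  then have XY: "X \<in> Obj C" "Y \<in> Obj C" using Hom_obj by auto
  have "f \<cdot> (Zero C W X \<boxplus> Zero C W X) = f \<cdot> Zero C W X \<boxplus> f \<cdot> Zero C W X"
    using comp_add_right[OF zero_hom[OF W XY(1)] zero_hom[OF W XY(1)] f] .
  then show "f \<cdot> Zero C W X = Zero C W Y"
    using dbl_zero[of "f \<cdot> Zero C W X" W Y] comp_hom[OF zero_hom[OF W XY(1)] f]
      add_zero[OF zero_hom[OF W XY(1)]] by simp
  have "(Zero C Y W \<boxplus> Zero C Y W) \<cdot> f = Zero C Y W \<cdot> f \<boxplus> Zero C Y W \<cdot> f"
    using comp_add_left[OF f zero_hom[OF XY(2) W] zero_hom[OF XY(2) W]] .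
  then show "Zero C Y W \<cdot> f = Zero C X W"
    using dbl_zero[of "Zero C Y W \<cdot> f" X W] comp_hom[OF f zero_hom[OF XY(2) W]]
      add_zero[OF zero_hom[OF XY(2) W]] by simp
qed

lemma comp_zero [simp]: "\<lbrakk>f \<in> Arr C; X = Dom C f; W \<in> Obj C\<rbrakk> \<Longrightarrow> f \<cdot> Zero C W X = Zero C W (Cod C f)"
  using comp_zero_hom arr_Hom by blast

lemma zero_comp [simp]: "\<lbrakk>f \<in> Arr C; Y = Cod C f; W \<in> Obj C\<rbrakk> \<Longrightarrow> Zero C Y W \<cdot> f = Zero C (Dom C f) W"
  using zero_comp_hom arr_Hom by blast

text \<open>Subtraction is not an operation of the record. Here \<open>x\<close> is a - b, delivered
  with the two facts for which differences are formed: it kills every arrow on which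
  \<open>a\<close> and \<open>b\<close> agree, and it is killed by every arrow that identifies
  them.\<close>

lemma diff_ex:
  assumes "a \<in> Hom C X Y" "b \<in> Hom C X Y"
  obtains x where "x \<in> Hom C X Y" "a = b \<boxplus> x"
    "\<And>d W. \<lbrakk>d \<in> Hom C W X; a \<cdot> d = b \<cdot> d\<rbrakk> \<Longrightarrow> x \<cdot> d = Zero C W Y"
    "\<And>p V. \<lbrakk>p \<in> Hom C Y V; p \<cdot> a = p \<cdot> b\<rbrakk> \<Longrightarrow> p \<cdot> x = Zero C X V"
proof -
  obtain n where n: "n \<in> Hom C X Y" "b \<boxplus> n = Zero C X Y" using ex_neg assms by blast
  define x where "x = n \<boxplus> a"
  have x: "x \<in> Hom C X Y" using n assms add_hom by (simp add: x_def)
  have a: "a = b \<boxplus> x"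
    using add_assoc[OF assms(2) n(1) assms(1)] n zero_add[OF assms(1)] by (simp add: x_def)
  show ?thesis
  proof (rule that[OF x a])
    fix d W assume d: "d \<in> Hom C W X" "a \<cdot> d = b \<cdot> d"
    have "b \<cdot> d \<boxplus> x \<cdot> d = b \<cdot> d \<boxplus> Zero C W Y"
      using comp_add_left[OF d(1) assms(2) x] a d add_zero[OF comp_hom[OF d(1) assms(2)]] by simp
    then show "x \<cdot> d = Zero C W Y"
      using add_cancel comp_hom[OF d(1)] assms x zero_hom Hom_obj d by meson
  next
    fix p V assume d: "p \<in> Hom C Y V" "p \<cdot> a = p \<cdot> b"
    have "p \<cdot> b \<boxplus> p \<cdot> x = p \<cdot> b \<boxplus> Zero C X V"
      using comp_add_right[OF assms(2) x d(1)] a d add_zero[OF comp_hom[OF assms(2) d(1)]] by simp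
    then show "p \<cdot> x = Zero C X V"
      using add_cancel comp_hom[OF _ d(1)] assms x zero_hom Hom_obj d by meson
  qed
qed

lemma monoI_zero:
  assumes "m \<in> Hom C X Y"
    "\<And>W x. \<lbrakk>x \<in> Hom C W X; m \<cdot> x = Zero C W Y\<rbrakk> \<Longrightarrow> x = Zero C W X"
  shows "is_mono C m"
  unfolding is_mono_def
proof (intro conjI allI ballI impI)
  show "m \<in> Arr C" using assms by (simp add: Hom_iff)
  fix W g h assume g: "g \<in> Hom C W (Dom C m)" and h: "h \<in> Hom C W (Dom C m)" and e: "m \<cdot> g = m \<cdot> h"
  have X: "Dom C m = X" using assms by (simp add: Hom_iff)
  obtain x where x: "x \<in> Hom C W X" "g = h \<boxplus> x" "m \<cdot> x = Zero C W Y"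
    using diff_ex[of g W X h] g h e X assms(1) by metis
  then show "g = h" using assms(2) h X add_zero by metis
qed

lemma epiI_zero:
  assumes "m \<in> Hom C X Y"
    "\<And>W x. \<lbrakk>x \<in> Hom C Y W; x \<cdot> m = Zero C X W\<rbrakk> \<Longrightarrow> x = Zero C Y W"
  shows "is_epi C m"
  unfolding is_epi_def
proof (intro conjI allI ballI impI)
  show "m \<in> Arr C" using assms by (simp add: Hom_iff)
  fix W g h assume g: "g \<in> Hom C (Cod C m) W" and h: "h \<in> Hom C (Cod C m) W" and e: "g \<cdot> m = h \<cdot> m"
  have X: "Cod C m = Y" using assms by (simp add: Hom_iff)
  obtain x where x: "x \<in> Hom C Y W" "g = h \<boxplus> x" "x \<cdot> m = Zero C X W"
    using diff_ex[of g Y W h] g h e X assms(1) by metis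
  then show "g = h" using assms(2) h X add_zero by metis
qed

lemma mono_zero:
  assumes "is_mono C m" "m \<in> Hom C X Y" "x \<in> Hom C W X" "m \<cdot> x = Zero C W Y"
  shows "x = Zero C W X"
proof (rule mono_cancel[OF assms(1)])
  have X: "Dom C m = X" using assms(2) by (simp add: Hom_iff)
  show "x \<in> Hom C W (Dom C m)" "Zero C W X \<in> Hom C W (Dom C m)"
    using X assms(3) zero_hom Hom_obj[OF assms(3)] by auto
  show "m \<cdot> x = m \<cdot> Zero C W X"
    using assms(4) comp_zero_hom[OF assms(2)] Hom_obj[OF assms(3)] by metis
qed

lemma epi_zero:
  assumes "is_epi C m" "m \<in> Hom C X Y" "x \<in> Hom C Y W" "x \<cdot> m = Zero C X W"
  shows "x = Zero C Y W"
proof (rule epi_cancel[OF assms(1)])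
  have Y: "Cod C m = Y" using assms(2) by (simp add: Hom_iff)
  show "x \<in> Hom C (Cod C m) W" "Zero C Y W \<in> Hom C (Cod C m) W"
    using Y assms(3) zero_hom Hom_obj[OF assms(3)] by auto
  show "x \<cdot> m = Zero C Y W \<cdot> m"
    using assms(4) zero_comp_hom[OF assms(2)] Hom_obj[OF assms(3)] by metis
qed

lemma kernelD:
  assumes "is_kernel C k f"
  shows "k \<in> Hom C (Dom C k) (Dom C f)" "f \<in> Hom C (Dom C f) (Cod C f)"
    "f \<cdot> k = Zero C (Dom C k) (Cod C f)" "is_mono C k"
    "\<And>W h. \<lbrakk>h \<in> Hom C W (Dom C f); f \<cdot> h = Zero C W (Cod C f)\<rbrakk> \<Longrightarrow> \<exists>u \<in> Hom C W (Dom C k). k \<cdot> u = h"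
proof -
  show k: "k \<in> Hom C (Dom C k) (Dom C f)" "f \<in> Hom C (Dom C f) (Cod C f)"
    "f \<cdot> k = Zero C (Dom C k) (Cod C f)"
    using assms by (auto simp: is_kernel_def Hom_iff)
  show "\<And>W h. \<lbrakk>h \<in> Hom C W (Dom C f); f \<cdot> h = Zero C W (Cod C f)\<rbrakk> \<Longrightarrow> \<exists>u \<in> Hom C W (Dom C k). k \<cdot> u = h"
    using assms unfolding is_kernel_def by blast
  show "is_mono C k"
  proof (rule monoI_zero[OF k(1)])
    fix W x assume x: "x \<in> Hom C W (Dom C k)" "k \<cdot> x = Zero C W (Dom C f)"
    have obj: "W \<in> Obj C" "Dom C f \<in> Obj C" "Dom C k \<in> Obj C" using x k Hom_obj by auto
    have "f \<cdot> Zero C W (Dom C f) = Zero C W (Cod C f)" using comp_zero_hom k obj by blast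
    then have "\<exists>!u. u \<in> Hom C W (Dom C k) \<and> k \<cdot> u = Zero C W (Dom C f)"
      using assms zero_hom[OF obj(1,2)] unfolding is_kernel_def by blast
    moreover have "k \<cdot> Zero C W (Dom C k) = Zero C W (Dom C f)" using comp_zero_hom k obj by blast
    ultimately show "x = Zero C W (Dom C k)" using x zero_hom obj by blast
  qed
qed

lemma kernelI:
  assumes "k \<in> Hom C K X" "f \<in> Hom C X Y" "f \<cdot> k = Zero C K Y" "is_mono C k"
    "\<And>W h. \<lbrakk>h \<in> Hom C W X; f \<cdot> h = Zero C W Y\<rbrakk> \<Longrightarrow> \<exists>u \<in> Hom C W K. k \<cdot> u = h"
  shows "is_kernel C k f"
proof -
  have t: "k \<in> Arr C" "f \<in> Arr C" "Dom C k = K" "Cod C k = X" "Dom C f = X" "Cod C f = Y"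
    using assms by (auto simp: Hom_iff)
  have "\<exists>!u. u \<in> Hom C W K \<and> k \<cdot> u = h" if h: "h \<in> Hom C W X" "f \<cdot> h = Zero C W Y" for W h
    using assms(5)[OF h] mono_cancel[OF assms(4), unfolded t] by metis
  then show ?thesis using assms(3) t by (simp add: is_kernel_def)
qed

text \<open>With \<open>K\<close> a variable the rule unifies with goals that name a concrete
  source; the equation \<open>Dom C k = K\<close> is then left to the simplifier.\<close>

lemma kernel_lift:
  "\<lbrakk>is_kernel C k f; Dom C k = K; h \<in> Hom C W (Dom C f); f \<cdot> h = Zero C W (Cod C f)\<rbrakk>
    \<Longrightarrow> \<exists>u \<in> Hom C W K. k \<cdot> u = h"
  using kernelD(5) by blast

lemma cokernelD:
  assumes "is_cokernel C c f"
  shows "c \<in> Hom C (Cod C f) (Cod C c)" "f \<in> Hom C (Dom C f) (Cod C f)"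
    "c \<cdot> f = Zero C (Dom C f) (Cod C c)" "is_epi C c"
    "\<And>W h. \<lbrakk>h \<in> Hom C (Cod C f) W; h \<cdot> f = Zero C (Dom C f) W\<rbrakk> \<Longrightarrow> \<exists>u \<in> Hom C (Cod C c) W. u \<cdot> c = h"
proof -
  show k: "c \<in> Hom C (Cod C f) (Cod C c)" "f \<in> Hom C (Dom C f) (Cod C f)"
    "c \<cdot> f = Zero C (Dom C f) (Cod C c)"
    using assms by (auto simp: is_cokernel_def Hom_iff)
  show "\<And>W h. \<lbrakk>h \<in> Hom C (Cod C f) W; h \<cdot> f = Zero C (Dom C f) W\<rbrakk> \<Longrightarrow> \<exists>u \<in> Hom C (Cod C c) W. u \<cdot> c = h"
    using assms unfolding is_cokernel_def by blast
  show "is_epi C c"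
  proof (rule epiI_zero[OF k(1)])
    fix W x assume x: "x \<in> Hom C (Cod C c) W" "x \<cdot> c = Zero C (Cod C f) W"
    have obj: "W \<in> Obj C" "Cod C f \<in> Obj C" "Cod C c \<in> Obj C" using x k Hom_obj by auto
    have "Zero C (Cod C f) W \<cdot> f = Zero C (Dom C f) W" using zero_comp_hom k obj by blast
    then have "\<exists>!u. u \<in> Hom C (Cod C c) W \<and> u \<cdot> c = Zero C (Cod C f) W"
      using assms zero_hom[OF obj(2,1)] unfolding is_cokernel_def by blast
    moreover have "Zero C (Cod C c) W \<cdot> c = Zero C (Cod C f) W" using zero_comp_hom k obj by blast
    ultimately show "x = Zero C (Cod C c) W" using x zero_hom obj by blast
  qed
qed

lemma cokernelI:
  assumes "c \<in> Hom C Y K" "f \<in> Hom C X Y" "c \<cdot> f = Zero C X K" "is_epi C c"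
    "\<And>W h. \<lbrakk>h \<in> Hom C Y W; h \<cdot> f = Zero C X W\<rbrakk> \<Longrightarrow> \<exists>u \<in> Hom C K W. u \<cdot> c = h"
  shows "is_cokernel C c f"
proof -
  have t: "c \<in> Arr C" "f \<in> Arr C" "Dom C c = Y" "Cod C c = K" "Dom C f = X" "Cod C f = Y"
    using assms by (auto simp: Hom_iff)
  have "\<exists>!u. u \<in> Hom C K W \<and> u \<cdot> c = h" if h: "h \<in> Hom C Y W" "h \<cdot> f = Zero C X W" for W h
    using assms(5)[OF h] epi_cancel[OF assms(4), unfolded t] by metis
  then show ?thesis using assms(3) t by (simp add: is_cokernel_def)
qed

lemma cokernel_desc:
  "\<lbrakk>is_cokernel C c f; Cod C c = K; h \<in> Hom C (Cod C f) W; h \<cdot> f = Zero C (Dom C f) W\<rbrakk>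
    \<Longrightarrow> \<exists>u \<in> Hom C K W. u \<cdot> c = h"
  using cokernelD(5) by blast

end

text \<open>The square is \<open>p \<cdot> f = q \<cdot> g\<close>, so \<open>p\<close> is the
  pushed out copy of \<open>g\<close>, and \<open>q\<close> that of \<open>f\<close>. The pushout
  object is not a separate argument; it is \<open>Cod C p\<close>.\<close>

definition is_pushout :: "('o, 'm) acat \<Rightarrow> 'm \<Rightarrow> 'm \<Rightarrow> 'm \<Rightarrow> 'm \<Rightarrow> bool" where
  "is_pushout C f g p q \<longleftrightarrow>
     f \<in> Arr C \<and> g \<in> Arr C \<and> Dom C g = Dom C f \<and>
     p \<in> Hom C (Cod C f) (Cod C p) \<and> q \<in> Hom C (Cod C g) (Cod C p) \<and>
     p \<cdot>\<^bsub>C\<^esub> f = q \<cdot>\<^bsub>C\<^esub> g \<and>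
     (\<forall>T. \<forall>h \<in> Hom C (Cod C f) T. \<forall>k \<in> Hom C (Cod C g) T. h \<cdot>\<^bsub>C\<^esub> f = k \<cdot>\<^bsub>C\<^esub> g \<longrightarrow>
        (\<exists>!u. u \<in> Hom C (Cod C p) T \<and> u \<cdot>\<^bsub>C\<^esub> p = h \<and> u \<cdot>\<^bsub>C\<^esub> q = k))"

section \<open>Normality, image factorizations and short exact sequences\<close>

context abelian_category begin

text \<open>As an epi, \<open>f\<close> is the cokernel of some \<open>k\<close>; as a mono, it
  forces \<open>k\<close> to be zero. Hence the identity descends along \<open>f\<close> and gives
  the inverse.\<close>

lemma mono_epi_iso:
  assumes "is_mono C f" "is_epi C f" "f \<in> Hom C X Y"
  shows "\<exists>g \<in> Hom C Y X. g \<cdot> f = Ident C X \<and> f \<cdot> g = Ident C Y"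
proof -
  note f = assms(3)[unfolded Hom_iff]
  have obj: "X \<in> Obj C" "Y \<in> Obj C" using Hom_obj assms(3) by auto
  obtain k where k: "is_cokernel C f k" using epi_normal assms(2) by blast
  have kh: "k \<in> Hom C (Dom C k) X" "f \<cdot> k = Zero C (Dom C k) Y"
    using cokernelD(1-3)[OF k] f by (auto simp: Hom_iff)
  have "k = Zero C (Dom C k) X" using mono_zero[OF assms(1,3) kh] .
  then have Ik: "Ident C X \<cdot> k = Zero C (Dom C k) X" using kh obj by (simp add: Hom_iff)
  have "\<exists>u \<in> Hom C Y X. u \<cdot> f = Ident C X"
    apply -
    apply (rule cokernel_desc[OF k])
    apply (use Ik kh(1) f obj in \<open>simp_all add: Hom_iff\<close>)
    done
  then obtain u where u: "u \<in> Hom C Y X" "u \<cdot> f = Ident C X" by blast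
  have "(f \<cdot> u) \<cdot> f = Ident C Y \<cdot> f"
    using u f obj by (simp add: Hom_iff assoc)
  then have "f \<cdot> u = Ident C Y"
    using epi_cancel[OF assms(2), of "f \<cdot> u" Y "Ident C Y"] u f obj by (simp add: Hom_iff)
  then show ?thesis using u by blast
qed

text \<open>The mono \<open>f\<close> is the kernel of some \<open>g\<close>. Since \<open>g\<close>
  kills \<open>f\<close> it factors through \<open>c\<close>, so whatever \<open>c\<close> kills is
  killed by \<open>g\<close> and lifts along \<open>f\<close>.\<close>

lemma kernel_of_cokernel:
  assumes "is_mono C f" "is_cokernel C c f"
  shows "is_kernel C f c"
proof -
  obtain g where g: "is_kernel C f g" using mono_normal assms(1) by blast
  note gD = kernelD(1-4)[OF g, unfolded Hom_iff] and cD = cokernelD(1-4)[OF assms(2), unfolded Hom_iff]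
  have "\<exists>v \<in> Hom C (Cod C c) (Cod C g). v \<cdot> c = g"
      apply -
      apply (rule cokernel_desc[OF assms(2)])
      apply (use gD in \<open>simp_all add: Hom_iff\<close>)
      done
    then obtain v where v: "v \<in> Hom C (Cod C c) (Cod C g)" "v \<cdot> c = g" by blast
  show ?thesis
  proof (rule kernelI)
    show "f \<in> Hom C (Dom C f) (Cod C f)" "c \<in> Hom C (Cod C f) (Cod C c)"
      "c \<cdot> f = Zero C (Dom C f) (Cod C c)"
      using cD by (auto simp: Hom_iff)
    show "is_mono C f" by fact
    fix W h assume h: "h \<in> Hom C W (Cod C f)" "c \<cdot> h = Zero C W (Cod C c)"
    have "g \<cdot> h = v \<cdot> (c \<cdot> h)" using assoc[of h c v] v h(1) cD by (simp add: Hom_iff)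
    also have "\<dots> = Zero C W (Cod C g)" using h v comp_zero_hom Hom_obj by metis
    finally show "\<exists>u \<in> Hom C W (Dom C f). f \<cdot> u = h"
      apply -
      apply (rule kernel_lift[OF g])
      apply (use h gD in \<open>simp_all add: Hom_iff\<close>)
      done
  qed
qed

lemma cokernel_of_kernel:
  assumes "is_epi C c" "is_kernel C f c"
  shows "is_cokernel C c f"
proof -
  obtain g where g: "is_cokernel C c g" using epi_normal assms(1) by blast
  note gD = cokernelD(1-4)[OF g, unfolded Hom_iff] and cD = kernelD(1-4)[OF assms(2), unfolded Hom_iff]
  have "\<exists>v \<in> Hom C (Dom C g) (Dom C f). f \<cdot> v = g"
      apply -
      apply (rule kernel_lift[OF assms(2)])
      apply (use gD in \<open>simp_all add: Hom_iff\<close>)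
      done
    then obtain v where v: "v \<in> Hom C (Dom C g) (Dom C f)" "f \<cdot> v = g" by blast
  show ?thesis
  proof (rule cokernelI)
    show "f \<in> Hom C (Dom C f) (Dom C c)" "c \<in> Hom C (Dom C c) (Cod C c)"
      "c \<cdot> f = Zero C (Dom C f) (Cod C c)"
      using cD by (auto simp: Hom_iff)
    show "is_epi C c" by fact
    fix W h assume h: "h \<in> Hom C (Dom C c) W" "h \<cdot> f = Zero C (Dom C f) W"
    have "h \<cdot> g = (h \<cdot> f) \<cdot> v" using assoc[of v f h] v h(1) cD by (simp add: Hom_iff)
    also have "\<dots> = Zero C (Dom C g) W" using h v zero_comp_hom Hom_obj by metis
    finally show "\<exists>u \<in> Hom C (Cod C c) W. u \<cdot> c = h"
      apply -
      apply (rule cokernel_desc[OF g])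
      apply (use h gD in \<open>simp_all add: Hom_iff\<close>)
      done
  qed
qed

lemma image_fact_arr:
  assumes "is_image_fact C f i q"
  shows "i \<in> Hom C (Dom C i) (Cod C f)" "q \<in> Hom C (Dom C f) (Dom C i)" "i \<cdot> q = f" "is_mono C i" "is_epi C q"
    "f \<in> Arr C"
  using assms mono_arr epi_arr by (auto simp: is_image_fact_def Hom_iff)

text \<open>The image is the kernel \<open>i\<close> of the cokernel \<open>c\<close> of
  \<open>f\<close>. That \<open>q\<close> is epi follows from minimality of \<open>i\<close>: if
  \<open>h\<close> kills \<open>q\<close> and \<open>k\<close> is the kernel of \<open>h\<close>,
  then \<open>f\<close> factors through the mono \<open>i \<cdot> k\<close>, which is the kernel of
  some \<open>g\<close>. Now \<open>g\<close> kills \<open>f\<close>, so it factors through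
  \<open>c\<close> and kills \<open>i\<close>. Thus \<open>i\<close> factors through
  \<open>i \<cdot> k\<close>, which makes \<open>k\<close> a split epi, and
  \<open>h = 0\<close>.\<close>

lemma ex_image_fact:
  assumes "f \<in> Arr C"
  shows "\<exists>i q. is_image_fact C f i q"
proof -
  obtain c where c: "is_cokernel C c f" using ex_cokernel assms by blast
  note cD = cokernelD(1-4)[OF c, unfolded Hom_iff]
  obtain i where i: "is_kernel C i c" using ex_kernel cD by blast
  note iD = kernelD(1-4)[OF i, unfolded Hom_iff]
  have "\<exists>q \<in> Hom C (Dom C f) (Dom C i). i \<cdot> q = f"
      apply -
      apply (rule kernel_lift[OF i])
      apply (use cD in \<open>simp_all add: Hom_iff\<close>)
      done
    then obtain q where q: "q \<in> Hom C (Dom C f) (Dom C i)" "i \<cdot> q = f" by blast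
  have "is_epi C q"
  proof (rule epiI_zero[OF q(1)])
    fix W h assume h: "h \<in> Hom C (Dom C i) W" "h \<cdot> q = Zero C (Dom C f) W"
    obtain k where k: "is_kernel C k h" using ex_kernel h by (auto simp: Hom_iff)
    note kD = kernelD(1-4)[OF k, unfolded Hom_iff]
    have "\<exists>q' \<in> Hom C (Dom C f) (Dom C k). k \<cdot> q' = q"
      apply -
      apply (rule kernel_lift[OF k])
      apply (use q h in \<open>simp_all add: Hom_iff\<close>)
      done
    then obtain q' where q': "q' \<in> Hom C (Dom C f) (Dom C k)" "k \<cdot> q' = q" by blast
    have "is_mono C (i \<cdot> k)" using mono_comp kD iD h(1) by (auto simp: Hom_iff)
    then obtain g where g: "is_kernel C (i \<cdot> k) g" using mono_normal by blast
    have ik: "i \<cdot> k \<in> Arr C" "Dom C (i \<cdot> k) = Dom C k" "Cod C (i \<cdot> k) = Cod C i"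
      using kD iD h(1) by (auto simp: Hom_iff)
    note gD = kernelD(1-4)[OF g, unfolded Hom_iff ik]
    have gf: "g \<cdot> f = Zero C (Dom C f) (Cod C g)"
    proof -
      have "g \<cdot> f = (g \<cdot> (i \<cdot> k)) \<cdot> q'"
        using q(2) q'(2) assoc[of q' k i] assoc[of q' "i \<cdot> k" g] q'(1) gD kD iD h(1) by (simp add: Hom_iff)
      then show ?thesis using gD q' cod_obj by (simp add: Hom_iff)
    qed
    have "\<exists>v \<in> Hom C (Cod C c) (Cod C g). v \<cdot> c = g"
      apply -
      apply (rule cokernel_desc[OF c])
      apply (use gf gD cD iD in \<open>simp_all add: Hom_iff\<close>)
      done
    then obtain v where v: "v \<in> Hom C (Cod C c) (Cod C g)" "v \<cdot> c = g" by blast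
    have "g \<cdot> i = v \<cdot> (c \<cdot> i)" using assoc[of i c v] v iD by (simp add: Hom_iff)
    also have "\<dots> = Zero C (Dom C i) (Cod C g)" using iD v dom_obj by (simp add: Hom_iff)
    finally have "\<exists>w \<in> Hom C (Dom C i) (Dom C k). (i \<cdot> k) \<cdot> w = i"
      apply -
      apply (rule kernel_lift[OF g])
      apply (use gD iD ik in \<open>simp_all add: Hom_iff\<close>)
      done
    then obtain w where w: "w \<in> Hom C (Dom C i) (Dom C k)" "(i \<cdot> k) \<cdot> w = i" by blast
    have "i \<cdot> (k \<cdot> w) = i \<cdot> Ident C (Dom C i)" using w iD kD h dom_obj by (simp add: Hom_iff assoc)
    then have kw: "k \<cdot> w = Ident C (Dom C i)"
      using mono_cancel[OF iD(4), of "k \<cdot> w" "Dom C i"] w iD kD h dom_obj by (simp add: Hom_iff)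
    have "h = (h \<cdot> k) \<cdot> w" using assoc[of w k h] kw w kD h by (simp add: Hom_iff)
    also have "\<dots> = Zero C (Dom C i) W" using kD(3) w(1) h(1) Hom_obj[OF h(1)] by (simp add: Hom_iff)
    finally show "h = Zero C (Dom C i) W" .
  qed
  then show ?thesis using q iD by (auto simp: is_image_fact_def Hom_iff)
qed

lemma exactD:
  assumes "exact C f g"
  shows "f \<in> Hom C (Dom C f) (Dom C g)" "g \<in> Arr C" "g \<cdot> f = Zero C (Dom C f) (Cod C g)"
proof -
  show a: "f \<in> Hom C (Dom C f) (Dom C g)" "g \<in> Arr C" using assms by (auto simp: exact_def Hom_iff)
  obtain i q where f: "is_image_fact C f i q" and i: "is_kernel C i g" using assms unfolding exact_def by blast
  note iD = kernelD(1-4)[OF i, unfolded Hom_iff] and fD = image_fact_arr[OF f, unfolded Hom_iff]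
  have "g \<cdot> f = (g \<cdot> i) \<cdot> q" using assoc[of q i g] fD iD a by (simp add: Hom_iff)
  then show "g \<cdot> f = Zero C (Dom C f) (Cod C g)" using iD fD cod_obj by auto
qed

text \<open>Exactness provides one image factorization \<open>i' \<cdot> q'\<close>, but later
  arguments bring their own. The mono \<open>i\<close> is the kernel of some \<open>c\<close>; since
  \<open>c \<cdot> i'\<close> vanishes after the epi \<open>q'\<close>, the arrow \<open>i'\<close>
  factors through \<open>i\<close>.\<close>

lemma exact_image_kernel:
  assumes "exact C f g" "is_image_fact C f i q"
  shows "is_kernel C i g"
proof -
  obtain i' q' where f: "is_image_fact C f i' q'" and i: "is_kernel C i' g" using assms unfolding exact_def by blast
  note i'D = kernelD(1-4)[OF i, unfolded Hom_iff] and f'D = image_fact_arr[OF f, unfolded Hom_iff]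
  note fD = image_fact_arr[OF assms(2), unfolded Hom_iff]
  note e = exactD[OF assms(1), unfolded Hom_iff]
  have ihom: "i \<in> Hom C (Dom C i) (Dom C g)" using fD e by (auto simp: Hom_iff)
  have "(g \<cdot> i) \<cdot> q = Zero C (Dom C f) (Cod C g)" using e fD by (simp add: assoc Hom_iff)
  then have gi: "g \<cdot> i = Zero C (Dom C i) (Cod C g)"
    using epi_zero[OF fD(5), of "Dom C f" "Dom C i" "g \<cdot> i" "Cod C g"] fD e by (simp add: Hom_iff)
  obtain c where c: "is_kernel C i c" using fD mono_normal by blast
  note cD = kernelD(1-4)[OF c, unfolded Hom_iff]
  have "(c \<cdot> i') \<cdot> q' = (c \<cdot> i) \<cdot> q" using assoc[of q i c] assoc[of q' i' c] cD fD f'D by simp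
  also have "\<dots> = Zero C (Dom C f) (Cod C c)" using cD fD cod_obj by simp
  finally have "c \<cdot> i' = Zero C (Dom C i') (Cod C c)"
    using epi_zero[OF f'D(5), of "Dom C f" "Dom C i'" "c \<cdot> i'" "Cod C c"] fD f'D e cD by (simp add: Hom_iff)
  then have "\<exists>v \<in> Hom C (Dom C i') (Dom C i). i \<cdot> v = i'"
      apply -
      apply (rule kernel_lift[OF c])
      apply (use cD fD f'D in \<open>simp_all add: Hom_iff\<close>)
      done
    then obtain v where v: "v \<in> Hom C (Dom C i') (Dom C i)" "i \<cdot> v = i'" by blast
  show ?thesis
  proof (rule kernelI[OF ihom _ gi fD(4)])
    show "g \<in> Hom C (Dom C g) (Cod C g)" using e by (simp add: Hom_iff)
    fix W h assume "h \<in> Hom C W (Dom C g)" "g \<cdot> h = Zero C W (Cod C g)"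
    then obtain u where u: "u \<in> Hom C W (Dom C i')" "i' \<cdot> u = h" using kernelD(5)[OF i] by blast
    have "i \<cdot> (v \<cdot> u) = h" using u v fD by (simp add: assoc_eq Hom_iff)
    moreover have "v \<cdot> u \<in> Hom C W (Dom C i)" using u v comp_hom by blast
    ultimately show "\<exists>u\<in>Hom C W (Dom C i). i \<cdot> u = h" by blast
  qed
qed

lemma kernel_comp_mono:
  assumes "is_kernel C k (i \<cdot> q)" "is_mono C i" "q \<in> Hom C X Y" "Y = Dom C i"
  shows "is_kernel C k q"
proof -
  note i = mono_arr[OF assms(2)] and q = assms(3)[unfolded Hom_iff]
  have iq: "Dom C (i \<cdot> q) = X" "Cod C (i \<cdot> q) = Cod C i" using i q assms(4) by auto
  note kD = kernelD(1-4)[OF assms(1), unfolded Hom_iff iq]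
  show ?thesis
  proof (rule kernelI[OF _ assms(3)])
    show "k \<in> Hom C (Dom C k) X" using kD by (simp add: Hom_iff)
    have "i \<cdot> (q \<cdot> k) = Zero C (Dom C k) (Cod C i)" using kD i q assms(4) by (simp add: assoc)
    then show "q \<cdot> k = Zero C (Dom C k) Y"
      using mono_zero[OF assms(2), of Y "Cod C i" "q \<cdot> k"] i q assms(4) kD by (simp add: Hom_iff)
    show "is_mono C k" using kD by simp
    fix W h assume h: "h \<in> Hom C W X" "q \<cdot> h = Zero C W Y"
    then have "(i \<cdot> q) \<cdot> h = Zero C W (Cod C i)" using Hom_obj[OF h(1)] i q assms(4) dom_obj by (simp add: assoc Hom_iff)
    then show "\<exists>u\<in>Hom C W (Dom C k). k \<cdot> u = h" using kernelD(5)[OF assms(1)] h iq by simp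
  qed
qed

lemma exact_mono_kernel:
  assumes "exact C f g" "is_mono C f"
  shows "is_kernel C f g"
proof -
  have "is_image_fact C f f (Ident C (Dom C f))"
    using assms(2) mono_arr[OF assms(2)] dom_obj epi_ident by (simp add: is_image_fact_def)
  then show ?thesis using exact_image_kernel assms(1) by blast
qed

lemma kernel_exact:
  assumes "is_kernel C f g"
  shows "exact C f g"
proof -
  note D = kernelD(1-4)[OF assms, unfolded Hom_iff]
  have "is_image_fact C f f (Ident C (Dom C f))"
    using D dom_obj epi_ident by (simp add: is_image_fact_def)
  then show ?thesis using assms D by (auto simp: exact_def)
qed

lemma exact_comp_epi:
  assumes "is_kernel C i g" "is_epi C q" "Cod C q = Dom C i"
  shows "exact C (i \<cdot> q) g"
proof -
  note D = kernelD(1-4)[OF assms(1), unfolded Hom_iff] and q = epi_arr[OF assms(2)]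
  have "is_image_fact C (i \<cdot> q) i q" using D assms by (simp add: is_image_fact_def)
  then show ?thesis using assms D q by (auto simp: exact_def)
qed

text \<open>Since \<open>i\<close> is mono, \<open>q\<close> has the same kernel \<open>i'\<close>
  as \<open>g\<close>, and \<open>q\<close> is the cokernel of \<open>i'\<close>. As
  \<open>f = i' \<cdot> q'\<close> with \<open>q'\<close> epi, killing \<open>f\<close> amounts to
  killing \<open>i'\<close>.\<close>

lemma exact_coimage_cokernel:
  assumes "exact C f g" "is_image_fact C g i q"
  shows "is_cokernel C q f"
proof -
  obtain i' q' where f: "is_image_fact C f i' q'" and i: "is_kernel C i' g" using assms unfolding exact_def by blast
  note i'D = kernelD(1-4)[OF i, unfolded Hom_iff] and f'D = image_fact_arr[OF f, unfolded Hom_iff]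
  note gD = image_fact_arr[OF assms(2), unfolded Hom_iff]
  note e = exactD[OF assms(1), unfolded Hom_iff]
  have "is_kernel C i' q"
    by (rule kernel_comp_mono[of _ i q "Dom C g" "Dom C i"]) (use gD i in \<open>auto simp: Hom_iff\<close>)
  then have k: "is_cokernel C q i'" using cokernel_of_kernel gD by blast
  note kD = cokernelD(1-4)[OF k, unfolded Hom_iff]
  show ?thesis
  proof (rule cokernelI)
    show "q \<in> Hom C (Dom C g) (Dom C i)" "f \<in> Hom C (Dom C f) (Dom C g)" "is_epi C q"
      using gD e by (auto simp: Hom_iff)
    have "q \<cdot> f = (q \<cdot> i') \<cdot> q'" using gD f'D e by (simp add: assoc)
    also have "\<dots> = Zero C (Dom C f) (Dom C i)" using kD f'D gD dom_obj by simp
    finally show "q \<cdot> f = Zero C (Dom C f) (Dom C i)" .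
    fix W h assume h: "h \<in> Hom C (Dom C g) W" "h \<cdot> f = Zero C (Dom C f) W"
    have "(h \<cdot> i') \<cdot> q' = Zero C (Dom C f) W" using h f'D e by (simp add: assoc Hom_iff)
    then have "h \<cdot> i' = Zero C (Dom C i') W"
      using epi_zero[OF f'D(5), of "Dom C f" "Dom C i'" "h \<cdot> i'" W] h f'D e by (simp add: Hom_iff)
    then show "\<exists>u\<in>Hom C (Dom C i) W. u \<cdot> q = h"
      apply -
      apply (rule cokernel_desc[OF k])
      apply (use h gD f'D e in \<open>simp_all add: Hom_iff\<close>)
      done
  qed
qed

lemma sesI_cokernel:
  assumes "is_mono C f" "is_cokernel C g f" "f \<in> Hom C X Y" "g \<in> Hom C Y Z"
  shows "ses C X Y Z f g"
  unfolding ses_def using assms kernel_exact[OF kernel_of_cokernel] cokernelD(4) by blast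

lemma sesI_kernel:
  assumes "is_epi C g" "is_kernel C f g" "f \<in> Hom C X Y" "g \<in> Hom C Y Z"
  shows "ses C X Y Z f g"
  unfolding ses_def using assms kernel_exact kernelD(4) by blast

lemma sesD:
  assumes "ses C X Y Z f g"
  shows "f \<in> Hom C X Y" "g \<in> Hom C Y Z" "is_mono C f" "is_epi C g"
    "is_kernel C f g" "is_cokernel C g f" "g \<cdot> f = Zero C X Z"
proof -
  show a: "f \<in> Hom C X Y" "g \<in> Hom C Y Z" "is_mono C f" "is_epi C g"
    using assms by (auto simp: ses_def)
  show b: "is_kernel C f g" using assms exact_mono_kernel by (auto simp: ses_def)
  show "is_cokernel C g f" using cokernel_of_kernel a b by blast
  show "g \<cdot> f = Zero C X Z" using kernelD(3)[OF b] a by (simp add: Hom_iff)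
qed

lemma ses_lift:
  assumes "ses C X Y Z f g" "h \<in> Hom C W Y" "g \<cdot> h = Zero C W Z"
  obtains u where "u \<in> Hom C W X" "f \<cdot> u = h"
proof -
  have "\<exists>u \<in> Hom C W X. f \<cdot> u = h"
    by (rule kernel_lift[OF sesD(5)[OF assms(1)]])
      (use sesD(1,2)[OF assms(1)] assms(2,3) in \<open>simp_all add: Hom_iff\<close>)
  then show ?thesis using that by blast
qed

lemma ses_desc:
  assumes "ses C X Y Z f g" "h \<in> Hom C Y W" "h \<cdot> f = Zero C X W"
  obtains u where "u \<in> Hom C Z W" "u \<cdot> g = h"
proof -
  have "\<exists>u \<in> Hom C Z W. u \<cdot> g = h"
    by (rule cokernel_desc[OF sesD(6)[OF assms(1)]])
      (use sesD(1,2)[OF assms(1)] assms(2,3) in \<open>simp_all add: Hom_iff\<close>)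
  then show ?thesis using that by blast
qed

end

section \<open>Pushouts along monos and the extensions obtained from them\<close>

context abelian_category begin

lemma is_pushout_sym:
  assumes po: "is_pushout C f g p q"
  shows "is_pushout C g f q p"
proof -
  note D = po[unfolded is_pushout_def]
  have q: "Cod C q = Cod C p" using D by (simp add: Hom_iff)
  have "\<exists>!u. u \<in> Hom C (Cod C p) T \<and> u \<cdot> q = h \<and> u \<cdot> p = k"
    if "h \<in> Hom C (Cod C g) T" "k \<in> Hom C (Cod C f) T" "h \<cdot> g = k \<cdot> f" for T h k
  proof -
    have "\<exists>!u. u \<in> Hom C (Cod C p) T \<and> u \<cdot> p = k \<and> u \<cdot> q = h" using D that by metis
    then show ?thesis by metis
  qed
  then show ?thesis unfolding is_pushout_def q using D by metis
qed

lemma pushout_ex1: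
  assumes "is_pushout C f g p q" "h \<in> Hom C (Cod C f) T" "k \<in> Hom C (Cod C g) T" "h \<cdot> f = k \<cdot> g"
  shows "\<exists>u \<in> Hom C (Cod C p) T. u \<cdot> p = h \<and> u \<cdot> q = k"
  using assms unfolding is_pushout_def by blast

lemma pushout_eq:
  assumes po: "is_pushout C f g p q" and u: "u \<in> Hom C (Cod C p) T" and v: "v \<in> Hom C (Cod C p) T"
    and "u \<cdot> p = v \<cdot> p" "u \<cdot> q = v \<cdot> q"
  shows "u = v"
proof -
  note D = po[unfolded is_pushout_def]
  have pq: "p \<in> Hom C (Cod C f) (Cod C p)" "q \<in> Hom C (Cod C g) (Cod C p)" "f \<in> Arr C" "g \<in> Arr C"
    and e: "p \<cdot> f = q \<cdot> g"
    using D by blast+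
  have up: "u \<cdot> p \<in> Hom C (Cod C f) T" "u \<cdot> q \<in> Hom C (Cod C g) T" using pq u comp_hom by blast+
  have "(u \<cdot> p) \<cdot> f = (u \<cdot> q) \<cdot> g" using pq u e by (simp add: Hom_iff assoc)
  then have "\<exists>!w. w \<in> Hom C (Cod C p) T \<and> w \<cdot> p = u \<cdot> p \<and> w \<cdot> q = u \<cdot> q"
    using D up by blast
  then show ?thesis using assms by metis
qed

text \<open>The pushout is the cokernel of (f, -g) from \<open>W\<close> to the biproduct of
  \<open>X\<close> and \<open>Y\<close>. The arrow \<open>n\<close> below is -g, and
  \<open>key\<close> translates a vanishing sum back into commutativity of a square.\<close>

lemma pushout_mono_exists:
  assumes f: "f \<in> Hom C W X" and g: "g \<in> Hom C W Y" and mono: "is_mono C g"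
  shows "\<exists>p q. is_pushout C f g p q \<and> is_mono C p"
proof -
  have obj: "W \<in> Obj C" "X \<in> Obj C" "Y \<in> Obj C" using f g Hom_obj by auto
  obtain S where "is_biproduct C X Y S" using ex_biproduct obj by blast
  then obtain i1 i2 p1 p2 where S: "S \<in> Obj C" and i1: "i1 \<in> Hom C X S" and i2: "i2 \<in> Hom C Y S"
    and p1: "p1 \<in> Hom C S X" and p2: "p2 \<in> Hom C S Y"
    and e: "p1 \<cdot> i1 = Ident C X" "p2 \<cdot> i2 = Ident C Y" "p2 \<cdot> i1 = Zero C X Y" "p1 \<cdot> i2 = Zero C Y X"
    "(i1 \<cdot> p1) \<boxplus> (i2 \<cdot> p2) = Ident C S"
    unfolding is_biproduct_def by blast
  note t = f[unfolded Hom_iff] g[unfolded Hom_iff] i1[unfolded Hom_iff] i2[unfolded Hom_iff]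
    p1[unfolded Hom_iff] p2[unfolded Hom_iff]
  obtain n where n: "n \<in> Hom C W Y" "g \<boxplus> n = Zero C W Y" using ex_neg[OF g] by blast
  note nt = n(1)[unfolded Hom_iff]
  define d where "d = (i1 \<cdot> f) \<boxplus> (i2 \<cdot> n)"
  have d: "d \<in> Hom C W S" by (simp add: d_def Hom_iff t nt)
  obtain c where c: "is_cokernel C c d" using ex_cokernel d by (auto simp: Hom_iff)
  define E where "E = Cod C c"
  have ch: "c \<in> Hom C S E" "c \<cdot> d = Zero C W E" "is_epi C c"
    using cokernelD(1-4)[OF c] d by (simp_all add: Hom_iff E_def)
  note ct = ch(1)[unfolded Hom_iff]
  have E: "E \<in> Obj C" using ch(1) Hom_obj by blast
  define p where "p = c \<cdot> i1"
  define q where "q = c \<cdot> i2"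
  have p: "p \<in> Hom C X E" and q: "q \<in> Hom C Y E" using t ct by (simp_all add: p_def q_def Hom_iff)
  have neg: "u \<cdot> g \<boxplus> u \<cdot> n = Zero C W T" if "u \<in> Hom C Y T" for u T
    using comp_add_right[OF g n(1) that] n(2) comp_zero_hom[OF that obj(1)] by simp
  have key: "a \<cdot> f = b \<cdot> g" if "a \<cdot> f \<boxplus> b \<cdot> n = Zero C W T" "a \<in> Hom C X T" "b \<in> Hom C Y T" for a b T
  proof (rule add_cancel)
    show "b \<cdot> n \<in> Hom C W T" "a \<cdot> f \<in> Hom C W T" "b \<cdot> g \<in> Hom C W T" using that f g n comp_hom by blast+
    then show "b \<cdot> n \<boxplus> a \<cdot> f = b \<cdot> n \<boxplus> b \<cdot> g" using that neg[OF that(3)] add_comm by metis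
  qed
  have sq: "p \<cdot> f = q \<cdot> g"
  proof (rule key[OF _ p q])
    have "p \<cdot> f \<boxplus> q \<cdot> n = c \<cdot> d" by (simp add: p_def q_def d_def comp_distrib assoc t nt ct)
    then show "p \<cdot> f \<boxplus> q \<cdot> n = Zero C W E" using ch by simp
  qed
  have joint: "u = v" if u: "u \<in> Hom C E T" and v: "v \<in> Hom C E T" and "u \<cdot> p = v \<cdot> p" "u \<cdot> q = v \<cdot> q" for u v T
  proof (rule epi_cancel[OF ch(3)])
    have *: "w \<cdot> c = w \<cdot> p \<cdot> p1 \<boxplus> w \<cdot> q \<cdot> p2" if w: "w \<in> Hom C E T" for w
    proof -
      note wt = w[unfolded Hom_iff]
      have "w \<cdot> c = w \<cdot> c \<cdot> ((i1 \<cdot> p1) \<boxplus> (i2 \<cdot> p2))" using e S wt ct by simp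
      also have "\<dots> = w \<cdot> p \<cdot> p1 \<boxplus> w \<cdot> q \<cdot> p2"
        by (simp add: p_def q_def comp_distrib assoc t wt ct)
      finally show ?thesis .
    qed
    show "u \<cdot> c = v \<cdot> c" using *[OF u] *[OF v] that by simp
    show "u \<in> Hom C (Cod C c) T" "v \<in> Hom C (Cod C c) T" using u v ct by simp_all
  qed
  have up: "\<exists>!u. u \<in> Hom C E T \<and> u \<cdot> p = h \<and> u \<cdot> q = k"
    if h: "h \<in> Hom C X T" and k: "k \<in> Hom C Y T" and hk: "h \<cdot> f = k \<cdot> g" for h k T
  proof -
    note ht = h[unfolded Hom_iff] k[unfolded Hom_iff]
    have T: "T \<in> Obj C" using h Hom_obj by blast
    define w where "w = (h \<cdot> p1) \<boxplus> (k \<cdot> p2)"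
    have w: "w \<in> Hom C S T" by (simp add: w_def t ht Hom_iff)
    note wt = w[unfolded Hom_iff]
    have w1: "w \<cdot> i1 = h"
      using add_zero[OF h] by (simp add: w_def comp_distrib assoc t ht e obj T)
    have w2: "w \<cdot> i2 = k"
      using zero_add[OF k] by (simp add: w_def comp_distrib assoc t ht e obj T)
    have "w \<cdot> d = h \<cdot> f \<boxplus> k \<cdot> n"
      using assoc_eq[OF w1, of f] assoc_eq[OF w2, of n] by (simp add: d_def comp_distrib t nt wt)
    also have "\<dots> = Zero C W T" using neg[OF k] hk by simp
    finally have wd: "w \<cdot> d = Zero C W T" .
    have "\<exists>u \<in> Hom C E T. u \<cdot> c = w"
      by (rule cokernel_desc[OF c]) (use wd w d ct in \<open>simp_all add: Hom_iff\<close>)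
    then obtain u where u: "u \<in> Hom C E T" "u \<cdot> c = w" by blast
    have "u \<cdot> p = h" "u \<cdot> q = k"
      using u w1 w2 t ct assoc[of i1 c u] assoc[of i2 c u] by (simp_all add: p_def q_def Hom_iff)
    then show ?thesis using joint u(1) by metis
  qed
  have po: "is_pushout C f g p q"
  proof -
    have "Cod C f = X" "Cod C g = Y" "Cod C p = E" using t p by (simp_all add: Hom_iff)
    then show ?thesis using t p q sq up by (simp add: is_pushout_def)
  qed
  have monod: "is_mono C d"
  proof (rule monoI_zero[OF d])
    fix V x assume x: "x \<in> Hom C V W" "d \<cdot> x = Zero C V S"
    note xt = x(1)[unfolded Hom_iff]
    have V: "V \<in> Obj C" using x Hom_obj by blast
    have fx: "n \<cdot> x \<in> Hom C V Y" "g \<cdot> x \<in> Hom C V Y" using comp_hom x n g by blast+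
    have "p2 \<cdot> d = n"
      using assoc_eq[OF e(2), of n] assoc_eq[OF e(3), of f] zero_add[OF n(1)] obj
      by (simp add: d_def comp_distrib t nt)
    then have "n \<cdot> x = Zero C V Y"
      using assoc[of x d p2] x d[unfolded Hom_iff] t xt V by simp
    moreover have "g \<cdot> x \<boxplus> n \<cdot> x = Zero C V Y"
      using comp_add_left[OF x(1) g n(1)] n zero_comp_hom[OF x(1) obj(3)] by simp
    ultimately have "g \<cdot> x = Zero C V Y" using add_zero[OF fx(2)] by simp
    then show "x = Zero C V W" using mono_zero[OF mono g x(1)] by blast
  qed
  have dk: "is_kernel C d c" using kernel_of_cokernel[OF monod c] .
  \<comment> \<open>If \<open>p\<close> kills \<open>y\<close>, then (y, 0) lies in the kernel
    \<open>d\<close> of \<open>c\<close>, say as \<open>d \<cdot> w\<close>. Its second component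
    gives \<open>g \<cdot> w = 0\<close>, hence \<open>w = 0\<close> and
    \<open>y = 0\<close>.\<close>
  have "is_mono C p"
  proof (rule monoI_zero[OF p])
    fix V y assume y: "y \<in> Hom C V X" "p \<cdot> y = Zero C V E"
    note yt = y(1)[unfolded Hom_iff]
    have V: "V \<in> Obj C" using y Hom_obj by blast
    have "c \<cdot> (i1 \<cdot> y) = Zero C V E" using y t yt ct by (simp add: p_def assoc)
    then have "\<exists>w \<in> Hom C V W. d \<cdot> w = i1 \<cdot> y"
      apply -
      apply (rule kernel_lift[OF dk])
      apply (use d y t ct in \<open>simp_all add: Hom_iff\<close>)
      done
    then obtain w where w: "w \<in> Hom C V W" "d \<cdot> w = i1 \<cdot> y" by blast
    note wt = w(1)[unfolded Hom_iff]
    have fx: "n \<cdot> w \<in> Hom C V Y" "g \<cdot> w \<in> Hom C V Y" using comp_hom w n g by blast+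
    have "p2 \<cdot> d = n"
      using assoc_eq[OF e(2), of n] assoc_eq[OF e(3), of f] zero_add[OF n(1)] obj
      by (simp add: d_def comp_distrib t nt)
    then have "n \<cdot> w = p2 \<cdot> (i1 \<cdot> y)"
      using assoc[of w d p2] w(2) d[unfolded Hom_iff] t wt by simp
    also have "\<dots> = Zero C V Y" using assoc_eq[OF e(3), of y] obj t yt by simp
    finally have "n \<cdot> w = Zero C V Y" .
    moreover have "g \<cdot> w \<boxplus> n \<cdot> w = Zero C V Y"
      using comp_add_left[OF w(1) g n(1)] n zero_comp_hom[OF w(1) obj(3)] by simp
    ultimately have "g \<cdot> w = Zero C V Y" using add_zero[OF fx(2)] by simp
    then have w0: "w = Zero C V W" using mono_zero[OF mono g w(1)] by blast
    have "y = p1 \<cdot> (i1 \<cdot> y)" using assoc_eq[OF e(1), of y] t yt by simp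
    also have "\<dots> = Zero C V X" unfolding w(2)[symmetric] w0 using d t V by (simp add: Hom_iff)
    finally show "y = Zero C V X" .
  qed
  then show ?thesis using po by blast
qed

text \<open>The arrow out of the pushout given by zero on one leg and \<open>c\<close> on the other
  has the universal property: what kills \<open>p\<close> restricts along \<open>q\<close> to an
  arrow that kills \<open>g\<close>. It is epi because \<open>c\<close> factors through it.\<close>

lemma pushout_cokernel:
  assumes po: "is_pushout C f g p q" and c: "is_cokernel C c g"
  shows "\<exists>c'. is_cokernel C c' p \<and> c' \<cdot> q = c \<and> Cod C c' = Cod C c"
proof -
  note D = po[unfolded is_pushout_def Hom_iff]
  note cD = cokernelD(1-4)[OF c, unfolded Hom_iff]
  define K where "K = Cod C c"
  have K: "K \<in> Obj C" "Cod C f \<in> Obj C" using cD D cod_obj by (auto simp: K_def)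
  have "\<exists>u \<in> Hom C (Cod C p) K. u \<cdot> p = Zero C (Cod C f) K \<and> u \<cdot> q = c"
    by (rule pushout_ex1[OF po]) (use D cD K in \<open>auto simp: Hom_iff K_def\<close>)
  then obtain u where u: "u \<in> Hom C (Cod C p) K" "u \<cdot> p = Zero C (Cod C f) K" "u \<cdot> q = c" by blast
  note ut = u(1)[unfolded Hom_iff]
  have qh: "q \<in> Hom C (Cod C g) (Cod C p)" and ph: "p \<in> Hom C (Cod C f) (Cod C p)" using D by (auto simp: Hom_iff)
  have "is_cokernel C u p"
  proof (rule cokernelI[OF u(1) ph u(2)])
    show "is_epi C u" by (rule epi_right_factor[of u q]) (use u(3) cD ut qh in \<open>simp_all add: Hom_iff\<close>)
    fix W h assume h: "h \<in> Hom C (Cod C p) W" "h \<cdot> p = Zero C (Cod C f) W"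
    note ht = h(1)[unfolded Hom_iff]
    have W: "W \<in> Obj C" using h Hom_obj by blast
    have "(h \<cdot> q) \<cdot> g = (h \<cdot> p) \<cdot> f" using D ht by (simp add: assoc)
    also have "\<dots> = Zero C (Dom C g) W" using h(2) D W by simp
    finally have hqg: "(h \<cdot> q) \<cdot> g = Zero C (Dom C g) W" .
    have "\<exists>w \<in> Hom C K W. w \<cdot> c = h \<cdot> q"
      by (rule cokernel_desc[OF c]) (use hqg ht D in \<open>simp_all add: Hom_iff K_def\<close>)
    then obtain w where w: "w \<in> Hom C K W" "w \<cdot> c = h \<cdot> q" by blast
    have "w \<cdot> u = h"
    proof (rule pushout_eq[OF po])
      show "w \<cdot> u \<in> Hom C (Cod C p) W" "h \<in> Hom C (Cod C p) W" using w u h comp_hom by blast+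
      show "w \<cdot> u \<cdot> p = h \<cdot> p"
        using assoc[of p u w] u(2) ut w(1) h(2) D K by (simp add: Hom_iff)
      show "w \<cdot> u \<cdot> q = h \<cdot> q" using assoc[of q u w] u(3) ut w qh by (simp add: Hom_iff)
    qed
    then show "\<exists>w\<in>Hom C K W. w \<cdot> u = h" using w by blast
  qed
  then show ?thesis using u by (auto simp: Hom_iff K_def)
qed

lemma pushout_ses:
  assumes ses: "ses C N M X m c" and g: "g \<in> Hom C N Y"
  obtains E m' g' c' where "is_pushout C g m m' g'" "ses C Y E X m' c'" "g' \<in> Hom C M E"
    "m' \<cdot> g = g' \<cdot> m" "c' \<cdot> g' = c"
proof -
  note S = sesD[OF ses]
  obtain m' g' where po: "is_pushout C g m m' g'" and m': "is_mono C m'"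
    using pushout_mono_exists[OF g S(1,3)] by blast
  note D = po[unfolded is_pushout_def Hom_iff]
  obtain c' where c': "is_cokernel C c' m'" "c' \<cdot> g' = c" "Cod C c' = Cod C c"
    using pushout_cokernel[OF po S(6)] by blast
  have t: "Cod C g = Y" "Cod C m = M" "Cod C c = X" using g S by (simp_all add: Hom_iff)
  have h: "m' \<in> Hom C Y (Cod C m')" "c' \<in> Hom C (Cod C m') X" "g' \<in> Hom C M (Cod C m')"
    using D t cokernelD(1)[OF c'(1)] c'(3) by (auto simp: Hom_iff)
  show ?thesis
    by (rule that[OF po sesI_cokernel[OF m' c'(1) h(1,2)] h(3) _ c'(2)]) (use D in blast)
qed

text \<open>\<open>E\<close> is \<open>M\<close> and \<open>Y\<close> glued along \<open>N\<close>,
  and it is an extension in both directions. For \<open>g'\<close> to be mono: an arrow that it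
  kills is killed by \<open>c\<close>, so comes from \<open>N\<close>, where
  \<open>m' \<cdot> g\<close> is mono.\<close>

lemma pushout_two_ses:
  assumes s1: "ses C N M X m c" and s2: "ses C N Y Z g r"
  obtains E m' g' c' r' where "ses C Y E X m' c'" "ses C M E Z g' r'"
    "m' \<cdot> g = g' \<cdot> m" "c' \<cdot> g' = c" "r' \<cdot> m' = r"
proof -
  note S1 = sesD[OF s1] and S2 = sesD[OF s2]
  obtain E m' g' c' where po: "is_pushout C g m m' g'" and s3: "ses C Y E X m' c'" and g': "g' \<in> Hom C M E"
    and e: "m' \<cdot> g = g' \<cdot> m" "c' \<cdot> g' = c" by (rule pushout_ses[OF s1 S2(1)])
  note S3 = sesD[OF s3]
  note t = S1(1,2)[unfolded Hom_iff] S2(1,2)[unfolded Hom_iff] S3(1,2)[unfolded Hom_iff] g'[unfolded Hom_iff]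
  have mono: "is_mono C g'"
  proof (rule monoI_zero[OF g'])
    fix W x assume x: "x \<in> Hom C W M" "g' \<cdot> x = Zero C W E"
    note xt = x(1)[unfolded Hom_iff]
    have W: "W \<in> Obj C" using x Hom_obj by blast
    have "c \<cdot> x = Zero C W X" using assoc_eq[OF e(2), of x] x(2) t xt W by simp
    then obtain y where y: "y \<in> Hom C W N" "m \<cdot> y = x" using ses_lift[OF s1 x(1)] by blast
    note yt = y(1)[unfolded Hom_iff]
    have "m' \<cdot> (g \<cdot> y) = g' \<cdot> (m \<cdot> y)" using assoc[of y g m'] assoc[of y m g'] e(1) t yt by simp
    then have 0: "m' \<cdot> (g \<cdot> y) = Zero C W E" using y x by simp
    have "g \<cdot> y = Zero C W Y" using mono_zero[OF S3(3,1) comp_hom[OF y(1) S2(1)] 0] .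
    then have "y = Zero C W N" using mono_zero[OF S2(3,1) y(1)] by blast
    then show "x = Zero C W M" using y t W by auto
  qed
  obtain r' where r': "is_cokernel C r' g'" "r' \<cdot> m' = r" "Cod C r' = Cod C r"
    using pushout_cokernel[OF is_pushout_sym[OF po] S2(6)] by blast
  have "r' \<in> Hom C E Z" using cokernelD(1)[OF r'(1)] r'(3) t by (simp add: Hom_iff)
  then show ?thesis using that[OF s3 sesI_cokernel[OF mono r'(1) g'] e r'(2)] by blast
qed

text \<open>Third isomorphism theorem: R/X is an extension of R/Y by Y/X. The pushout
  \<open>P\<close> of \<open>p\<close> along \<open>b\<close> serves as R/X, because an arrow out of
  \<open>R\<close> that kills \<open>X\<close> is the same as a compatible pair of arrows out of
  \<open>P1\<close> and \<open>R\<close>.\<close>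

lemma ses_comp_mono:
  assumes s1: "ses C X Y P1 a p" and s2: "ses C Y R P2 b r"
  obtains P c i j where "ses C X R P (b \<cdot> a) c" "ses C P1 P P2 i j"
proof -
  note S1 = sesD[OF s1] and S2 = sesD[OF s2]
  obtain P i c j where po: "is_pushout C p b i c" and s3: "ses C P1 P P2 i j" and c: "c \<in> Hom C R P"
    and e: "i \<cdot> p = c \<cdot> b" "j \<cdot> c = r" by (rule pushout_ses[OF s2 S1(2)])
  note S3 = sesD[OF s3]
  note t = S1(1,2)[unfolded Hom_iff] S2(1,2)[unfolded Hom_iff] S3(1,2)[unfolded Hom_iff] c[unfolded Hom_iff]
  have obj: "X \<in> Obj C" "P \<in> Obj C" "R \<in> Obj C" "P1 \<in> Obj C" using S1 S3 c Hom_obj by auto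
  have ba: "b \<cdot> a \<in> Hom C X R" using S1(1) S2(1) comp_hom by blast
  have mono: "is_mono C (b \<cdot> a)" using mono_comp S1(3) S2(3) t by simp
  have d: "\<exists>u \<in> Hom C P W. u \<cdot> c = v" if v: "v \<in> Hom C R W" "v \<cdot> (b \<cdot> a) = Zero C X W" for v W
  proof -
    note vt = v(1)[unfolded Hom_iff]
    have "(v \<cdot> b) \<cdot> a = Zero C X W" using v vt t by (simp add: assoc)
    then obtain w where w: "w \<in> Hom C P1 W" "w \<cdot> p = v \<cdot> b"
      using ses_desc[OF s1 comp_hom[OF S2(1) v(1)]] by blast
    have "\<exists>u \<in> Hom C (Cod C i) W. u \<cdot> i = w \<and> u \<cdot> c = v"
      by (rule pushout_ex1[OF po]) (use w v t in \<open>simp_all add: Hom_iff\<close>)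
    then show ?thesis using t by auto
  qed
  have epi: "is_epi C c"
  proof (rule epiI_zero[OF c])
    fix W u assume u: "u \<in> Hom C P W" "u \<cdot> c = Zero C R W"
    note ut = u(1)[unfolded Hom_iff]
    have W: "W \<in> Obj C" using u Hom_obj by blast
    have "(u \<cdot> i) \<cdot> p = u \<cdot> (c \<cdot> b)" using e ut t by (simp add: assoc)
    also have "\<dots> = Zero C Y W" using assoc[of b c u] u(2) ut t W by simp
    finally have "u \<cdot> i = Zero C P1 W" using epi_zero[OF S1(4,2) comp_hom[OF S3(1) u(1)]] by blast
    then show "u = Zero C P W"
      using u pushout_eq[OF po, of u W "Zero C P W"] t ut W obj by (simp add: Hom_iff)
  qed
  have ca: "c \<cdot> (b \<cdot> a) = Zero C X P"
  proof -
    have "c \<cdot> (b \<cdot> a) = i \<cdot> (p \<cdot> a)" using assoc[of a b c] assoc[of a p i] e t by simp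
    then show ?thesis using S1(7) t obj by simp
  qed
  have "is_cokernel C c (b \<cdot> a)" by (rule cokernelI[OF c ba ca epi d])
  then show ?thesis using that[OF sesI_cokernel[OF mono _ ba c] s3] by blast
qed

text \<open>A case of the snake lemma: \<open>r\<close> is a map of extensions of the same object
  \<open>P\<close>, so it inherits from \<open>\<pi>\<close> that it is epi and has kernel
  \<open>Y\<close>.\<close>

lemma ses_map_kernel:
  assumes s1: "ses C A1 R P a c" and s2: "ses C A2 R2 P i c2" and s3: "ses C Y A1 A2 y \<pi>"
    and r: "r \<in> Hom C R R2" and e: "r \<cdot> a = i \<cdot> \<pi>" "c2 \<cdot> r = c"
  shows "ses C Y R R2 (a \<cdot> y) r"
proof -
  note S1 = sesD[OF s1] and S2 = sesD[OF s2] and S3 = sesD[OF s3]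
  note t = S1(1,2)[unfolded Hom_iff] S2(1,2)[unfolded Hom_iff] S3(1,2)[unfolded Hom_iff] r[unfolded Hom_iff]
  have obj: "Y \<in> Obj C" "A2 \<in> Obj C" "R2 \<in> Obj C" using S2 S3 Hom_obj by auto
  have ay: "a \<cdot> y \<in> Hom C Y R" using S1(1) S3(1) comp_hom by blast
  have mono: "is_mono C (a \<cdot> y)" using mono_comp S1(3) S3(3) t by simp
  have epi: "is_epi C r"
  proof (rule epiI_zero[OF r])
    fix W h assume h: "h \<in> Hom C R2 W" "h \<cdot> r = Zero C R W"
    note ht = h(1)[unfolded Hom_iff]
    have W: "W \<in> Obj C" using h Hom_obj by blast
    have "(h \<cdot> i) \<cdot> \<pi> = (h \<cdot> r) \<cdot> a" using e ht t by (simp add: assoc)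
    also have "\<dots> = Zero C A1 W" using h(2) t W by simp
    finally have "h \<cdot> i = Zero C A2 W" using epi_zero[OF S3(4,2) comp_hom[OF S2(1) h(1)]] by blast
    then obtain h' where h': "h' \<in> Hom C P W" "h' \<cdot> c2 = h" using ses_desc[OF s2 h(1)] by blast
    have "h' \<cdot> c = Zero C R W"
      using h' e(2) h(2) assoc[of r c2 h'] t by (simp add: Hom_iff)
    then have "h' = Zero C P W" using epi_zero[OF S1(4,2) h'(1)] by blast
    then show "h = Zero C R2 W" using h' t W by auto
  qed
  have "is_kernel C (a \<cdot> y) r"
  proof (rule kernelI[OF ay r _ mono])
    have "r \<cdot> (a \<cdot> y) = i \<cdot> (\<pi> \<cdot> y)" using assoc[of y a r] assoc[of y \<pi> i] e t by simp
    then show "r \<cdot> (a \<cdot> y) = Zero C Y R2" using S3(7) t obj by simp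
    fix W x assume x: "x \<in> Hom C W R" "r \<cdot> x = Zero C W R2"
    note xt = x(1)[unfolded Hom_iff]
    have W: "W \<in> Obj C" using x Hom_obj by blast
    have "c \<cdot> x = Zero C W P" using assoc_eq[OF e(2), of x] x(2) t xt W by simp
    then obtain u where u: "u \<in> Hom C W A1" "a \<cdot> u = x" using ses_lift[OF s1 x(1)] by blast
    note ut = u(1)[unfolded Hom_iff]
    have "i \<cdot> (\<pi> \<cdot> u) = r \<cdot> x" using assoc[of u a r] assoc[of u \<pi> i] e(1) u(2) t ut by simp
    then have "i \<cdot> (\<pi> \<cdot> u) = Zero C W R2" using x by simp
    then have "\<pi> \<cdot> u = Zero C W A2" using mono_zero[OF S2(3,1) comp_hom[OF u(1) S3(2)]] by blast
    then obtain v where v: "v \<in> Hom C W Y" "y \<cdot> v = u" using ses_lift[OF s3 u(1)] by blast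
    have "(a \<cdot> y) \<cdot> v = x" using v u t by (simp add: assoc Hom_iff)
    then show "\<exists>u\<in>Hom C W Y. a \<cdot> y \<cdot> u = x" using v by blast
  qed
  then show ?thesis using sesI_kernel[OF epi _ ay r] by blast
qed

end

section \<open>Lifting against projective resolutions\<close>

context abelian_category begin

lemma is_image_fact_epi: "is_epi C e \<Longrightarrow> is_image_fact C e (Ident C (Cod C e)) e"
  using epi_arr cod_obj mono_ident by (auto simp: is_image_fact_def)

lemma projective_lift:
  "\<lbrakk>projective C P; is_epi C e; e \<in> Hom C X Y; f \<in> Hom C P Y\<rbrakk> \<Longrightarrow> \<exists>g \<in> Hom C P X. e \<cdot> g = f"
  unfolding projective_def by (auto simp: Hom_def)

lemma injective_extend:
  "\<lbrakk>injective C J; is_mono C m; m \<in> Hom C X Y; f \<in> Hom C X J\<rbrakk> \<Longrightarrow> \<exists>g \<in> Hom C Y J. g \<cdot> m = f"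
  unfolding injective_def by (auto simp: Hom_def)

lemma ex_proj_resolution:
  assumes ep: "enough_projectives C" and X: "X \<in> Obj C"
  shows "\<exists>P d e. is_proj_resolution C X P d e"
proof -
  \<comment> \<open>One sequence of arrows carries the whole resolution: \<open>a 0\<close> is the
    augmentation and \<open>a (Suc i)\<close> is \<open>d i\<close>. Dependent choice then only has
    to add one arrow, a projective cover of the kernel of the last one followed by the
    inclusion.\<close>
  define Q where
    "Q n a \<longleftrightarrow> a \<in> Arr C \<and> projective C (Dom C a) \<and> (n = 0 \<longrightarrow> is_epi C a \<and> Cod C a = X)" for n :: nat and a
  have "\<exists>a. \<forall>n. Q n (a n) \<and> exact C (a (Suc n)) (a n)"
  proof (rule dependent_nat_choice)
    obtain P e where "projective C P" "e \<in> Hom C P X" "is_epi C e"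
      using ep X unfolding enough_projectives_def by blast
    then have "Q 0 e" by (simp add: Q_def Hom_iff)
    then show "\<exists>x. Q 0 x" by blast
    fix a n assume "Q n a"
    then have a: "a \<in> Arr C" by (simp add: Q_def)
    obtain k where k: "is_kernel C k a" using ex_kernel a by blast
    note kD = kernelD(1-4)[OF k, unfolded Hom_iff]
    have "Dom C k \<in> Obj C" using kD dom_obj by simp
    then obtain P q where q: "projective C P" "q \<in> Hom C P (Dom C k)" "is_epi C q"
      using ep unfolding enough_projectives_def by blast
    have "exact C (k \<cdot> q) a" using exact_comp_epi[OF k q(3)] q(2) by (simp add: Hom_iff)
    moreover have "Q (Suc n) (k \<cdot> q)" using q kD by (simp add: Q_def Hom_iff)
    ultimately show "\<exists>y. Q (Suc n) y \<and> exact C y a" by blast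
  qed
  then obtain a where a: "\<And>n. Q n (a n)" "\<And>n. exact C (a (Suc n)) (a n)" by blast
  have "is_proj_resolution C X (\<lambda>i. Dom C (a i)) (\<lambda>i. a (Suc i)) (a 0)"
    using a exactD(1)[OF a(2)] a(1)[of 0] by (simp add: is_proj_resolution_def Q_def Hom_iff)
  then show ?thesis by blast
qed

section \<open>Vanishing of Ext as a condition on the chosen resolution\<close>

lemma chosen_resolution:
  assumes "enough_projectives C" and "X \<in> Obj C"
  obtains P d e where "chosen_resolution C X = (P, d, e)" "is_proj_resolution C X P d e"
proof -
  let ?R = "\<lambda>(P, d, e). is_proj_resolution C X P d e"
  have "\<exists>x. ?R x" using ex_proj_resolution[OF assms] by auto
  then have "?R (SOME x. ?R x)" by (rule someI_ex)
  moreover obtain P d e where "(SOME x. ?R x) = (P, d, e)" by (metis prod_cases3)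
  ultimately show ?thesis using that[of P d e] by (simp add: chosen_resolution_def)
qed

text \<open>\<open>trivial_group\<close> includes the group axioms of the quotient. This is why the
  cocycles are shown to form a subgroup, and why the converse direction divides a commutative group
  by all of itself.\<close>

lemma Ext_trivial_iff:
  assumes ch: "chosen_resolution C X = (P, d, e)" and res: "is_proj_resolution C X P d e"
    and Y: "Y \<in> Obj C"
  shows "trivial_group (Ext C (Suc i) X Y) \<longleftrightarrow>
    cocycles C P d Y (Suc i) \<subseteq> coboundaries C P d Y (Suc i)"
proof -
  let ?Z = "cocycles C P d Y (Suc i)" and ?B = "coboundaries C P d Y (Suc i)"
  define H where "H = hom_group C (P (Suc i)) Y"
  define G where "G = H\<lparr>carrier := ?Z\<rparr>"
  have E: "Ext C (Suc i) X Y = G Mod ?B" by (simp add: Ext_def ch G_def H_def)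
  have d: "\<And>i. d i \<in> Hom C (P (Suc i)) (P i)" and dd: "\<And>i. d i \<cdot> d (Suc i) = Zero C (P (Suc (Suc i))) (P i)"
  proof -
    show d: "\<And>i. d i \<in> Hom C (P (Suc i)) (P i)" using res by (simp add: is_proj_resolution_def)
    fix i
    have "exact C (d (Suc i)) (d i)" using res by (simp add: is_proj_resolution_def)
    then show "d i \<cdot> d (Suc i) = Zero C (P (Suc (Suc i))) (P i)"
      using exactD(3) d[of i] d[of "Suc i"] by (fastforce simp: Hom_iff)
  qed
  have P: "\<And>i. P i \<in> Obj C" using d Hom_obj by blast
  interpret H: comm_group H unfolding H_def by (rule hom_comm_group[OF P Y])
  have cH: "carrier H = Hom C (P (Suc i)) Y" "mult H = Add C" "one H = Zero C (P (Suc i)) Y"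
    by (simp_all add: H_def hom_group_def)
  have zB: "Zero C (P (Suc i)) Y \<in> ?B"
    using zero_comp_hom[OF d Y, symmetric] zero_hom[OF P Y] by auto
  have sub: "subgroup ?Z H"
  proof (rule H.subgroupI)
    show "?Z \<subseteq> carrier H" by (auto simp: cocycles_def cH)
    have "Zero C (P (Suc i)) Y \<in> ?Z" using zero_hom[OF P Y] zero_comp_hom[OF d Y] by (simp add: cocycles_def)
    then show "?Z \<noteq> {}" by blast
  next
    fix a assume "a \<in> ?Z"
    then have a: "a \<in> Hom C (P (Suc i)) Y" "a \<cdot> d (Suc i) = Zero C (P (Suc (Suc i))) Y" by (auto simp: cocycles_def)
    have n: "inv\<^bsub>H\<^esub> a \<in> Hom C (P (Suc i)) Y" "inv\<^bsub>H\<^esub> a \<boxplus> a = Zero C (P (Suc i)) Y"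
      using a(1) H.inv_closed[of a] H.l_inv[of a] by (simp_all add: cH)
    have "inv\<^bsub>H\<^esub> a \<cdot> d (Suc i) \<boxplus> a \<cdot> d (Suc i) = Zero C (P (Suc (Suc i))) Y"
      using comp_add_left[OF d n(1) a(1)] n(2) zero_comp_hom[OF d Y] by simp
    then have "inv\<^bsub>H\<^esub> a \<cdot> d (Suc i) = Zero C (P (Suc (Suc i))) Y"
      using a(2) add_zero[OF comp_hom[OF d n(1)]] by simp
    then show "inv\<^bsub>H\<^esub> a \<in> ?Z" using n by (simp add: cocycles_def)
  next
    fix a b assume "a \<in> ?Z" "b \<in> ?Z"
    then have a: "a \<in> Hom C (P (Suc i)) Y" "a \<cdot> d (Suc i) = Zero C (P (Suc (Suc i))) Y"
      and b: "b \<in> Hom C (P (Suc i)) Y" "b \<cdot> d (Suc i) = Zero C (P (Suc (Suc i))) Y" by (auto simp: cocycles_def)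
    then show "a \<otimes>\<^bsub>H\<^esub> b \<in> ?Z"
      using comp_add_left[OF d a(1) b(1)] add_zero[OF zero_hom[OF P Y]] add_hom by (simp add: cocycles_def cH)
  qed
  have BZ: "?B \<subseteq> ?Z"
  proof
    fix x assume "x \<in> ?B"
    then obtain g where g: "g \<in> Hom C (P i) Y" "x = g \<cdot> d i" by auto
    have "x \<cdot> d (Suc i) = g \<cdot> (d i \<cdot> d (Suc i))" unfolding g(2) by (rule comp_assoc[OF d d g(1)])
    then show "x \<in> ?Z" using g comp_hom[OF d g(1)] dd comp_zero_hom[OF g(1) P] by (simp add: cocycles_def)
  qed
  show ?thesis
  proof
    assume "trivial_group (Ext C (Suc i) X Y)"
    then have c: "carrier (G Mod ?B) = {?B}"
      unfolding E by (simp add: trivial_group_def FactGroup_def)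
    show "?Z \<subseteq> ?B"
    proof
      fix f assume f: "f \<in> ?Z"
      then have "?B #>\<^bsub>G\<^esub> f \<in> carrier (G Mod ?B)" by (auto simp: FactGroup_def RCOSETS_def G_def)
      then have "?B #>\<^bsub>G\<^esub> f = ?B" using c by blast
      \<comment> \<open>A trivial quotient makes the coset of \<open>f\<close> equal to the
        coboundaries; \<open>f\<close> is recovered from that coset as 0 + f.\<close>
      moreover have "Zero C (P (Suc i)) Y \<boxplus> f \<in> ?B #>\<^bsub>G\<^esub> f"
        using zB by (auto simp: r_coset_def G_def cH simp del: coboundaries.simps)
      ultimately show "f \<in> ?B" using zero_add[of f "P (Suc i)" Y] f by (simp add: cocycles_def)
    qed
  next
    assume "?Z \<subseteq> ?B"
    then have eq: "?B = carrier G" using BZ by (simp add: G_def)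
    interpret G: comm_group G
      unfolding G_def
      by (rule group.group_comm_groupI[OF subgroup.subgroup_is_group[OF sub H.is_group]])
        (use subgroup.subset[OF sub] H.m_comm in auto)
    have n: "carrier G \<lhd> G" by (rule G.subgroup_imp_normal[OF G.subgroup_self])
    have "carrier (G Mod carrier G) = {carrier G}"
      using G.coset_join2[OF _ G.subgroup_self] G.one_closed by (auto simp: FactGroup_def RCOSETS_def)
    then show "trivial_group (Ext C (Suc i) X Y)"
      unfolding E eq trivial_group_def using normal.factorgroup_is_group[OF n] by (simp add: FactGroup_def)
  qed
qed

text \<open>The hypothesis \<open>van\<close> says that Hom(-, Y) has no cohomology at
  \<open>Q2\<close>. Since \<open>Q1 -> Dom C i\<close> is the cokernel of \<open>b\<close>, this
  plays the role of Ext^1(Dom i, Y) = 0. Stating it for the image of an arbitrary \<open>a\<close>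
  covers two uses: for the augmentation the image is the resolved object itself and the condition is
  Ext^1 = 0; for \<open>d 0\<close> it is the first syzygy and the condition is Ext^2 = 0 of the
  resolved object. Dimension shifting is thereby built in.\<close>

lemma ext_lift:
  assumes ex: "exact C b a" and im: "is_image_fact C a i q" and b: "b \<in> Hom C Q2 Q1"
    and c: "c \<in> Hom C Q3 Q2" and bc: "b \<cdot> c = Zero C Q3 Q1" and Q1: "projective C Q1"
    and van: "\<And>h. \<lbrakk>h \<in> Hom C Q2 Y; h \<cdot> c = Zero C Q3 Y\<rbrakk> \<Longrightarrow> \<exists>g \<in> Hom C Q1 Y. h = g \<cdot> b"
    and s: "ses C Y E V y \<pi>" and t: "t \<in> Hom C (Dom C i) V"
  shows "\<exists>l \<in> Hom C (Dom C i) E. \<pi> \<cdot> l = t"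
proof -
  note S = sesD[OF s]
  have qb: "is_cokernel C q b" by (rule exact_coimage_cokernel[OF ex im])
  have q: "q \<in> Hom C Q1 (Dom C i)" "is_epi C q"
    using image_fact_arr[OF im] cokernelD(1)[OF qb] b by (simp_all add: Hom_iff)
  have qb0: "q \<cdot> b = Zero C Q2 (Dom C i)" using cokernelD(3)[OF qb] q b by (simp add: Hom_iff)
  have tq: "t \<cdot> q \<in> Hom C Q1 V" using q t comp_hom by blast
  note T = S(1,2)[unfolded Hom_iff] b[unfolded Hom_iff] c[unfolded Hom_iff] q(1)[unfolded Hom_iff]
    t[unfolded Hom_iff]
  have obj: "V \<in> Obj C" "Q2 \<in> Obj C" "Q3 \<in> Obj C" using t b c Hom_obj by blast+
  obtain k where k: "k \<in> Hom C Q1 E" "\<pi> \<cdot> k = t \<cdot> q"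
    using projective_lift[OF Q1 S(4,2) tq] by blast
  note kt = k(1)[unfolded Hom_iff]
  have "\<pi> \<cdot> (k \<cdot> b) = t \<cdot> (q \<cdot> b)" using assoc[of b k \<pi>] assoc[of b q t] k(2) T kt by simp
  then have "\<pi> \<cdot> (k \<cdot> b) = Zero C Q2 V" using qb0 T obj by simp
  then obtain h where h: "h \<in> Hom C Q2 Y" "y \<cdot> h = k \<cdot> b" using ses_lift[OF s comp_hom[OF b k(1)]] by blast
  note ht = h(1)[unfolded Hom_iff]
  have "y \<cdot> (h \<cdot> c) = k \<cdot> (b \<cdot> c)" using assoc[of c h y] assoc[of c b k] h(2) T ht kt by simp
  then have "y \<cdot> (h \<cdot> c) = Zero C Q3 E" using bc kt obj by simp
  then have "h \<cdot> c = Zero C Q3 Y" using mono_zero[OF S(3,1) comp_hom[OF c h(1)]] by blast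
  then obtain g where g: "g \<in> Hom C Q1 Y" "h = g \<cdot> b" using van h(1) by blast
  note gt = g(1)[unfolded Hom_iff]
  have yg: "y \<cdot> g \<in> Hom C Q1 E" using comp_hom g(1) S(1) by blast
  \<comment> \<open>Both \<open>k\<close> and x = k - y g lift \<open>t \<cdot> q\<close>, but
    \<open>x\<close> also kills \<open>b\<close>, so it descends along the cokernel \<open>q\<close>
    to the lift of \<open>t\<close>.\<close>
  obtain x where x: "x \<in> Hom C Q1 E" "k = (y \<cdot> g) \<boxplus> x"
    and x2: "\<And>d W. \<lbrakk>d \<in> Hom C W Q1; k \<cdot> d = (y \<cdot> g) \<cdot> d\<rbrakk> \<Longrightarrow> x \<cdot> d = Zero C W E"
    by (rule diff_ex[OF k(1) yg]) (rule that)
  have "(y \<cdot> g) \<cdot> b = y \<cdot> h" unfolding g(2) using T gt by (simp add: assoc)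
  then have "k \<cdot> b = (y \<cdot> g) \<cdot> b" using h(2) by metis
  then have xb: "x \<cdot> b = Zero C Q2 E" using x2 b by blast
  have "\<exists>l \<in> Hom C (Dom C i) E. l \<cdot> q = x"
    by (rule cokernel_desc[OF qb]) (use xb x T in \<open>simp_all add: Hom_iff\<close>)
  then obtain l where l: "l \<in> Hom C (Dom C i) E" "l \<cdot> q = x" by blast
  note lt = l(1)[unfolded Hom_iff]
  have "\<pi> \<cdot> (y \<cdot> g) = Zero C Q1 V" using assoc_eq[OF S(7), of g] T gt obj by simp
  moreover have "\<pi> \<cdot> k = \<pi> \<cdot> (y \<cdot> g) \<boxplus> \<pi> \<cdot> x" unfolding x(2) by (rule comp_add_right[OF yg x(1) S(2)])
  ultimately have "\<pi> \<cdot> x = t \<cdot> q" using zero_add[OF comp_hom[OF x(1) S(2)]] k(2) by simp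
  then have "(\<pi> \<cdot> l) \<cdot> q = t \<cdot> q" using l(2) T lt by (simp add: assoc)
  then have "\<pi> \<cdot> l = t"
    using epi_cancel[OF q(2), of "\<pi> \<cdot> l" V t] T lt by (simp add: Hom_iff)
  then show ?thesis using l by blast
qed

lemma cocycle_bounds:
  assumes "cocycles C P d Y (Suc i) \<subseteq> coboundaries C P d Y (Suc i)"
    "h \<in> Hom C (P (Suc i)) Y" "h \<cdot> d (Suc i) = Zero C (P (Suc (Suc i))) Y"
  shows "\<exists>g \<in> Hom C (P i) Y. h = g \<cdot> d i"
  using assms by (auto simp: cocycles_def)

text \<open>Let K be the kernel of Q 0 -> P2. The extension \<open>R2\<close> of \<open>P2\<close>
  by \<open>A2\<close> is the pushout of K -> Q 0 along a map \<open>t\<close> from K to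
  \<open>A2\<close>. If \<open>t\<close> lifts to \<open>l\<close> from K to \<open>E\<close>,
  pushing out along \<open>l\<close> instead gives an extension \<open>R\<close> of
  \<open>P2\<close> by \<open>E\<close> lying over \<open>R2\<close>.\<close>

lemma ses_combine:
  assumes ep: "enough_projectives C" and s: "ses C A1 A A2 a a'" and s1: "ses C A1 R1 P1 u1 v1"
    and s2: "ses C A2 R2 P2 u2 v2" and ext: "trivial_group (Ext C 2 P2 R1)"
  shows "\<exists>R P f g f1 g1 f2 g2. ses C A R P f g \<and> ses C R1 R R2 f1 g1 \<and> ses C P1 P P2 f2 g2"
proof -
  obtain E m b h k where s3: "ses C R1 E A2 m b" and s4: "ses C A E P1 h k"
    by (rule pushout_two_ses[OF s s1])
  note S2 = sesD[OF s2] and S3 = sesD[OF s3]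
  have obj: "P2 \<in> Obj C" "R1 \<in> Obj C" "R2 \<in> Obj C" using S2 S3 Hom_obj by blast+
  obtain Q d e where ch: "chosen_resolution C P2 = (Q, d, e)" and res: "is_proj_resolution C P2 Q d e"
    using chosen_resolution[OF ep obj(1)] by blast
  have van: "cocycles C Q d R1 (Suc 1) \<subseteq> coboundaries C Q d R1 (Suc 1)"
    using ext Ext_trivial_iff[OF ch res obj(2), of 1] by (simp add: numeral_2_eq_2)
  have pr: "\<And>i. projective C (Q i)" and d: "\<And>i. d i \<in> Hom C (Q (Suc i)) (Q i)"
    and e: "e \<in> Hom C (Q 0) P2" "is_epi C e" and exe: "exact C (d 0) e"
    and exd: "\<And>i. exact C (d (Suc i)) (d i)" using res by (simp_all add: is_proj_resolution_def)
  obtain i q where im: "is_image_fact C (d 0) i q" using ex_image_fact d by (metis Hom_iff)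
  have ik: "is_kernel C i e" by (rule exact_image_kernel[OF exe im])
  define K where "K = Dom C i"
  have i: "i \<in> Hom C K (Q 0)" using kernelD(1)[OF ik] e by (simp add: K_def Hom_iff)
  have s5: "ses C K (Q 0) P2 i e" by (rule sesI_kernel[OF e(2) ik i e(1)])
  note S5 = sesD[OF s5]
  \<comment> \<open>Projectivity of \<open>Q 0\<close> compares the presentation of
    \<open>P2\<close> with the given extension; \<open>t\<close> is the induced map of
    kernels.\<close>
  obtain w where w: "w \<in> Hom C (Q 0) R2" "v2 \<cdot> w = e"
    using projective_lift[OF pr S2(4,2) e(1)] by blast
  note T = S2(1,2)[unfolded Hom_iff] S3(1,2)[unfolded Hom_iff] S5(1,2)[unfolded Hom_iff] w(1)[unfolded Hom_iff]
  have "v2 \<cdot> (w \<cdot> i) = Zero C K P2" using assoc[of i w v2] w(2) S5(7) T by simp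
  then obtain t where t: "t \<in> Hom C K A2" "u2 \<cdot> t = w \<cdot> i" using ses_lift[OF s2 comp_hom[OF i w(1)]] by blast
  note tt = t(1)[unfolded Hom_iff]
  \<comment> \<open>Here \<open>ext_lift\<close> is applied with \<open>a = d 0\<close>, so the
    object to lift from is the syzygy K, and the cohomology in degree 2 that \<open>van\<close>
    kills is the obstruction.\<close>
  have "\<exists>l \<in> Hom C (Dom C i) E. b \<cdot> l = t"
  proof (rule ext_lift[OF exd im _ d _ pr _ s3])
    show d1: "d (Suc 0) \<in> Hom C (Q (Suc (Suc 0))) (Q (Suc 0))" by (rule d)
    show "d (Suc 0) \<cdot> d (Suc (Suc 0)) = Zero C (Q (Suc (Suc (Suc 0)))) (Q (Suc 0))"
      using exactD(3)[OF exd[of "Suc 0"]] d[of "Suc 0"] d[of "Suc (Suc 0)"] by (simp add: Hom_iff)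
    show "t \<in> Hom C (Dom C i) A2" using t by (simp add: K_def)
  qed (use cocycle_bounds[OF van] in simp)
  then obtain l where l: "l \<in> Hom C K E" "b \<cdot> l = t" unfolding K_def by blast
  note lt = l(1)[unfolded Hom_iff]
  obtain R n z c where po: "is_pushout C l i n z" and s6: "ses C E R P2 n c" and z: "z \<in> Hom C (Q 0) R"
    and sq: "n \<cdot> l = z \<cdot> i" "c \<cdot> z = e" by (rule pushout_ses[OF s5 l(1)])
  note S6 = sesD[OF s6]
  note T6 = S6(1,2)[unfolded Hom_iff] z[unfolded Hom_iff]
  have "\<exists>r \<in> Hom C (Cod C n) R2. r \<cdot> n = u2 \<cdot> b \<and> r \<cdot> z = w"
    by (rule pushout_ex1[OF po]) (use T T6 lt tt t l assoc[of l b u2] in \<open>simp_all add: Hom_iff\<close>)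
  then obtain r where r: "r \<in> Hom C R R2" "r \<cdot> n = u2 \<cdot> b" "r \<cdot> z = w" using T6 by auto
  note rt = r(1)[unfolded Hom_iff]
  \<comment> \<open>This makes \<open>r\<close> a map of extensions of \<open>P2\<close> over
    \<open>b\<close>, so its kernel is that of E -> A2, namely \<open>R1\<close>.\<close>
  have "v2 \<cdot> r = c"
  proof (rule pushout_eq[OF po])
    show "v2 \<cdot> r \<in> Hom C (Cod C n) P2" "c \<in> Hom C (Cod C n) P2" using T T6 rt by (simp_all add: Hom_iff)
    have "v2 \<cdot> r \<cdot> n = Zero C E P2"
      using assoc[of n r v2] r(2) assoc_eq[OF S2(7), of b] T T6 rt obj by simp
    then show "v2 \<cdot> r \<cdot> n = c \<cdot> n" using S6(7) by simp
    show "v2 \<cdot> r \<cdot> z = c \<cdot> z" using assoc[of z r v2] r(3) w(2) sq(2) T T6 rt by simp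
  qed
  then have s7: "ses C R1 R R2 (n \<cdot> m) r" using ses_map_kernel[OF s6 s2 s3 r(1,2)] by blast
  \<comment> \<open>The cokernel of the composite A -> E -> R is filtered by those of its factors,
    which are \<open>P1\<close> and \<open>P2\<close>.\<close>
  obtain P c' f2 g2 where "ses C A R P (n \<cdot> h) c'" "ses C P1 P P2 f2 g2"
    by (rule ses_comp_mono[OF s4 s6])
  then show ?thesis using s7 by blast
qed

end

section \<open>The extension category is abelian\<close>

locale eta_datum = abelian_category B for B :: "('o, 'm) acat" (structure) +
  fixes F :: "('o, 'm, 'o, 'm) fctr" and \<eta> :: "'o \<Rightarrow> 'm"
  assumes additive: "is_additive_functor B B F" and rex: "right_exact B B F"
    and nat: "nat_trans B B (functor_comp F F) F \<eta>"
begin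

abbreviation A where "A \<equiv> eta_extension B F \<eta>"

lemma F_hom: "f \<in> Hom B X Y \<Longrightarrow> AMap F f \<in> Hom B (OMap F X) (OMap F Y)"
  and F_obj [simp]: "X \<in> Obj B \<Longrightarrow> OMap F X \<in> Obj B"
  and F_ident [simp]: "X \<in> Obj B \<Longrightarrow> AMap F (Ident B X) = Ident B (OMap F X)"
  and F_comp_hom: "\<lbrakk>f \<in> Hom B X Y; g \<in> Hom B Y Z\<rbrakk> \<Longrightarrow> AMap F (g \<cdot> f) = AMap F g \<cdot> AMap F f"
  and F_add_hom: "\<lbrakk>f \<in> Hom B X Y; g \<in> Hom B X Y\<rbrakk> \<Longrightarrow> AMap F (f \<boxplus> g) = AMap F f \<boxplus> AMap F g"
  using additive unfolding is_additive_functor_def is_functor_def by blast+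

lemma F_arr [simp]:
  assumes "f \<in> Arr B"
  shows "AMap F f \<in> Arr B" "Dom B (AMap F f) = OMap F (Dom B f)" "Cod B (AMap F f) = OMap F (Cod B f)"
  using F_hom[of f "Dom B f" "Cod B f"] assms by (simp_all add: Hom_iff)

lemma F_comp [simp]:
  "\<lbrakk>f \<in> Arr B; g \<in> Arr B; Cod B f = Dom B g\<rbrakk> \<Longrightarrow> AMap F (g \<cdot> f) = AMap F g \<cdot> AMap F f"
  using F_comp_hom[of f "Dom B f" "Cod B f" g "Cod B g"] by (simp add: Hom_iff)

lemma F_add [simp]:
  "\<lbrakk>f \<in> Arr B; g \<in> Arr B; Dom B f = Dom B g; Cod B f = Cod B g\<rbrakk> \<Longrightarrow> AMap F (f \<boxplus> g) = AMap F f \<boxplus> AMap F g"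
  using F_add_hom[of f "Dom B f" "Cod B f" g] by (simp add: Hom_iff)

lemma F_zero [simp]:
  assumes "X \<in> Obj B" "Y \<in> Obj B"
  shows "AMap F (Zero B X Y) = Zero B (OMap F X) (OMap F Y)"
proof (rule dbl_zero)
  show "AMap F (Zero B X Y) \<in> Hom B (OMap F X) (OMap F Y)" using F_hom zero_hom assms by blast
  show "AMap F (Zero B X Y) \<boxplus> AMap F (Zero B X Y) = AMap F (Zero B X Y)"
    using F_add_hom[OF zero_hom zero_hom, OF assms assms] add_zero[OF zero_hom[OF assms]] by simp
qed

lemma eta_hom: "X \<in> Obj B \<Longrightarrow> \<eta> X \<in> Hom B (OMap F (OMap F X)) (OMap F X)"
  using nat by (simp add: nat_trans_def functor_comp_def)

lemma eta_arr [simp]: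
  assumes "X \<in> Obj B"
  shows "\<eta> X \<in> Arr B" "Dom B (\<eta> X) = OMap F (OMap F X)" "Cod B (\<eta> X) = OMap F X"
  using eta_hom[OF assms] by (simp_all add: Hom_iff)

lemma eta_nat: "f \<in> Hom B X Y \<Longrightarrow> \<eta> Y \<cdot> AMap F (AMap F f) = AMap F f \<cdot> \<eta> X"
  using nat unfolding nat_trans_def functor_comp_def by simp

lemma F_epi:
  assumes "is_epi B e"
  shows "is_epi B (AMap F e)"
proof -
  obtain k where k: "is_kernel B k e" using ex_kernel epi_arr assms by blast
  have "ses B (Dom B k) (Dom B e) (Cod B e) k e"
    by (rule sesI_kernel[OF assms k kernelD(1,2)[OF k]])
  then show ?thesis using rex unfolding right_exact_def by blast
qed

text \<open>\<open>right_exact\<close> speaks of short exact sequences, while \<open>f\<close> need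
  not be mono. Replacing \<open>f\<close> by its image \<open>i\<close> does not change the
  cokernel, and since F keeps \<open>q\<close> epi, an arrow that kills F(f) kills F(i).\<close>

lemma F_cokernel_desc:
  assumes c: "is_cokernel B c f" and f: "f \<in> Hom B X Y" and x: "x \<in> Hom B (OMap F Y) W"
    and xf: "x \<cdot> AMap F f = Zero B (OMap F X) W"
  shows "\<exists>u \<in> Hom B (OMap F (Cod B c)) W. u \<cdot> AMap F c = x"
proof -
  have fa: "f \<in> Arr B" using f by (simp add: Hom_iff)
  obtain i q where im: "is_image_fact B f i q" using ex_image_fact fa by blast
  define I where "I = Dom B i"
  define K where "K = Cod B c"
  have i: "i \<in> Hom B I Y" "q \<in> Hom B X I" "i \<cdot> q = f" "is_mono B i" "is_epi B q"
    using image_fact_arr[OF im] f by (simp_all add: Hom_iff I_def)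
  have cc: "c \<in> Hom B Y K" "is_epi B c" "c \<cdot> f = Zero B X K"
    using cokernelD(1-4)[OF c] f by (simp_all add: Hom_iff K_def)
  note t = i(1,2)[unfolded Hom_iff] cc(1)[unfolded Hom_iff] f[unfolded Hom_iff] x[unfolded Hom_iff]
  have "(c \<cdot> i) \<cdot> q = Zero B X K" using cc(3) i(3) t by (simp add: assoc)
  then have ci0: "c \<cdot> i = Zero B I K" using epi_zero[OF i(5,2) comp_hom[OF i(1) cc(1)]] by blast
  have "is_cokernel B c i"
  proof (rule cokernelI[OF cc(1) i(1) ci0 cc(2)])
    fix V h assume h: "h \<in> Hom B Y V" "h \<cdot> i = Zero B I V"
    have "h \<cdot> f = (h \<cdot> i) \<cdot> q" using assoc[of q i h] i(3) t h(1) by (simp add: Hom_iff)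
    then have hf: "h \<cdot> f = Zero B X V" using h(2) zero_comp_hom[OF i(2)] Hom_obj[OF h(1)] by simp
    show "\<exists>u\<in>Hom B K V. u \<cdot> c = h"
      by (rule cokernel_desc[OF c]) (use hf h(1) t in \<open>simp_all add: Hom_iff\<close>)
  qed
  then have "ses B I Y K i c" using sesI_cokernel[OF i(4)] i cc by blast
  then have e: "exact B (AMap F i) (AMap F c)" and epi: "is_epi B (AMap F c)"
    using rex unfolding right_exact_def by blast+
  have ck: "is_cokernel B (AMap F c) (AMap F i)"
    using exact_coimage_cokernel[OF e is_image_fact_epi[OF epi]] .
  have xi: "x \<cdot> AMap F i \<in> Hom B (OMap F I) W" using comp_hom F_hom i(1) x by blast
  have "(x \<cdot> AMap F i) \<cdot> AMap F q = x \<cdot> AMap F (i \<cdot> q)" using t by (simp add: assoc)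
  then have "(x \<cdot> AMap F i) \<cdot> AMap F q = Zero B (OMap F X) W" using i(3) xf by simp
  then have "x \<cdot> AMap F i = Zero B (OMap F I) W"
    using epi_zero[OF F_epi[OF i(5)] F_hom[OF i(2)] xi] by blast
  then show ?thesis
    apply -
    apply (rule cokernel_desc[OF ck])
    apply (use t in \<open>simp_all add: Hom_iff\<close>)
    done
qed

section \<open>The extension as a preadditive category\<close>

lemma obj_ext: "(X, f) \<in> Obj A \<longleftrightarrow>
    X \<in> Obj B \<and> f \<in> Hom B (OMap F X) X \<and> f \<cdot> AMap F f = f \<cdot> \<eta> X"
  by (simp add: eta_extension_def eta_objects_def)

lemma arr_ext: "((X, f), \<alpha>, (Y, g)) \<in> Arr A \<longleftrightarrow>
    (X, f) \<in> Obj A \<and> (Y, g) \<in> Obj A \<and> \<alpha> \<in> Hom B X Y \<and> \<alpha> \<cdot> f = g \<cdot> AMap F \<alpha>"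
  by (simp add: eta_extension_def eta_arrows_def)

lemma ext_sel [simp]:
  "Dom A (U, \<alpha>, V) = U" "Cod A (U, \<alpha>, V) = V" "Ident A U = (U, Ident B (fst U), U)"
  "Comp A (V', \<beta>, W) (U, \<alpha>, V) = (U, \<beta> \<cdot> \<alpha>, W)"
  "Add A (U, \<alpha>, V) (U', \<beta>, V') = (U, \<alpha> \<boxplus> \<beta>, V)"
  "Zero A U V = (U, Zero B (fst U) (fst V), V)"
  by (simp_all add: eta_extension_def)

lemma arr_ext_cases:
  assumes "u \<in> Arr A"
  obtains X f \<alpha> Y g where "u = ((X, f), \<alpha>, (Y, g))" "((X, f), \<alpha>, (Y, g)) \<in> Arr A"
  using assms by (cases u) auto

lemma hom_ext: "u \<in> Hom A (X, f) (Y, g) \<longleftrightarrow> (\<exists>\<alpha>. u = ((X, f), \<alpha>, (Y, g)) \<and> ((X, f), \<alpha>, (Y, g)) \<in> Arr A)"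
  by (cases u) (auto simp: Hom_def)

lemma ext_compI:
  assumes "((X, f), \<alpha>, (Y, g)) \<in> Arr A" "((Y, g), \<beta>, (Z, h)) \<in> Arr A"
  shows "((X, f), \<beta> \<cdot> \<alpha>, (Z, h)) \<in> Arr A"
proof -
  have t: "f \<in> Hom B (OMap F X) X" "g \<in> Hom B (OMap F Y) Y" "h \<in> Hom B (OMap F Z) Z"
    "\<alpha> \<in> Hom B X Y" "\<beta> \<in> Hom B Y Z" "\<alpha> \<cdot> f = g \<cdot> AMap F \<alpha>" "\<beta> \<cdot> g = h \<cdot> AMap F \<beta>"
    using assms by (auto simp: arr_ext obj_ext)
  note T = t(1-5)[unfolded Hom_iff]
  have "(\<beta> \<cdot> \<alpha>) \<cdot> f = \<beta> \<cdot> (g \<cdot> AMap F \<alpha>)" using T t(6) by (simp add: assoc)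
  also have "\<dots> = h \<cdot> AMap F (\<beta> \<cdot> \<alpha>)" using T by (simp add: assoc_eq[OF t(7)] assoc)
  finally show ?thesis using assms T by (simp add: arr_ext Hom_iff)
qed

lemma category_ext: "category A"
proof
  fix u assume "u \<in> Arr A"
  then obtain X f \<alpha> Y g where "u = ((X, f), \<alpha>, (Y, g))" "((X, f), \<alpha>, (Y, g)) \<in> Arr A"
    by (rule arr_ext_cases)
  then show "Dom A u \<in> Obj A" "Cod A u \<in> Obj A" by (simp_all add: arr_ext)
next
  fix U assume "U \<in> Obj A"
  then show "Ident A U \<in> Hom A U U"
    by (cases U) (auto simp: hom_ext arr_ext obj_ext ident_hom Hom_iff)
next
  fix U V W u v assume "u \<in> Hom A U V" "v \<in> Hom A V W"
  then show "Comp A v u \<in> Hom A U W"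
    by (cases U; cases V; cases W) (auto simp: hom_ext intro: ext_compI)
next
  fix U V u assume "u \<in> Hom A U V"
  then show "Comp A u (Ident A U) = u" "Comp A (Ident A V) u = u"
    by (cases U; cases V; auto simp: hom_ext arr_ext Hom_iff)+
next
  fix U V W T u v w assume "u \<in> Hom A U V" "v \<in> Hom A V W" "w \<in> Hom A W T"
  then show "Comp A (Comp A w v) u = Comp A w (Comp A v u)"
    by (cases U; cases V; cases W; cases T) (auto simp: hom_ext arr_ext Hom_iff assoc)
qed

lemma ext_addI:
  assumes "((X, f), \<alpha>, (Y, g)) \<in> Arr A" "((X, f), \<beta>, (Y, g)) \<in> Arr A"
  shows "((X, f), \<alpha> \<boxplus> \<beta>, (Y, g)) \<in> Arr A"
  using assms by (auto simp: arr_ext obj_ext Hom_iff comp_distrib)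

lemma ext_zeroI:
  assumes "(X, f) \<in> Obj A" "(Y, g) \<in> Obj A"
  shows "((X, f), Zero B X Y, (Y, g)) \<in> Arr A"
  using assms by (auto simp: arr_ext obj_ext Hom_iff)

text \<open>Both \<open>n \<cdot> f\<close> and \<open>g \<cdot> AMap F n\<close> are the negative
  of the common value of \<open>\<alpha> \<cdot> f\<close> and
  \<open>g \<cdot> AMap F \<alpha>\<close>.\<close>

lemma ext_negI:
  assumes u: "((X, f), \<alpha>, (Y, g)) \<in> Arr A" and n: "n \<in> Hom B X Y" "\<alpha> \<boxplus> n = Zero B X Y"
  shows "((X, f), n, (Y, g)) \<in> Arr A"
proof -
  have o: "(X, f) \<in> Obj A" "(Y, g) \<in> Obj A" and t: "f \<in> Hom B (OMap F X) X" "g \<in> Hom B (OMap F Y) Y" "\<alpha> \<in> Hom B X Y"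
    "\<alpha> \<cdot> f = g \<cdot> AMap F \<alpha>" "X \<in> Obj B" "Y \<in> Obj B"
    using assms by (auto simp: arr_ext obj_ext)
  have z: "AMap F \<alpha> \<boxplus> AMap F n = Zero B (OMap F X) (OMap F Y)"
    using F_add_hom[OF t(3) n(1)] n(2) t by simp
  have h: "\<alpha> \<cdot> f \<in> Hom B (OMap F X) Y" "n \<cdot> f \<in> Hom B (OMap F X) Y" "g \<cdot> AMap F n \<in> Hom B (OMap F X) Y"
    using comp_hom t n F_hom by blast+
  have "\<alpha> \<cdot> f \<boxplus> n \<cdot> f = Zero B (OMap F X) Y"
    using comp_add_left[OF t(1,3) n(1)] n(2) zero_comp_hom[OF t(1)] t by simp
  moreover have "\<alpha> \<cdot> f \<boxplus> g \<cdot> AMap F n = Zero B (OMap F X) Y"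
    using comp_add_right[OF F_hom[OF t(3)] F_hom[OF n(1)] t(2)] z t(4) comp_zero_hom[OF t(2)] t by simp
  ultimately have "n \<cdot> f = g \<cdot> AMap F n" using add_cancel h by metis
  then show ?thesis using o n by (simp add: arr_ext)
qed

lemma preadditive_ext: "preadditive_category A"
proof (intro preadditive_category.intro preadditive_category_axioms.intro)
  show "category A" by (rule category_ext)
next
  fix U V assume UV: "U \<in> Obj A" "V \<in> Obj A"
  obtain X f where U: "U = (X, f)" by (cases U)
  obtain Y g where V: "V = (Y, g)" by (cases V)
  have o: "(X, f) \<in> Obj A" "(Y, g) \<in> Obj A" using UV U V by auto
  have h: "\<alpha> \<in> Hom B X Y" if "((X, f), \<alpha>, (Y, g)) \<in> Arr A" for \<alpha> using that by (simp add: arr_ext)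
  show "comm_group (hom_group A U V)"
  proof (rule comm_groupI)
    fix x y assume "x \<in> carrier (hom_group A U V)" "y \<in> carrier (hom_group A U V)"
    then show "x \<otimes>\<^bsub>hom_group A U V\<^esub> y \<in> carrier (hom_group A U V)"
      using ext_addI by (auto simp: hom_group_def U V hom_ext)
  next
    show "\<one>\<^bsub>hom_group A U V\<^esub> \<in> carrier (hom_group A U V)"
      using ext_zeroI[OF o] by (simp add: hom_group_def U V hom_ext)
  next
    fix x y z
    assume "x \<in> carrier (hom_group A U V)" "y \<in> carrier (hom_group A U V)" "z \<in> carrier (hom_group A U V)"
    then show "x \<otimes>\<^bsub>hom_group A U V\<^esub> y \<otimes>\<^bsub>hom_group A U V\<^esub> z = x \<otimes>\<^bsub>hom_group A U V\<^esub> (y \<otimes>\<^bsub>hom_group A U V\<^esub> z)"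
      using add_assoc[of _ X Y] by (auto simp: hom_group_def U V hom_ext dest!: h)
  next
    fix x y assume "x \<in> carrier (hom_group A U V)" "y \<in> carrier (hom_group A U V)"
    then show "x \<otimes>\<^bsub>hom_group A U V\<^esub> y = y \<otimes>\<^bsub>hom_group A U V\<^esub> x"
      using add_comm[of _ X Y] by (auto simp: hom_group_def U V hom_ext dest!: h)
  next
    fix x assume "x \<in> carrier (hom_group A U V)"
    then show "\<one>\<^bsub>hom_group A U V\<^esub> \<otimes>\<^bsub>hom_group A U V\<^esub> x = x"
      using zero_add[of _ X Y] by (auto simp: hom_group_def U V hom_ext dest!: h)
  next
    fix x assume "x \<in> carrier (hom_group A U V)"
    then obtain \<alpha> where \<alpha>: "x = ((X, f), \<alpha>, (Y, g))" "((X, f), \<alpha>, (Y, g)) \<in> Arr A"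
      by (auto simp: hom_group_def U V hom_ext)
    obtain n where n: "n \<in> Hom B X Y" "\<alpha> \<boxplus> n = Zero B X Y" using ex_neg h \<alpha>(2) by blast
    have "((X, f), n, (Y, g)) \<in> carrier (hom_group A U V)"
      using ext_negI[OF \<alpha>(2) n] by (simp add: hom_group_def U V hom_ext)
    moreover have "((X, f), n, (Y, g)) \<otimes>\<^bsub>hom_group A U V\<^esub> x = \<one>\<^bsub>hom_group A U V\<^esub>"
      using n add_comm[OF n(1) h[OF \<alpha>(2)]] by (simp add: hom_group_def U V \<alpha>(1))
    ultimately show "\<exists>y\<in>carrier (hom_group A U V). y \<otimes>\<^bsub>hom_group A U V\<^esub> x = \<one>\<^bsub>hom_group A U V\<^esub>"
      by blast
  qed
next
  fix U V W u v w assume "u \<in> Hom A U V" "v \<in> Hom A V W" "w \<in> Hom A V W"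
  then show "Comp A (Add A v w) u = Add A (Comp A v u) (Comp A w u)"
    by (cases U; cases V; cases W) (auto simp: hom_ext arr_ext comp_add_left)
next
  fix U V W u v w assume "u \<in> Hom A U V" "v \<in> Hom A U V" "w \<in> Hom A V W"
  then show "Comp A w (Add A u v) = Add A (Comp A w u) (Comp A w v)"
    by (cases U; cases V; cases W) (auto simp: hom_ext arr_ext comp_add_right)
qed

section \<open>Kernels, cokernels and biproducts, computed in the base category\<close>

lemma mono_ext:
  assumes "u = ((X, f), \<alpha>, (Y, g))" "u \<in> Arr A" "is_mono B \<alpha>"
  shows "is_mono A u"
  unfolding is_mono_def
proof (intro conjI allI ballI impI)
  show "u \<in> Arr A" by fact
  fix W v w assume "v \<in> Hom A W (Dom A u)" "w \<in> Hom A W (Dom A u)" "Comp A u v = Comp A u w"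
  then show "v = w"
    using assms mono_cancel[OF assms(3)] by (cases W) (auto simp: hom_ext arr_ext Hom_iff)
qed

lemma epi_ext:
  assumes "u = ((X, f), \<alpha>, (Y, g))" "u \<in> Arr A" "is_epi B \<alpha>"
  shows "is_epi A u"
  unfolding is_epi_def
proof (intro conjI allI ballI impI)
  show "u \<in> Arr A" by fact
  fix W v w assume "v \<in> Hom A (Cod A u) W" "w \<in> Hom A (Cod A u) W" "Comp A v u = Comp A w u"
  then show "v = w"
    using assms epi_cancel[OF assms(3)] by (cases W) (auto simp: hom_ext arr_ext Hom_iff)
qed

text \<open>The arrow \<open>y\<close> supplied by the universal property in \<open>B\<close> has to
  respect the structure maps; this is checked after composing with the mono
  \<open>\<alpha>\<close>.\<close>

lemma kernel_ext:
  assumes u: "((X, f), \<alpha>, (Y, g)) \<in> Arr A" and v: "((Y, g), \<beta>, (Z, h)) \<in> Arr A"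
    and k: "is_kernel B \<alpha> \<beta>"
  shows "is_kernel A ((X, f), \<alpha>, (Y, g)) ((Y, g), \<beta>, (Z, h))"
proof -
  interpret E: preadditive_category A by (rule preadditive_ext)
  have t: "f \<in> Hom B (OMap F X) X" "g \<in> Hom B (OMap F Y) Y" "h \<in> Hom B (OMap F Z) Z"
    "\<alpha> \<in> Hom B X Y" "\<beta> \<in> Hom B Y Z" "\<alpha> \<cdot> f = g \<cdot> AMap F \<alpha>" "\<beta> \<cdot> g = h \<cdot> AMap F \<beta>"
    using u v by (auto simp: arr_ext obj_ext)
  note T = t(1-5)[unfolded Hom_iff]
  have kD: "\<beta> \<cdot> \<alpha> = Zero B X Z" "is_mono B \<alpha>" using kernelD(3,4)[OF k] T by simp_all
  show ?thesis
  proof (rule E.kernelI)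
    show "((X, f), \<alpha>, (Y, g)) \<in> Hom A (X, f) (Y, g)" "((Y, g), \<beta>, (Z, h)) \<in> Hom A (Y, g) (Z, h)"
      using u v by (simp_all add: hom_ext)
    show "Comp A ((Y, g), \<beta>, Z, h) ((X, f), \<alpha>, Y, g) = Zero A (X, f) (Z, h)" using kD by simp
    show "is_mono A ((X, f), \<alpha>, Y, g)" by (rule mono_ext[OF refl u kD(2)])
    fix W w assume w: "w \<in> Hom A W (Y, g)" "Comp A ((Y, g), \<beta>, Z, h) w = Zero A W (Z, h)"
    obtain V p where W: "W = (V, p)" by (cases W)
    obtain x where x: "w = ((V, p), x, (Y, g))" "((V, p), x, (Y, g)) \<in> Arr A" using w by (auto simp: W hom_ext)
    have x0: "\<beta> \<cdot> x = Zero B V Z" using w(2) by (simp add: W x)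
    have xt: "x \<in> Hom B V Y" "x \<cdot> p = g \<cdot> AMap F x" "p \<in> Hom B (OMap F V) V" "(V, p) \<in> Obj A"
      using x(2) by (auto simp: arr_ext obj_ext)
    have "\<exists>y \<in> Hom B V X. \<alpha> \<cdot> y = x"
      by (rule kernel_lift[OF k]) (use x0 xt T in \<open>simp_all add: Hom_iff\<close>)
    then obtain y where y: "y \<in> Hom B V X" "\<alpha> \<cdot> y = x" by blast
    note yt = y(1)[unfolded Hom_iff] xt(1)[unfolded Hom_iff] xt(3)[unfolded Hom_iff]
    have "\<alpha> \<cdot> (y \<cdot> p) = x \<cdot> p" using yt T assoc[of p y \<alpha>] y(2) by simp
    also have "\<dots> = g \<cdot> (AMap F \<alpha> \<cdot> AMap F y)" using xt(2) F_comp_hom[OF y(1) t(4)] y(2) by simp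
    also have "\<dots> = (g \<cdot> AMap F \<alpha>) \<cdot> AMap F y" using yt T by (simp add: assoc)
    also have "\<dots> = \<alpha> \<cdot> (f \<cdot> AMap F y)" unfolding t(6)[symmetric] using yt T by (simp add: assoc)
    finally have "y \<cdot> p = f \<cdot> AMap F y"
      using mono_cancel[OF kD(2), of "y \<cdot> p" "OMap F V" "f \<cdot> AMap F y"] yt T by (simp add: Hom_iff)
    then have "((V, p), y, (X, f)) \<in> Arr A" using xt y u by (simp add: arr_ext)
    then show "\<exists>z\<in>Hom A W (X, f). Comp A ((X, f), \<alpha>, Y, g) z = w"
      using y(2) by (intro bexI[of _ "((V, p), y, (X, f))"]) (simp_all add: W x hom_ext)
  qed
qed

text \<open>Dually, compatibility of \<open>y\<close> is checked after composing with
  \<open>AMap F \<beta>\<close>, which is cancellable because F preserves epis.\<close>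

lemma cokernel_ext:
  assumes u: "((X, f), \<alpha>, (Y, g)) \<in> Arr A" and v: "((Y, g), \<beta>, (Z, h)) \<in> Arr A"
    and k: "is_cokernel B \<beta> \<alpha>"
  shows "is_cokernel A ((Y, g), \<beta>, (Z, h)) ((X, f), \<alpha>, (Y, g))"
proof -
  interpret E: preadditive_category A by (rule preadditive_ext)
  have t: "f \<in> Hom B (OMap F X) X" "g \<in> Hom B (OMap F Y) Y" "h \<in> Hom B (OMap F Z) Z"
    "\<alpha> \<in> Hom B X Y" "\<beta> \<in> Hom B Y Z" "\<alpha> \<cdot> f = g \<cdot> AMap F \<alpha>" "\<beta> \<cdot> g = h \<cdot> AMap F \<beta>"
    using u v by (auto simp: arr_ext obj_ext)
  note T = t(1-5)[unfolded Hom_iff]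
  have kD: "\<beta> \<cdot> \<alpha> = Zero B X Z" "is_epi B \<beta>" using cokernelD(3,4)[OF k] T by simp_all
  show ?thesis
  proof (rule E.cokernelI)
    show "((X, f), \<alpha>, (Y, g)) \<in> Hom A (X, f) (Y, g)" "((Y, g), \<beta>, (Z, h)) \<in> Hom A (Y, g) (Z, h)"
      using u v by (simp_all add: hom_ext)
    show "Comp A ((Y, g), \<beta>, Z, h) ((X, f), \<alpha>, Y, g) = Zero A (X, f) (Z, h)" using kD by simp
    show "is_epi A ((Y, g), \<beta>, Z, h)" by (rule epi_ext[OF refl v kD(2)])
    fix W w assume w: "w \<in> Hom A (Y, g) W" "Comp A w ((X, f), \<alpha>, Y, g) = Zero A (X, f) W"
    obtain V p where W: "W = (V, p)" by (cases W)
    obtain x where x: "w = ((Y, g), x, (V, p))" "((Y, g), x, (V, p)) \<in> Arr A" using w by (auto simp: W hom_ext)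
    have x0: "x \<cdot> \<alpha> = Zero B X V" using w(2) by (simp add: W x)
    have xt: "x \<in> Hom B Y V" "x \<cdot> g = p \<cdot> AMap F x" "p \<in> Hom B (OMap F V) V" "(V, p) \<in> Obj A"
      using x(2) by (auto simp: arr_ext obj_ext)
    have "\<exists>y \<in> Hom B Z V. y \<cdot> \<beta> = x"
      by (rule cokernel_desc[OF k]) (use x0 xt T in \<open>simp_all add: Hom_iff\<close>)
    then obtain y where y: "y \<in> Hom B Z V" "y \<cdot> \<beta> = x" by blast
    note yt = y(1)[unfolded Hom_iff] xt(1)[unfolded Hom_iff] xt(3)[unfolded Hom_iff]
    have "(p \<cdot> AMap F y) \<cdot> AMap F \<beta> = p \<cdot> AMap F x"
      using yt T F_comp_hom[OF t(5) y(1)] y(2) by (simp add: assoc)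
    also have "\<dots> = (y \<cdot> \<beta>) \<cdot> g" using xt(2) y(2) by simp
    also have "\<dots> = y \<cdot> (h \<cdot> AMap F \<beta>)" using yt T t(7) by (simp add: assoc)
    also have "\<dots> = (y \<cdot> h) \<cdot> AMap F \<beta>" using yt T by (simp add: assoc)
    finally have "y \<cdot> h = p \<cdot> AMap F y"
      using epi_cancel[OF F_epi[OF kD(2)], of "y \<cdot> h" V "p \<cdot> AMap F y"] yt T by (simp add: Hom_iff)
    then have "((Z, h), y, (V, p)) \<in> Arr A" using xt y v by (simp add: arr_ext)
    then show "\<exists>z\<in>Hom A (Z, h) W. Comp A z ((Y, g), \<beta>, Z, h) = w"
      using y(2) by (intro bexI[of _ "((Z, h), y, (V, p))"]) (simp_all add: W x hom_ext)
  qed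
qed

text \<open>The structure map of the kernel is the restriction of \<open>f\<close>. Its law is
  checked after the mono \<open>k\<close>, where naturality of \<open>\<eta>\<close> reduces it to
  the law of \<open>f\<close>.\<close>

lemma kernel_obj_ext:
  assumes u: "((X, f), \<alpha>, (Y, g)) \<in> Arr A" and k: "is_kernel B k \<alpha>"
  shows "\<exists>p. ((Dom B k, p), k, (X, f)) \<in> Arr A"
proof -
  define K where "K = Dom B k"
  have t: "f \<in> Hom B (OMap F X) X" "g \<in> Hom B (OMap F Y) Y" "\<alpha> \<in> Hom B X Y"
    "f \<cdot> AMap F f = f \<cdot> \<eta> X" "\<alpha> \<cdot> f = g \<cdot> AMap F \<alpha>"
    using u by (auto simp: arr_ext obj_ext)
  have kD: "k \<in> Hom B K X" "\<alpha> \<cdot> k = Zero B K Y" "is_mono B k"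
    using kernelD(1-4)[OF k] t by (simp_all add: Hom_iff K_def)
  note T = t(1-3)[unfolded Hom_iff] kD(1)[unfolded Hom_iff]
  have obj: "K \<in> Obj B" "X \<in> Obj B" "Y \<in> Obj B" using kD t Hom_obj by blast+
  have "\<alpha> \<cdot> (f \<cdot> AMap F k) = g \<cdot> AMap F (\<alpha> \<cdot> k)"
    using T assoc_eq[OF t(5), of "AMap F k"] by (simp add: assoc)
  also have "\<dots> = Zero B (OMap F K) Y" using kD(2) T obj by simp
  finally have fk: "\<alpha> \<cdot> (f \<cdot> AMap F k) = Zero B (OMap F K) Y" .
  have "\<exists>p \<in> Hom B (OMap F K) K. k \<cdot> p = f \<cdot> AMap F k"
    by (rule kernel_lift[OF k]) (use fk T in \<open>simp_all add: Hom_iff\<close>)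
  then obtain p where p: "p \<in> Hom B (OMap F K) K" "k \<cdot> p = f \<cdot> AMap F k" by blast
  note pt = p(1)[unfolded Hom_iff]
  have Fkp: "AMap F k \<cdot> AMap F p = AMap F f \<cdot> AMap F (AMap F k)"
    using F_comp_hom[OF p(1) kD(1)] F_comp_hom[OF F_hom[OF kD(1)] t(1)] p(2) by simp
  have "k \<cdot> (p \<cdot> AMap F p) = f \<cdot> (AMap F k \<cdot> AMap F p)"
    using assoc_eq[OF p(2), of "AMap F p"] T pt by (simp add: assoc)
  also have "\<dots> = (f \<cdot> \<eta> X) \<cdot> AMap F (AMap F k)"
    unfolding Fkp t(4)[symmetric] using T by (simp add: assoc)
  also have "\<dots> = f \<cdot> (AMap F k \<cdot> \<eta> K)" using eta_nat[OF kD(1)] T obj by (simp add: assoc)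
  also have "\<dots> = k \<cdot> (p \<cdot> \<eta> K)" using assoc_eq[OF p(2), of "\<eta> K"] T pt obj by (simp add: assoc)
  finally have "p \<cdot> AMap F p = p \<cdot> \<eta> K"
    using mono_cancel[OF kD(3), of "p \<cdot> AMap F p" "OMap F (OMap F K)" "p \<cdot> \<eta> K"] T pt obj by (simp add: Hom_iff)
  then have "((K, p), k, (X, f)) \<in> Arr A" using p kD u obj by (simp add: arr_ext obj_ext)
  then show ?thesis unfolding K_def by blast
qed

text \<open>The structure map exists because F(c) still has the factorization property of a cokernel
  of F(\<alpha>). Its law is checked in front of the epi F(F(c)), again by naturality of
  \<open>\<eta>\<close>.\<close>

lemma cokernel_obj_ext:
  assumes u: "((X, f), \<alpha>, (Y, g)) \<in> Arr A" and c: "is_cokernel B c \<alpha>"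
  shows "\<exists>p. ((Y, g), c, (Cod B c, p)) \<in> Arr A"
proof -
  define K where "K = Cod B c"
  have t: "f \<in> Hom B (OMap F X) X" "g \<in> Hom B (OMap F Y) Y" "\<alpha> \<in> Hom B X Y"
    "g \<cdot> AMap F g = g \<cdot> \<eta> Y" "\<alpha> \<cdot> f = g \<cdot> AMap F \<alpha>"
    using u by (auto simp: arr_ext obj_ext)
  have cD: "c \<in> Hom B Y K" "c \<cdot> \<alpha> = Zero B X K" "is_epi B c"
    using cokernelD(1-4)[OF c] t by (simp_all add: Hom_iff K_def)
  note T = t(1-3)[unfolded Hom_iff] cD(1)[unfolded Hom_iff]
  have obj: "K \<in> Obj B" "X \<in> Obj B" "Y \<in> Obj B" using cD t Hom_obj by blast+
  have cg: "c \<cdot> g \<in> Hom B (OMap F Y) K" using comp_hom t cD by blast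
  have "(c \<cdot> g) \<cdot> AMap F \<alpha> = (c \<cdot> \<alpha>) \<cdot> f" using T t(5) by (simp add: assoc)
  also have "\<dots> = Zero B (OMap F X) K" using cD(2) T obj by simp
  finally have z: "(c \<cdot> g) \<cdot> AMap F \<alpha> = Zero B (OMap F X) K" .
  obtain p where p: "p \<in> Hom B (OMap F K) K" "p \<cdot> AMap F c = c \<cdot> g"
    using F_cokernel_desc[OF c t(3) cg z] unfolding K_def by blast
  note pt = p(1)[unfolded Hom_iff]
  have Fp: "AMap F p \<cdot> AMap F (AMap F c) = AMap F c \<cdot> AMap F g"
    using F_comp_hom[OF F_hom[OF cD(1)] p(1)] F_comp_hom[OF t(2) cD(1)] p(2) by simp
  have "(p \<cdot> AMap F p) \<cdot> AMap F (AMap F c) = p \<cdot> (AMap F c \<cdot> AMap F g)" unfolding Fp[symmetric]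
    using T pt by (simp add: assoc)
  also have "\<dots> = c \<cdot> (g \<cdot> \<eta> Y)" using assoc_eq[OF p(2), of "AMap F g"] t(4) T pt by (simp add: assoc)
  also have "\<dots> = p \<cdot> (AMap F c \<cdot> \<eta> Y)" using assoc_eq[OF p(2), of "\<eta> Y"] T pt obj by (simp add: assoc)
  also have "\<dots> = (p \<cdot> \<eta> K) \<cdot> AMap F (AMap F c)" using eta_nat[OF cD(1)] T pt obj by (simp add: assoc)
  finally have "p \<cdot> AMap F p = p \<cdot> \<eta> K"
    using epi_cancel[OF F_epi[OF F_epi[OF cD(3)]], of "p \<cdot> AMap F p" K "p \<cdot> \<eta> K"] T pt obj by (simp add: Hom_iff)
  then have "((Y, g), c, (K, p)) \<in> Arr A" using p cD u obj by (simp add: arr_ext obj_ext)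
  then show ?thesis unfolding K_def by blast
qed

text \<open>A test arrow in \<open>B\<close> starts at an object without structure map, so it cannot
  be tested in \<open>A\<close> directly. The kernel of \<open>\<alpha>\<close> does carry one;
  monicity in \<open>A\<close> makes it zero, and every test arrow killed by \<open>\<alpha>\<close>
  factors through it.\<close>

lemma mono_extD:
  assumes u: "((X, f), \<alpha>, (Y, g)) \<in> Arr A" and m: "is_mono A ((X, f), \<alpha>, (Y, g))"
  shows "is_mono B \<alpha>"
proof -
  interpret E: preadditive_category A by (rule preadditive_ext)
  have a: "\<alpha> \<in> Hom B X Y" using u by (simp add: arr_ext)
  obtain k where k: "is_kernel B k \<alpha>" using ex_kernel a by (auto simp: Hom_iff)
  obtain p where p: "((Dom B k, p), k, (X, f)) \<in> Arr A" using kernel_obj_ext[OF u k] by blast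
  have kD: "k \<in> Hom B (Dom B k) X" "\<alpha> \<cdot> k = Zero B (Dom B k) Y" using kernelD(1-3)[OF k] a by (simp_all add: Hom_iff)
  have "((Dom B k, p), k, (X, f)) = Zero A (Dom B k, p) (X, f)"
    by (rule E.mono_zero[OF m, of _ "(Y, g)"]) (use u p kD in \<open>simp_all add: hom_ext\<close>)
  then have k0: "k = Zero B (Dom B k) X" by simp
  show ?thesis
  proof (rule monoI_zero[OF a])
    fix W x assume x: "x \<in> Hom B W X" "\<alpha> \<cdot> x = Zero B W Y"
    have "\<exists>v \<in> Hom B W (Dom B k). k \<cdot> v = x"
      by (rule kernel_lift[OF k]) (use x a in \<open>simp_all add: Hom_iff\<close>)
    then obtain v where v: "v \<in> Hom B W (Dom B k)" "k \<cdot> v = x" by blast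
    have "Zero B (Dom B k) X \<cdot> v = Zero B W X" using zero_comp_hom v(1) Hom_obj[OF a] by blast
    then show "x = Zero B W X" using v(2) k0 by metis
  qed
qed

lemma epi_extD:
  assumes u: "((X, f), \<alpha>, (Y, g)) \<in> Arr A" and m: "is_epi A ((X, f), \<alpha>, (Y, g))"
  shows "is_epi B \<alpha>"
proof -
  interpret E: preadditive_category A by (rule preadditive_ext)
  have a: "\<alpha> \<in> Hom B X Y" using u by (simp add: arr_ext)
  obtain c where c: "is_cokernel B c \<alpha>" using ex_cokernel a by (auto simp: Hom_iff)
  obtain p where p: "((Y, g), c, (Cod B c, p)) \<in> Arr A" using cokernel_obj_ext[OF u c] by blast
  have cD: "c \<in> Hom B Y (Cod B c)" "c \<cdot> \<alpha> = Zero B X (Cod B c)" using cokernelD(1-3)[OF c] a by (simp_all add: Hom_iff)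
  have "((Y, g), c, (Cod B c, p)) = Zero A (Y, g) (Cod B c, p)"
    by (rule E.epi_zero[OF m, of "(X, f)"]) (use u p cD in \<open>simp_all add: hom_ext\<close>)
  then have c0: "c = Zero B Y (Cod B c)" by simp
  show ?thesis
  proof (rule epiI_zero[OF a])
    fix W x assume x: "x \<in> Hom B Y W" "x \<cdot> \<alpha> = Zero B X W"
    have "\<exists>v \<in> Hom B (Cod B c) W. v \<cdot> c = x"
      by (rule cokernel_desc[OF c]) (use x a in \<open>simp_all add: Hom_iff\<close>)
    then obtain v where v: "v \<in> Hom B (Cod B c) W" "v \<cdot> c = x" by blast
    have "v \<cdot> Zero B Y (Cod B c) = Zero B Y W" using comp_zero_hom v(1) Hom_obj[OF a] by blast
    then show "x = Zero B Y W" using v(2) c0 by metis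
  qed
qed

lemma zero_obj_ext: "X \<in> Obj B \<Longrightarrow> (X, Zero B (OMap F X) X) \<in> Obj A"
  by (simp add: obj_ext Hom_iff)

lemma biproduct_ext:
  assumes U: "(X, f) \<in> Obj A" and V: "(Y, g) \<in> Obj A"
  shows "\<exists>S. is_biproduct A (X, f) (Y, g) S"
proof -
  have t: "f \<in> Hom B (OMap F X) X" "g \<in> Hom B (OMap F Y) Y"
    "f \<cdot> AMap F f = f \<cdot> \<eta> X" "g \<cdot> AMap F g = g \<cdot> \<eta> Y" and obj: "X \<in> Obj B" "Y \<in> Obj B"
    using U V by (auto simp: obj_ext)
  obtain S where "is_biproduct B X Y S" using ex_biproduct obj by blast
  then obtain i1 i2 p1 p2 where S: "S \<in> Obj B" and i1: "i1 \<in> Hom B X S" and i2: "i2 \<in> Hom B Y S"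
    and p1: "p1 \<in> Hom B S X" and p2: "p2 \<in> Hom B S Y"
    and e: "p1 \<cdot> i1 = Ident B X" "p2 \<cdot> i2 = Ident B Y" "p2 \<cdot> i1 = Zero B X Y" "p1 \<cdot> i2 = Zero B Y X"
    "(i1 \<cdot> p1) \<boxplus> (i2 \<cdot> p2) = Ident B S"
    unfolding is_biproduct_def by blast
  note T = t(1,2)[unfolded Hom_iff] i1[unfolded Hom_iff] i2[unfolded Hom_iff] p1[unfolded Hom_iff] p2[unfolded Hom_iff]
  have Fe: "AMap F p1 \<cdot> AMap F i1 = Ident B (OMap F X)" "AMap F p2 \<cdot> AMap F i2 = Ident B (OMap F Y)"
    "AMap F p2 \<cdot> AMap F i1 = Zero B (OMap F X) (OMap F Y)" "AMap F p1 \<cdot> AMap F i2 = Zero B (OMap F Y) (OMap F X)"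
    using F_comp_hom[OF i1 p1] F_comp_hom[OF i2 p2] F_comp_hom[OF i1 p2] F_comp_hom[OF i2 p1] e obj by simp_all
  \<comment> \<open>The direct sum of the structure maps \<open>f\<close> and \<open>g\<close> in
    coordinates. The equations \<open>ps\<close> and \<open>si\<close> say that projections and
    injections become morphisms; the law of \<open>s\<close> is verified componentwise.\<close>
  define s where "s = i1 \<cdot> (f \<cdot> AMap F p1) \<boxplus> i2 \<cdot> (g \<cdot> AMap F p2)"
  have s: "s \<in> Hom B (OMap F S) S" using T by (simp add: s_def Hom_iff)
  note st = s[unfolded Hom_iff]
  have h1: "f \<cdot> AMap F p1 \<in> Hom B (OMap F S) X" "g \<cdot> AMap F p2 \<in> Hom B (OMap F S) Y"
    using T by (simp_all add: Hom_iff)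
  have h2: "i1 \<cdot> f \<in> Hom B (OMap F X) S" "i2 \<cdot> g \<in> Hom B (OMap F Y) S"
    using T by (simp_all add: Hom_iff)
  have ps: "p1 \<cdot> s = f \<cdot> AMap F p1" "p2 \<cdot> s = g \<cdot> AMap F p2"
    using T obj S add_zero[OF h1(1)] zero_add[OF h1(2)]
    by (simp_all add: s_def comp_distrib assoc_eq[OF e(1)] assoc_eq[OF e(2)] assoc_eq[OF e(3)] assoc_eq[OF e(4)])
  have si: "s \<cdot> AMap F i1 = i1 \<cdot> f" "s \<cdot> AMap F i2 = i2 \<cdot> g"
    using T obj S add_zero[OF h2(1)] zero_add[OF h2(2)] by (simp_all add: s_def comp_distrib assoc Fe)
  have Fps: "AMap F p1 \<cdot> AMap F s = AMap F f \<cdot> AMap F (AMap F p1)" "AMap F p2 \<cdot> AMap F s = AMap F g \<cdot> AMap F (AMap F p2)"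
    using F_comp_hom[OF s p1] F_comp_hom[OF s p2] F_comp_hom[OF F_hom[OF p1] t(1)] F_comp_hom[OF F_hom[OF p2] t(2)] ps by simp_all
  have "f \<cdot> (AMap F p1 \<cdot> AMap F s) = f \<cdot> (AMap F p1 \<cdot> \<eta> S)"
    unfolding Fps eta_nat[OF p1, symmetric] using T obj by (simp add: assoc_eq[OF t(3)] assoc)
  moreover have "g \<cdot> (AMap F p2 \<cdot> AMap F s) = g \<cdot> (AMap F p2 \<cdot> \<eta> S)"
    unfolding Fps eta_nat[OF p2, symmetric] using T obj by (simp add: assoc_eq[OF t(4)] assoc)
  moreover have "s \<cdot> x = i1 \<cdot> (f \<cdot> (AMap F p1 \<cdot> x)) \<boxplus> i2 \<cdot> (g \<cdot> (AMap F p2 \<cdot> x))"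
    if "x \<in> Arr B" "Cod B x = OMap F S" for x
    unfolding s_def using T that by (simp add: comp_distrib assoc)
  ultimately have "s \<cdot> AMap F s = s \<cdot> \<eta> S" using st S by simp
  then have So: "(S, s) \<in> Obj A" using S s by (simp add: obj_ext)
  have arrs: "((X, f), i1, (S, s)) \<in> Arr A" "((Y, g), i2, (S, s)) \<in> Arr A"
    "((S, s), p1, (X, f)) \<in> Arr A" "((S, s), p2, (Y, g)) \<in> Arr A"
    using U V So i1 i2 p1 p2 ps si by (simp_all add: arr_ext)
  have "is_biproduct A (X, f) (Y, g) (S, s)"
    unfolding is_biproduct_def
    by (intro conjI U V So bexI[of _ "((X, f), i1, (S, s))"] bexI[of _ "((Y, g), i2, (S, s))"]
        bexI[of _ "((S, s), p1, (X, f))"] bexI[of _ "((S, s), p2, (Y, g))"])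
      (use arrs e in \<open>simp_all add: hom_ext\<close>)
  then show ?thesis by blast
qed

text \<open>For normality, a mono of \<open>A\<close> is a mono of \<open>B\<close>, hence there the
  kernel of its cokernel; the cokernel acquires a structure map and the kernel property lifts. Epis
  are treated dually.\<close>

lemma abelian_ext: "abelian_category A"
proof (intro abelian_category.intro abelian_category_axioms.intro)
  show "preadditive_category A" by (rule preadditive_ext)
next
  obtain Z where Z: "is_zero B Z" using ex_zero by blast
  then have ZO: "Z \<in> Obj B" by (simp add: is_zero_def)
  have ZA: "(Z, Zero B (OMap F Z) Z) \<in> Obj A" by (rule zero_obj_ext[OF ZO])
  have "is_zero A (Z, Zero B (OMap F Z) Z)"
    unfolding is_zero_def
  proof (intro conjI ballI ZA)
    fix U assume U: "U \<in> Obj A"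
    obtain X f where Xf: "U = (X, f)" by (cases U)
    have X: "X \<in> Obj B" using U by (simp add: Xf obj_ext)
    have "\<exists>!f. f \<in> Hom B Z X" "\<exists>!f. f \<in> Hom B X Z" using Z X by (auto simp: is_zero_def)
    then have un: "\<And>a b. a \<in> Hom B Z X \<Longrightarrow> b \<in> Hom B Z X \<Longrightarrow> a = b" "\<And>a b. a \<in> Hom B X Z \<Longrightarrow> b \<in> Hom B X Z \<Longrightarrow> a = b"
      by blast+
    show "\<exists>!u. u \<in> Hom A (Z, Zero B (OMap F Z) Z) U"
      unfolding Xf hom_ext using ext_zeroI[OF ZA U[unfolded Xf]] un by (auto simp: arr_ext)
    show "\<exists>!u. u \<in> Hom A U (Z, Zero B (OMap F Z) Z)"
      unfolding Xf hom_ext using ext_zeroI[OF U[unfolded Xf] ZA] un by (auto simp: arr_ext)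
  qed
  then show "\<exists>Z. is_zero A Z" by blast
next
  fix U V assume "U \<in> Obj A" "V \<in> Obj A"
  then show "\<exists>S. is_biproduct A U V S" using biproduct_ext by (cases U; cases V) blast
next
  fix u assume "u \<in> Arr A"
  then obtain X f \<alpha> Y g where u: "u = ((X, f), \<alpha>, (Y, g))" "((X, f), \<alpha>, (Y, g)) \<in> Arr A" by (rule arr_ext_cases)
  have a: "\<alpha> \<in> Arr B" using u by (simp add: arr_ext Hom_iff)
  obtain k where k: "is_kernel B k \<alpha>" using ex_kernel a by blast
  obtain p where p: "((Dom B k, p), k, (X, f)) \<in> Arr A" using kernel_obj_ext[OF u(2) k] by blast
  show "\<exists>k. is_kernel A k u" using kernel_ext[OF p u(2) k] u(1) by blast
  obtain c where c: "is_cokernel B c \<alpha>" using ex_cokernel a by blast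
  obtain q where q: "((Y, g), c, (Cod B c, q)) \<in> Arr A" using cokernel_obj_ext[OF u(2) c] by blast
  show "\<exists>c. is_cokernel A c u" using cokernel_ext[OF u(2) q c] u(1) by blast
next
  fix u assume m: "is_mono A u"
  then have "u \<in> Arr A" by (simp add: is_mono_def)
  then obtain X f \<alpha> Y g where u: "u = ((X, f), \<alpha>, (Y, g))" "((X, f), \<alpha>, (Y, g)) \<in> Arr A" by (rule arr_ext_cases)
  have a: "\<alpha> \<in> Arr B" using u by (simp add: arr_ext Hom_iff)
  have mB: "is_mono B \<alpha>" using mono_extD[OF u(2)] m u(1) by simp
  obtain c where c: "is_cokernel B c \<alpha>" using ex_cokernel a by blast
  obtain q where q: "((Y, g), c, (Cod B c, q)) \<in> Arr A" using cokernel_obj_ext[OF u(2) c] by blast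
  show "\<exists>g. is_kernel A u g" using kernel_ext[OF u(2) q kernel_of_cokernel[OF mB c]] u(1) by blast
next
  fix u assume m: "is_epi A u"
  then have "u \<in> Arr A" by (simp add: is_epi_def)
  then obtain X f \<alpha> Y g where u: "u = ((X, f), \<alpha>, (Y, g))" "((X, f), \<alpha>, (Y, g)) \<in> Arr A" by (rule arr_ext_cases)
  have a: "\<alpha> \<in> Arr B" using u by (simp add: arr_ext Hom_iff)
  have mB: "is_epi B \<alpha>" using epi_extD[OF u(2)] m u(1) by simp
  obtain k where k: "is_kernel B k \<alpha>" using ex_kernel a by blast
  obtain p where p: "((Dom B k, p), k, (X, f)) \<in> Arr A" using kernel_obj_ext[OF u(2) k] by blast
  show "\<exists>g. is_cokernel A u g" using cokernel_ext[OF p u(2) cokernel_of_kernel[OF mB k]] u(1) by blast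
qed

text \<open>With \<open>p = q \<cdot> AMap F i\<close> one has
  \<open>i \<cdot> p = f \<cdot> AMap F i\<close>. So \<open>i\<close> is a morphism, and its being
  mono carries the law of \<open>f\<close> over to \<open>p\<close>. The quotient takes the zero
  structure map because its projection kills the image of \<open>f\<close>.\<close>

lemma ses_image_object:
  assumes U: "(X, f) \<in> Obj A"
  shows "image_object B F (X, f) \<in> Obj A"
    and "\<exists>C u v. C \<in> Obj B \<and> ses A (image_object B F (X, f)) (X, f) (OMap (Z_functor B F) C) u v"
proof -
  interpret E: abelian_category A by (rule abelian_ext)
  have t: "f \<in> Hom B (OMap F X) X" "f \<cdot> AMap F f = f \<cdot> \<eta> X" and X: "X \<in> Obj B"
    using U by (auto simp: obj_ext)
  \<comment> \<open>The factorization must be the very one selected inside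
    \<open>image_object\<close>.\<close>
  let ?P = "\<lambda>(i, q). is_image_fact B f i q"
  have "\<exists>x. ?P x" using ex_image_fact[of f] t by (auto simp: Hom_iff)
  then have "?P (SOME x. ?P x)" by (rule someI_ex)
  then obtain i q where iq: "(SOME x. ?P x) = (i, q)" and im: "is_image_fact B f i q" by (metis (no_types, lifting) case_prodE)
  define I where "I = Dom B i"
  have io: "image_object B F (X, f) = (I, q \<cdot> AMap F i)" by (simp add: image_object_def iq I_def)
  have i: "i \<in> Hom B I X" "q \<in> Hom B (OMap F X) I" "i \<cdot> q = f" "is_mono B i" "is_epi B q"
    using image_fact_arr[OF im] t by (simp_all add: Hom_iff I_def)
  note T = t(1)[unfolded Hom_iff] i(1,2)[unfolded Hom_iff]
  have I: "I \<in> Obj B" using i Hom_obj by blast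
  obtain c where c: "is_cokernel B c i" using ex_cokernel T by blast
  define K where "K = Cod B c"
  have cD: "c \<in> Hom B X K" "c \<cdot> i = Zero B I K" using cokernelD(1-3)[OF c] T by (simp_all add: Hom_iff K_def)
  have K: "K \<in> Obj B" using cD Hom_obj by blast
  define p where "p = q \<cdot> AMap F i"
  have p: "p \<in> Hom B (OMap F I) I" using T by (simp add: p_def Hom_iff)
  note pt = p[unfolded Hom_iff]
  have ip: "i \<cdot> p = f \<cdot> AMap F i" using T by (simp add: p_def assoc_eq[OF i(3)])
  have Fip: "AMap F i \<cdot> AMap F p = AMap F f \<cdot> AMap F (AMap F i)"
    using F_comp_hom[OF p i(1)] F_comp_hom[OF F_hom[OF i(1)] t(1)] ip by simp
  have "i \<cdot> (p \<cdot> AMap F p) = f \<cdot> (AMap F i \<cdot> AMap F p)"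
    using assoc_eq[OF ip, of "AMap F p"] T pt by (simp add: assoc)
  also have "\<dots> = f \<cdot> (\<eta> X \<cdot> AMap F (AMap F i))"
    unfolding Fip using T X by (simp add: assoc_eq[OF t(2)] assoc)
  also have "\<dots> = i \<cdot> (p \<cdot> \<eta> I)"
    unfolding eta_nat[OF i(1)] using assoc_eq[OF ip, of "\<eta> I"] T pt I by (simp add: assoc)
  finally have "p \<cdot> AMap F p = p \<cdot> \<eta> I"
    using mono_cancel[OF i(4), of "p \<cdot> AMap F p" "OMap F (OMap F I)" "p \<cdot> \<eta> I"] T pt I by (simp add: Hom_iff)
  then have Io: "(I, p) \<in> Obj A" using p I by (simp add: obj_ext)
  then show "image_object B F (X, f) \<in> Obj A" by (simp add: io p_def)
  have Ko: "(K, Zero B (OMap F K) K) \<in> Obj A" by (rule zero_obj_ext[OF K])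
  have a1: "((I, p), i, (X, f)) \<in> Arr A" using Io U i ip by (simp add: arr_ext)
  have "c \<cdot> f = (c \<cdot> i) \<cdot> q" using assoc[of q i c] i(3) T cD(1) by (simp add: Hom_iff)
  then have "c \<cdot> f = Zero B (OMap F X) K" using cD(2) T K by simp
  moreover have "Zero B (OMap F K) K \<cdot> AMap F c = Zero B (OMap F X) K" using cD K by (simp add: Hom_iff)
  ultimately have a2: "((X, f), c, (K, Zero B (OMap F K) K)) \<in> Arr A" using U Ko cD by (simp add: arr_ext)
  have "ses A (I, p) (X, f) (K, Zero B (OMap F K) K) ((I, p), i, (X, f)) ((X, f), c, (K, Zero B (OMap F K) K))"
    by (rule E.sesI_cokernel[OF mono_ext[OF refl a1 i(4)] cokernel_ext[OF a1 a2 c]])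
      (use a1 a2 in \<open>simp_all add: hom_ext\<close>)
  then show "\<exists>C u v. C \<in> Obj B \<and> ses A (image_object B F (X, f)) (X, f) (OMap (Z_functor B F) C) u v"
    using K unfolding io p_def Z_functor_def fctr.simps by blast
qed

text \<open>This serves the base of the induction on the nilpotency index. A zero object equals some
  Z(X), not just up to isomorphism, so its approximation is an instance of the hypothesis on
  Z.\<close>

lemma is_zero_ext:
  assumes z: "is_zero A U" and U: "U \<in> Obj A"
  shows "U = OMap (Z_functor B F) (fst U)" "fst U \<in> Obj B"
proof -
  obtain X f where Xf: "U = (X, f)" by (cases U)
  have t: "f \<in> Hom B (OMap F X) X" and X: "X \<in> Obj B" using U by (auto simp: Xf obj_ext)
  have o: "(X, f) \<in> Obj A" using U Xf by simp
  interpret E: category A by (rule category_ext)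
  have "Ident A (X, f) \<in> Hom A (X, f) (X, f)" "Zero A (X, f) (X, f) \<in> Hom A (X, f) (X, f)"
    using E.ident_hom[OF o] ext_zeroI[OF o o] by (simp_all add: hom_ext)
  then have "Ident A (X, f) = Zero A (X, f) (X, f)" using z o unfolding is_zero_def Xf by blast
  then have "Ident B X = Zero B X X" by simp
  then have "f = Zero B X X \<cdot> f" using t comp_ident_left by metis
  then have "f = Zero B (OMap F X) X" using zero_comp_hom[OF t X] by simp
  then show "U = OMap (Z_functor B F) (fst U)" "fst U \<in> Obj B" using X by (simp_all add: Xf Z_functor_def)
qed

end

section \<open>Dimension shifting and approximations\<close>

context abelian_category begin

lemma ses_cokernel_exists:
  assumes m: "is_mono C m" "m \<in> Hom C Y J"
  obtains p Z where "ses C Y J Z m p"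
proof -
  obtain p where p: "is_cokernel C p m" using ex_cokernel mono_arr m(1) by blast
  have "p \<in> Hom C J (Cod C p)" using cokernelD(1)[OF p] m(2) by (simp add: Hom_iff)
  then show ?thesis using that sesI_cokernel[OF m(1) p m(2)] by blast
qed

text \<open>Hom(-, J) is exact: \<open>u\<close> descends to the image of \<open>a\<close> and
  extends from there by injectivity.\<close>

lemma injective_extend_exact:
  assumes ex: "exact C b a" and b: "b \<in> Hom C Q2 Q1" and a: "a \<in> Hom C Q1 Q0"
    and J: "injective C J" and u: "u \<in> Hom C Q1 J" and ub: "u \<cdot> b = Zero C Q2 J"
  shows "\<exists>h \<in> Hom C Q0 J. h \<cdot> a = u"
proof -
  obtain i q where im: "is_image_fact C a i q" using ex_image_fact a by (metis Hom_iff)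
  note D = image_fact_arr[OF im]
  have i: "i \<in> Hom C (Dom C i) Q0" and q: "q \<in> Hom C Q1 (Dom C i)" using D a by (simp_all add: Hom_iff)
  have qc: "is_cokernel C q b" by (rule exact_coimage_cokernel[OF ex im])
  have "\<exists>w \<in> Hom C (Dom C i) J. w \<cdot> q = u"
    by (rule cokernel_desc[OF qc]) (use ub u b q in \<open>simp_all add: Hom_iff\<close>)
  then obtain w where w: "w \<in> Hom C (Dom C i) J" "w \<cdot> q = u" by blast
  obtain h where h: "h \<in> Hom C Q0 J" "h \<cdot> i = w" using injective_extend[OF J D(4) i w(1)] by blast
  have "h \<cdot> (i \<cdot> q) = (h \<cdot> i) \<cdot> q" using h(1) i q by (simp add: assoc Hom_iff)
  then have "h \<cdot> a = u" using D(3) h(2) w(2) by simp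
  then show ?thesis using h by blast
qed

text \<open>The last step of several chases below: h - v dies under \<open>p\<close>, so it is
  \<open>j \<cdot> u\<close>, and subtracting \<open>v\<close> did not change the composite with
  \<open>b\<close>.\<close>

lemma ses_factor_diff:
  assumes s: "ses C Y J Y' j p" and h: "h \<in> Hom C Q J" and v: "v \<in> Hom C Q J" and hv: "p \<cdot> h = p \<cdot> v"
    and b: "b \<in> Hom C Q' Q" and vb: "v \<cdot> b = Zero C Q' J" and f: "f \<in> Hom C Q' Y" and hb: "h \<cdot> b = j \<cdot> f"
  shows "\<exists>u \<in> Hom C Q Y. f = u \<cdot> b"
proof -
  note S = sesD[OF s]
  obtain x where x: "x \<in> Hom C Q J" "h = v \<boxplus> x"
    and x2: "\<And>p V. \<lbrakk>p \<in> Hom C J V; p \<cdot> h = p \<cdot> v\<rbrakk> \<Longrightarrow> p \<cdot> x = Zero C Q V"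
    by (rule diff_ex[OF h v]) (rule that)
  have "p \<cdot> x = Zero C Q Y'" by (rule x2[OF S(2) hv])
  then obtain u where u: "u \<in> Hom C Q Y" "j \<cdot> u = x" using ses_lift[OF s x(1)] by blast
  have ub: "u \<cdot> b \<in> Hom C Q' Y" using comp_hom b u by blast
  have "h \<cdot> b = v \<cdot> b \<boxplus> x \<cdot> b" unfolding x(2) by (rule comp_add_left[OF b v x(1)])
  then have "j \<cdot> f = x \<cdot> b" using vb hb zero_add[OF comp_hom[OF b x(1)]] by simp
  also have "\<dots> = j \<cdot> (u \<cdot> b)" unfolding u(2)[symmetric] by (rule comp_assoc[OF b u(1) S(1)])
  finally have "f = u \<cdot> b"
    using mono_cancel[OF S(3), of f Q' "u \<cdot> b"] f ub S(1) by (simp add: Hom_iff)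
  then show ?thesis using u by blast
qed

text \<open>One resolution of \<open>X\<close> serves all \<open>Y\<close> and all positive degrees,
  so that vanishing for different coefficients can be compared on it.\<close>

lemma Ext_resolution:
  assumes "enough_projectives C" and "X \<in> Obj C"
  obtains P d e where "\<And>i. projective C (P i)" "\<And>i. d i \<in> Hom C (P (Suc i)) (P i)"
    "e \<in> Hom C (P 0) X" "is_epi C e" "exact C (d 0) e" "\<And>i. exact C (d (Suc i)) (d i)"
    "\<And>Y i. Y \<in> Obj C \<Longrightarrow> trivial_group (Ext C (Suc i) X Y) \<longleftrightarrow>
      (\<forall>h \<in> Hom C (P (Suc i)) Y. h \<cdot> d (Suc i) = Zero C (P (Suc (Suc i))) Y \<longrightarrow>
        (\<exists>g \<in> Hom C (P i) Y. h = g \<cdot> d i))"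
proof -
  obtain P d e where ch: "chosen_resolution C X = (P, d, e)" and res: "is_proj_resolution C X P d e"
    using chosen_resolution[OF assms] by blast
  have "trivial_group (Ext C (Suc i) X Y) \<longleftrightarrow>
      (\<forall>h \<in> Hom C (P (Suc i)) Y. h \<cdot> d (Suc i) = Zero C (P (Suc (Suc i))) Y \<longrightarrow>
        (\<exists>g \<in> Hom C (P i) Y. h = g \<cdot> d i))" if "Y \<in> Obj C" for Y i
    unfolding Ext_trivial_iff[OF ch res that] by (auto simp: cocycles_def)
  then show ?thesis using res that[of P d e] by (simp add: is_proj_resolution_def)
qed

lemma Ext1_lift:
  assumes ep: "enough_projectives C" and ext: "trivial_group (Ext C 1 X Y)"
    and s: "ses C Y E V y \<pi>" and t: "t \<in> Hom C X V"
  shows "\<exists>l \<in> Hom C X E. \<pi> \<cdot> l = t"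
proof -
  have XY: "X \<in> Obj C" "Y \<in> Obj C" using t sesD(1)[OF s] Hom_obj by blast+
  obtain P d e where R: "\<And>i. projective C (P i)" "\<And>i. d i \<in> Hom C (P (Suc i)) (P i)"
    "e \<in> Hom C (P 0) X" "is_epi C e" "exact C (d 0) e" "\<And>i. exact C (d (Suc i)) (d i)"
    and E: "\<And>Y i. Y \<in> Obj C \<Longrightarrow> trivial_group (Ext C (Suc i) X Y) \<longleftrightarrow>
      (\<forall>h \<in> Hom C (P (Suc i)) Y. h \<cdot> d (Suc i) = Zero C (P (Suc (Suc i))) Y \<longrightarrow>
        (\<exists>g \<in> Hom C (P i) Y. h = g \<cdot> d i))"
    by (rule Ext_resolution[OF ep XY(1)]) (rule that)
  have X: "Cod C e = X" "Dom C (Ident C X) = X" using R(3) XY by (simp_all add: Hom_iff)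
  have "\<exists>l \<in> Hom C (Dom C (Ident C (Cod C e))) E. \<pi> \<cdot> l = t"
  proof (rule ext_lift[OF R(5) is_image_fact_epi[OF R(4)] R(2) R(2) _ R(1) _ s])
    show "d 0 \<cdot> d (Suc 0) = Zero C (P (Suc (Suc 0))) (P 0)"
      using exactD(3)[OF R(6)[of 0]] R(2)[of 0] R(2)[of "Suc 0"] by (simp add: Hom_iff)
    show "t \<in> Hom C (Dom C (Ident C (Cod C e))) V" using t X by simp
  qed (use ext E[OF XY(2), of 0] in auto)
  then show ?thesis using X by simp
qed

text \<open>The extension pushed out along \<open>g\<close> splits. If \<open>l\<close> is a section
  of \<open>c'\<close>, then 1 - l c' factors through \<open>Y\<close> and gives a retraction
  \<open>r\<close> of \<open>m'\<close>; the extension of \<open>g\<close> is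
  \<open>r \<cdot> g'\<close>.\<close>

lemma Ext1_extend:
  assumes ep: "enough_projectives C" and ext: "trivial_group (Ext C 1 X Y)"
    and s: "ses C N M X m c" and g: "g \<in> Hom C N Y"
  shows "\<exists>h \<in> Hom C M Y. h \<cdot> m = g"
proof -
  obtain E m' g' c' where po: "is_pushout C g m m' g'" and s': "ses C Y E X m' c'" and g': "g' \<in> Hom C M E"
    and e: "m' \<cdot> g = g' \<cdot> m" "c' \<cdot> g' = c" by (rule pushout_ses[OF s g])
  note S = sesD[OF s] and S' = sesD[OF s']
  note T = S(1,2)[unfolded Hom_iff] S'(1,2)[unfolded Hom_iff] g[unfolded Hom_iff] g'[unfolded Hom_iff]
  have obj: "X \<in> Obj C" "Y \<in> Obj C" "E \<in> Obj C" using S' Hom_obj by blast+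
  obtain l where l: "l \<in> Hom C X E" "c' \<cdot> l = Ident C X"
    using Ext1_lift[OF ep ext s' ident_hom[OF obj(1)]] by blast
  note lt = l(1)[unfolded Hom_iff]
  have "\<exists>r \<in> Hom C E Y. Ident C Y = r \<cdot> m'"
  proof (rule ses_factor_diff[OF s' ident_hom[OF obj(3)] comp_hom[OF S'(2) l(1)]])
    show "c' \<cdot> Ident C E = c' \<cdot> (l \<cdot> c')" using assoc_eq[OF l(2), of c'] T lt obj by simp
    show "l \<cdot> c' \<cdot> m' = Zero C Y E" using S'(7) T lt obj by (simp add: assoc)
  qed (use S'(1) T obj ident_hom in simp_all)
  then obtain r where r: "r \<in> Hom C E Y" "r \<cdot> m' = Ident C Y" by metis
  have "r \<cdot> (g' \<cdot> m) = g" unfolding e(1)[symmetric] using assoc_eq[OF r(2), of g] r(1) T by (simp add: Hom_iff)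
  then have "(r \<cdot> g') \<cdot> m = g" using r(1) T by (simp add: assoc Hom_iff)
  then show ?thesis using comp_hom[OF g' r(1)] by blast
qed

text \<open>Chased by hand: exactness of Ext^1(M, Y) -> Ext^1(N, Y) -> Ext^2(X, Y), whose last term
  is replaced by Ext^1(X, Y') for the cosyzygy \<open>Y'\<close> of \<open>Y\<close>.\<close>

lemma Ext1_kernel:
  assumes ep: "enough_projectives C" and s: "ses C N M X m c"
    and sJ: "ses C Y J Y' j p" and J: "injective C J"
    and extM: "trivial_group (Ext C 1 M Y)" and extX: "trivial_group (Ext C 1 X Y')"
  shows "trivial_group (Ext C 1 N Y)"
proof -
  note S = sesD[OF s] and SJ = sesD[OF sJ]
  have obj: "N \<in> Obj C" "Y \<in> Obj C" "J \<in> Obj C" "Y' \<in> Obj C" using S SJ Hom_obj by blast+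
  obtain P d e where R: "\<And>i. projective C (P i)" "\<And>i. d i \<in> Hom C (P (Suc i)) (P i)"
    "e \<in> Hom C (P 0) N" "is_epi C e" "exact C (d 0) e" "\<And>i. exact C (d (Suc i)) (d i)"
    and E: "\<And>Y i. Y \<in> Obj C \<Longrightarrow> trivial_group (Ext C (Suc i) N Y) \<longleftrightarrow>
      (\<forall>h \<in> Hom C (P (Suc i)) Y. h \<cdot> d (Suc i) = Zero C (P (Suc (Suc i))) Y \<longrightarrow>
        (\<exists>g \<in> Hom C (P i) Y. h = g \<cdot> d i))"
    by (rule Ext_resolution[OF ep obj(1)]) (rule that)
  have "\<exists>u \<in> Hom C (P 0) Y. f = u \<cdot> d 0"
    if f: "f \<in> Hom C (P (Suc 0)) Y" "f \<cdot> d (Suc 0) = Zero C (P (Suc (Suc 0))) Y" for f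
  proof -
    note T = S(1,2)[unfolded Hom_iff] SJ(1,2)[unfolded Hom_iff] R(3)[unfolded Hom_iff] f(1)[unfolded Hom_iff]
      R(2)[of 0, unfolded Hom_iff] R(2)[of "Suc 0", unfolded Hom_iff]
    have PO: "\<And>i. P i \<in> Obj C" using R(2) Hom_obj by blast
    have jf: "j \<cdot> f \<in> Hom C (P (Suc 0)) J" using comp_hom f SJ by blast
    have "(j \<cdot> f) \<cdot> d (Suc 0) = Zero C (P (Suc (Suc 0))) J" using f(2) T obj PO by (simp add: assoc)
    then obtain h where h: "h \<in> Hom C (P 0) J" "h \<cdot> d 0 = j \<cdot> f"
      using injective_extend_exact[OF R(6) R(2) R(2) J jf] by blast
    note ht = h(1)[unfolded Hom_iff]
    have ph: "p \<cdot> h \<in> Hom C (P 0) Y'" using comp_hom h SJ by blast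
    have "(p \<cdot> h) \<cdot> d 0 = (p \<cdot> j) \<cdot> f" using h(2) T ht by (simp add: assoc)
    also have "\<dots> = Zero C (P (Suc 0)) Y'" using SJ(7) T obj PO by simp
    finally have phd: "(p \<cdot> h) \<cdot> d 0 = Zero C (P (Suc 0)) Y'" .
    have ec: "is_cokernel C e (d 0)" by (rule exact_coimage_cokernel[OF R(5) is_image_fact_epi[OF R(4)]])
    have "\<exists>g \<in> Hom C N Y'. g \<cdot> e = p \<cdot> h"
      by (rule cokernel_desc[OF ec]) (use phd ph T in \<open>simp_all add: Hom_iff\<close>)
    \<comment> \<open>The class of the cocycle \<open>f\<close> is the image of \<open>g\<close>
      under the connecting map Hom(N, Y') -> Ext^1(N, Y). It vanishes once \<open>g\<close> lifts to
      \<open>J\<close>.\<close>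
    then obtain g where g: "g \<in> Hom C N Y'" "g \<cdot> e = p \<cdot> h" by blast
    obtain g1 where g1: "g1 \<in> Hom C M Y'" "g1 \<cdot> m = g" using Ext1_extend[OF ep extX s g(1)] by blast
    obtain l where l: "l \<in> Hom C M J" "p \<cdot> l = g1" using Ext1_lift[OF ep extM sJ g1(1)] by blast
    note lt = l(1)[unfolded Hom_iff]
    \<comment> \<open>The lift of \<open>g\<close> to \<open>J\<close> is
      \<open>l \<cdot> m\<close>. Its pullback to \<open>P 0\<close> has zero boundary, so
      subtracting it from \<open>h\<close> leaves an arrow into \<open>Y\<close> with boundary
      \<open>f\<close>.\<close>
    have v: "l \<cdot> (m \<cdot> e) \<in> Hom C (P 0) J" using comp_hom l(1) S(1) R(3) by blast
    show ?thesis
    proof (rule ses_factor_diff[OF sJ h(1) v _ R(2) _ f(1) h(2)])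
      have "p \<cdot> (l \<cdot> (m \<cdot> e)) = (g1 \<cdot> m) \<cdot> e" using T lt assoc_eq[OF l(2), of "m \<cdot> e"] g1(1)
        by (simp add: assoc Hom_iff)
      then show "p \<cdot> h = p \<cdot> (l \<cdot> (m \<cdot> e))" using g1(2) g(2) by simp
      have "e \<cdot> d 0 = Zero C (P (Suc 0)) N" using exactD(3)[OF R(5)] T by simp
      then show "l \<cdot> (m \<cdot> e) \<cdot> d 0 = Zero C (P (Suc 0)) J" using T lt PO by (simp add: assoc)
    qed
  qed
  then show ?thesis using E[OF obj(2), of 0] by simp
qed

text \<open>A 2-cocycle becomes a boundary in the injective \<open>J\<close>, which yields a
  1-cocycle \<open>p \<cdot> h\<close> in \<open>Y'\<close>. That one bounds by hypothesis, and
  projectivity of \<open>P 0\<close> lifts its bounding arrow back to \<open>J\<close>.\<close>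

lemma Ext2_shift:
  assumes ep: "enough_projectives C" and N: "N \<in> Obj C"
    and sJ: "ses C Y J Y' j p" and J: "injective C J" and ext: "trivial_group (Ext C 1 N Y')"
  shows "trivial_group (Ext C 2 N Y)"
proof -
  note SJ = sesD[OF sJ]
  have obj: "Y \<in> Obj C" "J \<in> Obj C" "Y' \<in> Obj C" using SJ Hom_obj by blast+
  obtain P d e where R: "\<And>i. projective C (P i)" "\<And>i. d i \<in> Hom C (P (Suc i)) (P i)"
    "e \<in> Hom C (P 0) N" "is_epi C e" "exact C (d 0) e" "\<And>i. exact C (d (Suc i)) (d i)"
    and E: "\<And>Y i. Y \<in> Obj C \<Longrightarrow> trivial_group (Ext C (Suc i) N Y) \<longleftrightarrow>
      (\<forall>h \<in> Hom C (P (Suc i)) Y. h \<cdot> d (Suc i) = Zero C (P (Suc (Suc i))) Y \<longrightarrow>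
        (\<exists>g \<in> Hom C (P i) Y. h = g \<cdot> d i))"
    by (rule Ext_resolution[OF ep N]) (rule that)
  have "\<exists>u \<in> Hom C (P (Suc 0)) Y. f = u \<cdot> d (Suc 0)"
    if f: "f \<in> Hom C (P (Suc (Suc 0))) Y" "f \<cdot> d (Suc (Suc 0)) = Zero C (P (Suc (Suc (Suc 0)))) Y" for f
  proof -
    note T = SJ(1,2)[unfolded Hom_iff] f(1)[unfolded Hom_iff] R(2)[of 0, unfolded Hom_iff]
      R(2)[of "Suc 0", unfolded Hom_iff] R(2)[of "Suc (Suc 0)", unfolded Hom_iff]
    have PO: "\<And>i. P i \<in> Obj C" using R(2) Hom_obj by blast
    have jf: "j \<cdot> f \<in> Hom C (P (Suc (Suc 0))) J" using comp_hom f SJ by blast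
    have "(j \<cdot> f) \<cdot> d (Suc (Suc 0)) = Zero C (P (Suc (Suc (Suc 0)))) J" using f(2) T obj PO by (simp add: assoc)
    then obtain h where h: "h \<in> Hom C (P (Suc 0)) J" "h \<cdot> d (Suc 0) = j \<cdot> f"
      using injective_extend_exact[OF R(6) R(2) R(2) J jf] by blast
    note ht = h(1)[unfolded Hom_iff]
    have ph: "p \<cdot> h \<in> Hom C (P (Suc 0)) Y'" using comp_hom h SJ by blast
    have "(p \<cdot> h) \<cdot> d (Suc 0) = (p \<cdot> j) \<cdot> f" using h(2) T ht by (simp add: assoc)
    also have "\<dots> = Zero C (P (Suc (Suc 0))) Y'" using SJ(7) T obj PO by simp
    finally obtain g where g: "g \<in> Hom C (P 0) Y'" "p \<cdot> h = g \<cdot> d 0"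
      using ext E[OF obj(3), of 0] ph by auto
    obtain l where l: "l \<in> Hom C (P 0) J" "p \<cdot> l = g" using projective_lift[OF R(1) SJ(4,2) g(1)] by blast
    note lt = l(1)[unfolded Hom_iff]
    show ?thesis
    proof (rule ses_factor_diff[OF sJ h(1) comp_hom[OF R(2) l(1)] _ R(2) _ f(1) h(2)])
      show "p \<cdot> h = p \<cdot> (l \<cdot> d 0)" using T lt assoc_eq[OF l(2), of "d 0"] g(2) by simp
      have "d 0 \<cdot> d (Suc 0) = Zero C (P (Suc (Suc 0))) (P 0)" using exactD(3)[OF R(6)[of 0]] T by simp
      then show "l \<cdot> d 0 \<cdot> d (Suc 0) = Zero C (P (Suc (Suc 0))) J" using T lt PO by (simp add: assoc)
    qed
  qed
  then show ?thesis using E[OF obj(1), of 1] by (simp add: numeral_2_eq_2)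
qed

section \<open>Finite coresolutions and vanishing of Ext^2 in the coresolving case\<close>

lemma coresolved_obj: "coresolved C M m \<subseteq> Obj C"
  unfolding coresolved_def using Hom_obj by blast

lemma coresolved_0:
  assumes "additive_subcategory C M" "N \<in> coresolved C M 0"
  shows "N \<in> M"
proof -
  obtain S d where S: "S (0::nat) = N" "S (Suc 0) \<in> M" "d (0::nat) \<in> Hom C (S 0) (S (Suc 0))" "is_mono C (d 0)" "is_epi C (d 0)"
    using assms(2) unfolding coresolved_def by auto
  have obj: "N \<in> Obj C" "S (Suc 0) \<in> Obj C" using S Hom_obj by blast+
  obtain g where g: "g \<in> Hom C (S (Suc 0)) N" "g \<cdot> d 0 = Ident C N" "d 0 \<cdot> g = Ident C (S (Suc 0))"
    using mono_epi_iso[OF S(4,5,3)] S(1) by auto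
  have "isomorphic C (S (Suc 0)) N" unfolding isomorphic_def using obj g S(1,3) by blast
  then show ?thesis using assms(1) S(2) unfolding additive_subcategory_def by blast
qed

text \<open>\<open>D\<close> is the image of the second arrow: it is the cokernel of
  \<open>N -> P\<close>, and its inclusion starts the remaining, shorter sequence.\<close>

lemma coresolved_Suc:
  assumes "N \<in> coresolved C M (Suc m)"
  shows "\<exists>P \<in> M. \<exists>D \<in> coresolved C M m. \<exists>f g. ses C N P D f g"
proof -
  obtain S d where S0: "S 0 = N" and SM: "\<And>j. j \<le> Suc m \<Longrightarrow> S (Suc j) \<in> M"
    and d: "\<And>j. j \<le> Suc m \<Longrightarrow> d j \<in> Hom C (S j) (S (Suc j))" and mono: "is_mono C (d 0)"
    and ex: "\<And>j. j < Suc m \<Longrightarrow> exact C (d j) (d (Suc j))" and epi: "is_epi C (d (Suc m))"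
    using assms unfolding coresolved_def by auto
  have d1: "d (Suc 0) \<in> Hom C (S (Suc 0)) (S (Suc (Suc 0)))" using d by simp
  then obtain i q where im: "is_image_fact C (d (Suc 0)) i q" using ex_image_fact by (metis Hom_iff)
  define D where "D = Dom C i"
  have i: "i \<in> Hom C D (S (Suc (Suc 0)))" "q \<in> Hom C (S (Suc 0)) D" "i \<cdot> q = d (Suc 0)" "is_mono C i" "is_epi C q"
    using image_fact_arr[OF im] d1 by (simp_all add: Hom_iff D_def)
  \<comment> \<open>The sequence moves by one place: position 0 now holds \<open>D\<close>, and
    \<open>S' (Suc j)\<close> is \<open>S (Suc (Suc j))\<close>.\<close>
  define S' where "S' = case_nat D (\<lambda>j. S (Suc (Suc j)))"
  define d' where "d' = case_nat i (\<lambda>j. d (Suc (Suc j)))"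
  have "is_kernel C (d 0) (i \<cdot> q)" using exact_mono_kernel[OF ex[of 0] mono] i(3) by simp
  then have "is_kernel C (d 0) q" by (rule kernel_comp_mono[OF _ i(4,2)]) (simp add: D_def)
  then have s: "ses C N (S (Suc 0)) D (d 0) q" using sesI_kernel[OF i(5) _ _ i(2)] d[of 0] S0 by simp
  have "D \<in> coresolved C M m"
    unfolding coresolved_def mem_Collect_eq
  proof (intro exI[of _ S'] exI[of _ d'] conjI allI impI)
    show "S' 0 = D" "is_mono C (d' 0)" using i by (simp_all add: S'_def d'_def)
    fix j assume j: "j \<le> m"
    show "S' (Suc j) \<in> M" using SM[of "Suc j"] j by (simp add: S'_def)
    show "d' j \<in> Hom C (S' j) (S' (Suc j))"
      using i(1) d[of "Suc j"] j by (cases j) (simp_all add: S'_def d'_def)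
  next
    fix j assume j: "j < m"
    show "exact C (d' j) (d' (Suc j))"
    proof (cases j)
      case 0
      then show ?thesis using kernel_exact[OF exact_image_kernel[OF ex[of "Suc 0"] im]] j by (simp add: d'_def)
    next
      case (Suc k)
      then show ?thesis using ex[of "Suc j"] j by (simp add: d'_def)
    qed
  next
    \<comment> \<open>For \<open>m = 0\<close> the last arrow is the inclusion \<open>i\<close>
      itself, which is epi because the old last arrow factors as \<open>i \<cdot> q\<close>.\<close>
    show "is_epi C (d' m)"
    proof (cases m)
      case 0
      then have "is_epi C (i \<cdot> q)" using epi i(3) by simp
      then show ?thesis using epi_right_factor[of i q] i 0 by (simp add: d'_def Hom_iff)
    next
      case (Suc k)
      then show ?thesis using epi by (simp add: d'_def)
    qed
  qed
  then show ?thesis using s SM[of 0] by blast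
qed

lemma Ext2_coresolved:
  assumes ep: "enough_projectives C" and ei: "enough_injectives C" and M: "additive_subcategory C M"
    and R: "coresolving C R" and ext: "Ext_vanishes C 1 M R"
  shows "Ext_vanishes C 2 (coresolved C M m) R"
proof -
  have cosyzygy: "\<exists>J Y' j p. injective C J \<and> Y' \<in> R \<and> ses C Y J Y' j p" if Y: "Y \<in> R" for Y
  proof -
    have "Y \<in> Obj C" using R Y unfolding coresolving_def additive_subcategory_def by blast
    then obtain J j where J: "injective C J" "j \<in> Hom C Y J" "is_mono C j"
      using ei unfolding enough_injectives_def by blast
    obtain p Y' where s: "ses C Y J Y' j p" using ses_cokernel_exists[OF J(3,2)] by blast
    have "J \<in> R" using R J(1) unfolding coresolving_def by blast
    then have "Y' \<in> R" using R s Y unfolding coresolving_def closed_under_mono_cokernels_def by blast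
    then show ?thesis using s J by blast
  qed
  \<comment> \<open>\<open>Y\<close> must vary in the induction, since each step needs the
    hypothesis for the cosyzygy \<open>Y'\<close>, which is again in \<open>R\<close>.\<close>
  have Ext1: "trivial_group (Ext C 1 N Y)" if "N \<in> coresolved C M k" "Y \<in> R" for N Y k
    using that
  proof (induction k arbitrary: N Y)
    case 0
    then show ?case using coresolved_0[OF M] ext unfolding Ext_vanishes_def by blast
  next
    case (Suc k)
    obtain P D f g where P: "P \<in> M" "D \<in> coresolved C M k" "ses C N P D f g"
      using coresolved_Suc[OF Suc.prems(1)] by blast
    obtain J Y' j p where J: "injective C J" "Y' \<in> R" "ses C Y J Y' j p" using cosyzygy[OF Suc.prems(2)] by blast
    show ?case
      using Ext1_kernel[OF ep P(3) J(3,1)] Suc.IH[OF P(2) J(2)] ext P(1) Suc.prems(2)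
      unfolding Ext_vanishes_def by blast
  qed
  show ?thesis
    unfolding Ext_vanishes_def
  proof (intro ballI)
    fix N Y assume N: "N \<in> coresolved C M m" and Y: "Y \<in> R"
    obtain J Y' j p where J: "injective C J" "Y' \<in> R" "ses C Y J Y' j p" using cosyzygy[OF Y] by blast
    show "trivial_group (Ext C 2 N Y)"
      using Ext2_shift[OF ep _ J(3,1) Ext1[OF N J(2)]] N coresolved_obj by blast
  qed
qed

end

text \<open>\<open>\<Q>\<close> stands for \<open>coresolved A \<P> (n - 1)\<close>. The class of
  right approximable objects contains all Z(X) and is closed under extensions by
  \<open>ses_combine\<close>, so it is reached by climbing the image filtration.\<close>

lemma (in eta_datum) approximation_of_image_nilpotent:
  assumes ep: "enough_projectives A"
    and R: "closed_under_extensions A \<R>" and Q: "closed_under_extensions A \<Q>"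
    and ext: "Ext_vanishes A 2 \<Q> \<R>"
    and Z: "\<And>X. X \<in> Obj B \<Longrightarrow> \<exists>R \<in> \<R>. \<exists>P \<in> \<Q>. \<exists>f g. ses A (OMap (Z_functor B F) X) R P f g"
    and U: "U \<in> Obj A" and zero: "is_zero A ((image_object B F ^^ d) U)"
  shows "\<exists>R \<in> \<R>. \<exists>P \<in> \<Q>. \<exists>f g. ses A U R P f g"
  using U zero
proof (induction d arbitrary: U)
  case 0
  then have "is_zero A U" by simp
  then show ?case using is_zero_ext[OF _ 0(1)] Z[of "fst U"] by simp
next
  case (Suc d)
  interpret E: abelian_category A by (rule abelian_ext)
  obtain X f where Xf: "U = (X, f)" by (cases U)
  have I: "image_object B F U \<in> Obj A" using ses_image_object(1) Suc.prems(1) Xf by blast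
  obtain K u v where K: "K \<in> Obj B" and s: "ses A (image_object B F U) U (OMap (Z_functor B F) K) u v"
    using ses_image_object(2) Suc.prems(1) Xf by blast
  \<comment> \<open>The iterate is unrolled at its inner end, so I(U) has index \<open>d\<close> and
    the induction hypothesis applies to it.\<close>
  have "is_zero A ((image_object B F ^^ d) (image_object B F U))"
    using Suc.prems(2) by (simp add: funpow_swap1)
  then obtain R1 P1 f1 g1 where 1: "R1 \<in> \<R>" "P1 \<in> \<Q>" "ses A (image_object B F U) R1 P1 f1 g1"
    using Suc.IH[OF I] by blast
  obtain R2 P2 f2 g2 where 2: "R2 \<in> \<R>" "P2 \<in> \<Q>" "ses A (OMap (Z_functor B F) K) R2 P2 f2 g2"
    using Z[OF K] by blast
  have "trivial_group (Ext A 2 P2 R1)" using ext 1 2 unfolding Ext_vanishes_def by blast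
  then obtain R P f g f3 g3 f4 g4 where 3: "ses A U R P f g" "ses A R1 R R2 f3 g3" "ses A P1 P P2 f4 g4"
    using E.ses_combine[OF ep s 1(3) 2(3)] by blast
  have "R \<in> \<R>" using R 3(2) 1 2 unfolding closed_under_extensions_def by blast
  moreover have "P \<in> \<Q>" using Q 3(3) 1 2 unfolding closed_under_extensions_def by blast
  ultimately show ?case using 3(1) by blast
qed

theorem theorem4p7:
  fixes B :: "('o, 'm) acat"
    and F :: "('o, 'm, 'o, 'm) fctr"
    and \<eta> :: "'o \<Rightarrow> 'm"
    and A :: "('o \<times> 'm, ('o \<times> 'm) \<times> 'm \<times> ('o \<times> 'm)) acat"
    and n :: nat
    and \<P> \<R> :: "('o \<times> 'm) set"
  assumes "abelian_category B" "enough_projectives B" "enough_injectives B"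
    and "is_additive_functor B B F" "right_exact B B F"
    and "nat_trans B B (functor_comp F F) F \<eta>" "eta_associative B F \<eta>"
    and "A = eta_extension B F \<eta>" "enough_projectives A" "enough_injectives A"
    and "image_nilpotent B F \<eta>"
    and "n \<ge> 1"
    and "additive_subcategory A \<P>" "additive_subcategory A \<R>"
  shows
    "(closed_under_extensions A \<R> \<and> closed_under_summands A \<R> \<and>
      closed_under_extensions A (coresolved A \<P> (n - 1)) \<and>
      (\<forall>i \<in> {1..n}. Ext_vanishes A i \<P> \<R>) \<and>
      Ext_vanishes A 2 (coresolved A \<P> (n - 1)) \<R> \<longrightarrow>
        (right_cotorsion_pair A n \<P> \<R> \<longleftrightarrow>
         (\<forall>X \<in> Obj B. \<exists>R \<in> \<R>. \<exists>P \<in> coresolved A \<P> (n - 1). \<exists>f g.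
            ses A (OMap (Z_functor B F) X) R P f g))) \<and>
     (coresolving A \<R> \<and> (\<forall>i \<in> {1..n}. Ext_vanishes A i \<P> \<R>) \<longrightarrow>
      Ext_vanishes A 2 (coresolved A \<P> (n - 1)) \<R>)"
proof -
  interpret D: eta_datum B F \<eta>
    using assms(1,4-6) by (intro eta_datum.intro eta_datum_axioms.intro)
  note A = \<open>A = eta_extension B F \<eta>\<close>
  interpret E: abelian_category A unfolding A by (rule D.abelian_ext)
  show ?thesis
  proof (intro conjI impI iffI ballI)
    fix X assume "right_cotorsion_pair A n \<P> \<R>" "X \<in> Obj B"
    moreover have "OMap (Z_functor B F) X \<in> Obj A"
      using D.zero_obj_ext[OF \<open>X \<in> Obj B\<close>] by (simp add: A Z_functor_def)
    ultimately show "\<exists>R \<in> \<R>. \<exists>P \<in> coresolved A \<P> (n - 1). \<exists>f g.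
        ses A (OMap (Z_functor B F) X) R P f g"
      unfolding right_cotorsion_pair_def by blast
  next
    assume H: "closed_under_extensions A \<R> \<and> closed_under_summands A \<R> \<and>
      closed_under_extensions A (coresolved A \<P> (n - 1)) \<and>
      (\<forall>i \<in> {1..n}. Ext_vanishes A i \<P> \<R>) \<and>
      Ext_vanishes A 2 (coresolved A \<P> (n - 1)) \<R>"
      and Z: "\<forall>X \<in> Obj B. \<exists>R \<in> \<R>. \<exists>P \<in> coresolved A \<P> (n - 1). \<exists>f g.
            ses A (OMap (Z_functor B F) X) R P f g"
    have "\<exists>Y \<in> \<R>. \<exists>X \<in> coresolved A \<P> (n - 1). \<exists>f g. ses A U Y X f g" if U: "U \<in> Obj A" for U
    proof -
      obtain d where "is_zero A ((image_object B F ^^ d) U)"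
        using assms(11) U unfolding image_nilpotent_def A by blast
      then show ?thesis
        using D.approximation_of_image_nilpotent[of \<R> "coresolved A \<P> (n - 1)" U d] H Z U assms(9)
        unfolding A by blast
    qed
    then show "right_cotorsion_pair A n \<P> \<R>" unfolding right_cotorsion_pair_def using H by blast
  next
    \<comment> \<open>Since \<open>n \<ge> 1\<close>, degree 1 is among the degrees in which Ext
      vanishes, and Ext^2 is derived from it.\<close>
    assume "coresolving A \<R> \<and> (\<forall>i \<in> {1..n}. Ext_vanishes A i \<P> \<R>)"
    then show "Ext_vanishes A 2 (coresolved A \<P> (n - 1)) \<R>"
      using E.Ext2_coresolved[OF assms(9,10,13)] assms(12) by simp
  qed
qed

end
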